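(* Let $X$ be a compact Hausdorff space, $\Delta_1\subset X$ clopen, $\alpha:\Delta_1\to X$ continuous with open image $\Delta_{-1}$, $\mathcal{A}=C(X)$, and let $\delta:\mathcal{A}\to\mathcal{A}$ be the endomorphism $\delta(a)=a\circ\alpha$ on $\Delta_1$, $\delta(a)=0$ off $\Delta_1$. Let $(\pi,U,H)\in\mathrm{CovFaithRep}(\mathcal{A},\delta)$, or let $(\pi,U,H)\in\mathrm{CovRep}(\mathcal{A},\delta)$ in the case $\delta$ is a monomorphism. Then the formula $$(\overline\pi\times U)\Big(\sum_{n=-N}^{N}a(n)u^n\Big)=\sum_{n=-N}^N\Big(\sum_{k=0}^\infty U^{*k}\pi(a_k^{(n)})U^k\Big)U^n,$$ where $a(n)=[a_0^{(n)},a_1^{(n)},\dots,a_k^{(n)},\dots]\in\mathcal{B}_0$, establishes an epimorphism $\overline\pi\times U$ of the covariance algebra $C^*(\mathcal{A},\delta)$ onto the $C^*$-algebra $C^*(\pi(\mathcal{A}),U)$ generated by $\pi(\mathcal{A})$ and $U$.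
   Context: $\mathbb{N}=\{0,1,2,\dots\}$; for a partial isometry $U$ and $n\in\mathbb{N}$, $U^{-n}:=U^{*n}$. For $n\ge1$, $\Delta_n$ is the domain of $\alpha^n$; $\Delta_0=X$. For a subset $K$ of a space $Y$, $C_K(Y)$ denotes the continuous functions on $Y$ vanishing outside $K$. Covariant representation: a triple $(\pi,U,H)$ where $\pi:\mathcal{A}\to L(H)$ is a representation on a Hilbert space $H$ and $U\in L(H)$ is a partial isometry with initial space $\pi(C_{\Delta_{-1}}(X))H$ and final space $\pi(C_{\Delta_1}(X))H$, such that $U\pi(a)U^*=\pi(\delta(a))$ for $a\in\mathcal{A}$. $\mathrm{CovRep}(\mathcal{A},\delta)$ is the set of all of these and $\mathrm{CovFaithRep}(\mathcal{A},\delta)$ the set of those with $\pi$ faithful. Reversible extension: adjoin to $X$ an isolated point $0$. Let $\widetilde X=\bigcup_{N\ge0}X_N\cup X_\infty\subset\prod_{n=0}^\infty(X\cup\{0\})$ with the topology induced from the product topology, where $X_N=\{(x_0,\dots,x_N,0,0,\dots):x_n\in\Delta_n,\ x_N\notin\Delta_{-1},\ \alpha(x_n)=x_{n-1}\text{ for }1\le n\le N\}$ and $X_\infty=\{(x_0,x_1,\dots):x_n\in\Delta_n,\ \alpha(x_n)=x_{n-1}\text{ for }n\ge1\}$. Let $\Phi(x_0,x_1,\dots)=x_0$, $\widetilde\Delta_{\pm1}=\Phi^{-1}(\Delta_{\pm1})$, $\widetilde\alpha:\widetilde\Delta_1\to\widetilde\Delta_{-1}$, $\widetilde\alpha(x_0,x_1,\dots)=(\alpha(x_0),x_0,x_1,\dots)$,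 a homeomorphism between clopen subsets of the compact space $\widetilde X$. For $n\in\mathbb{Z}$, $\widetilde\Delta_n$ is the domain of $\widetilde\alpha^n$. Coefficient algebra: $\mathcal{B}=C(\widetilde X)$. For $a_n\in C_{\Delta_n}(X)$ ($n\in\mathbb{N}$), only finitely many nonzero, $[a_0,a_1,\dots]\in\mathcal{B}$ is the function $\widetilde x=(x_0,x_1,\dots)\mapsto\sum_n a_n(x_n)$, with $a_n(x_n):=0$ if $x_n=0$; $\mathcal{B}_0$ is the dense $^*$-subalgebra of $\mathcal{B}$ of all such functions. Covariance algebra: $\widetilde\delta:C_{\widetilde\Delta_{-1}}(\widetilde X)\to C_{\widetilde\Delta_1}(\widetilde X)$, $\widetilde\delta(b)=b\circ\widetilde\alpha$ on $\widetilde\Delta_1$ and $0$ elsewhere, is a partial automorphism of $\mathcal{B}$. Let $L=\{a\in l^1(\mathbb{Z},\mathcal{B}):a(n)\in C_{\widetilde\Delta_n}(\widetilde X)\}$ (where $C_{\widetilde\Delta_n}(\widetilde X)$ is the domain of $\widetilde\delta^{-n}$) with $(a*b)(n)=\sum_k\widetilde\delta^k(\widetilde\delta^{-k}(a(k))b(n-k))$, $(a^* )(n)=\widetilde\delta^n(a(-n)^* )$, $\|a\|=\sum_n\|a(n)\|$. $C^*(\mathcal{A},\delta)=\mathcal{B}\rtimes_{\widetilde\delta}\mathbb{Z}$ is the universal enveloping $C^*$-algebra of $L$. $\sum_{n=-N}^N a(n)u^n$ denotes the element of $L$ with value $a(n)\in C_{\widetilde\Delta_n}(\widetilde X)$ at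 $|n|\le N$ and $0$ elsewhere. *)

theory Defs
  imports "HOL-Analysis.Analysis"
begin

section \<open>Complex Hilbert spaces and bounded operators\<close>

text \<open>The inner product is linear in the second argument; positivity and definiteness come from
  the compatibility with the norm.\<close>

class complex_hilbert_space = banach +
  fixes scaleC :: "complex \<Rightarrow> 'a \<Rightarrow> 'a" (infixr \<open>*\<^sub>C\<close> 75)
    and cinner :: "'a \<Rightarrow> 'a \<Rightarrow> complex"
  assumes scaleC_add_right: "c *\<^sub>C (x + y) = c *\<^sub>C x + c *\<^sub>C y"
    and scaleC_add_left: "(c + d) *\<^sub>C x = c *\<^sub>C x + d *\<^sub>C x"
    and scaleC_scaleC: "c *\<^sub>C (d *\<^sub>C x) = (c * d) *\<^sub>C x"
    and scaleR_scaleC: "scaleR r x = complex_of_real r *\<^sub>C x"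
    and cinner_commute: "cinner x y = cnj (cinner y x)"
    and cinner_add_right: "cinner x (y + z) = cinner x y + cinner x z"
    and cinner_scaleC_right: "cinner x (c *\<^sub>C y) = c * cinner x y"
    and norm_eq_sqrt_cinner: "norm x = sqrt (Re (cinner x x))"

instantiation complex :: complex_hilbert_space
begin

definition scaleC_complex :: "complex \<Rightarrow> complex \<Rightarrow> complex" where
  "scaleC_complex c x = c * x"

definition cinner_complex :: "complex \<Rightarrow> complex \<Rightarrow> complex" where
  "cinner_complex x y = cnj x * y"

instance
  by standard
    (auto simp: scaleC_complex_def cinner_complex_def algebra_simps scaleR_conv_of_real
      cmod_def power2_eq_square)

end

text \<open>\<open>'h \<Rightarrow>\<^sub>L 'h\<close> consists of the real-linear bounded maps; \<open>L(H)\<close> is the complex-linear part.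
  The operator norm is the norm of \<open>'h \<Rightarrow>\<^sub>L 'h\<close>.\<close>

definition bounded_ops :: "('h::complex_hilbert_space \<Rightarrow>\<^sub>L 'h) set" where
  "bounded_ops = {T :: 'h \<Rightarrow>\<^sub>L 'h. \<forall>c h. T (c *\<^sub>C h) = c *\<^sub>C T h}"

definition scale_op :: "complex \<Rightarrow> ('h::complex_hilbert_space \<Rightarrow>\<^sub>L 'h) \<Rightarrow> 'h \<Rightarrow>\<^sub>L 'h" where
  "scale_op c T = Blinfun (\<lambda>h. c *\<^sub>C T h)"

definition adj :: "('h::complex_hilbert_space \<Rightarrow>\<^sub>L 'h) \<Rightarrow> 'h \<Rightarrow>\<^sub>L 'h" where
  "adj T = (THE S :: 'h \<Rightarrow>\<^sub>L 'h. \<forall>x y. cinner (S x) y = cinner x (T y))"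

definition op_power :: "('h::complex_hilbert_space \<Rightarrow>\<^sub>L 'h) \<Rightarrow> nat \<Rightarrow> 'h \<Rightarrow>\<^sub>L 'h" where
  "op_power T n = ((\<lambda>S. T o\<^sub>L S) ^^ n) id_blinfun"

text \<open>\<open>U\<^sup>n\<close> for \<open>n \<ge> 0\<close> and \<open>U\<^sup>*\<^sup>|\<^sup>n\<^sup>|\<close> for \<open>n < 0\<close>.\<close>

definition op_power_int :: "('h::complex_hilbert_space \<Rightarrow>\<^sub>L 'h) \<Rightarrow> int \<Rightarrow> 'h \<Rightarrow>\<^sub>L 'h" where
  "op_power_int U n = (if 0 \<le> n then op_power U (nat n) else op_power (adj U) (nat (- n)))"

definition initial_space :: "('h::complex_hilbert_space \<Rightarrow>\<^sub>L 'h) \<Rightarrow> 'h set" where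
  "initial_space U = {h. \<forall>k. U k = 0 \<longrightarrow> cinner k h = 0}"

definition final_space :: "('h::complex_hilbert_space \<Rightarrow>\<^sub>L 'h) \<Rightarrow> 'h set" where
  "final_space U = range (blinfun_apply U)"

definition partial_isometry :: "('h::complex_hilbert_space \<Rightarrow>\<^sub>L 'h) \<Rightarrow> bool" where
  "partial_isometry U \<longleftrightarrow> U \<in> bounded_ops \<and> (\<forall>h\<in>initial_space U. norm (U h) = norm h)"


section \<open>Normed *-algebras and their homomorphisms\<close>

record 'a star_algebra =
  elems :: "'a set"
  add :: "'a \<Rightarrow> 'a \<Rightarrow> 'a"
  scale :: "complex \<Rightarrow> 'a \<Rightarrow> 'a"
  mult :: "'a \<Rightarrow> 'a \<Rightarrow> 'a"
  star :: "'a \<Rightarrow> 'a"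
  nrm :: "'a \<Rightarrow> real"

definition star_hom :: "'a star_algebra \<Rightarrow> 'b star_algebra \<Rightarrow> ('a \<Rightarrow> 'b) \<Rightarrow> bool" where
  "star_hom A B h \<longleftrightarrow>
     (\<forall>a\<in>elems A. h a \<in> elems B) \<and>
     (\<forall>a\<in>elems A. \<forall>b\<in>elems A. h (add A a b) = add B (h a) (h b)) \<and>
     (\<forall>c. \<forall>a\<in>elems A. h (scale A c a) = scale B c (h a)) \<and>
     (\<forall>a\<in>elems A. \<forall>b\<in>elems A. h (mult A a b) = mult B (h a) (h b)) \<and>
     (\<forall>a\<in>elems A. h (star A a) = star B (h a))"

definition star_epimorphism :: "'a star_algebra \<Rightarrow> 'b star_algebra \<Rightarrow> ('a \<Rightarrow> 'b) \<Rightarrow> bool" where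
  "star_epimorphism A B h \<longleftrightarrow> star_hom A B h \<and> h ` elems A = elems B"

definition op_algebra :: "('h::complex_hilbert_space \<Rightarrow>\<^sub>L 'h) set \<Rightarrow> ('h \<Rightarrow>\<^sub>L 'h) star_algebra" where
  "op_algebra S = \<lparr>elems = S, add = (+), scale = scale_op, mult = (o\<^sub>L), star = adj, nrm = norm\<rparr>"

definition cstar_generated :: "('h::complex_hilbert_space \<Rightarrow>\<^sub>L 'h) set \<Rightarrow> ('h \<Rightarrow>\<^sub>L 'h) set" where
  "cstar_generated G = \<Inter> {S. G \<subseteq> S \<and> S \<subseteq> bounded_ops \<and> closed S \<and> 0 \<in> S \<and>
     (\<forall>S1\<in>S. \<forall>S2\<in>S. S1 + S2 \<in> S \<and> S1 o\<^sub>L S2 \<in> S) \<and>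
     (\<forall>T\<in>S. adj T \<in> S \<and> (\<forall>c. scale_op c T \<in> S))}"


section \<open>The enveloping C*-algebra\<close>

text \<open>The universal enveloping C*-algebra of a Banach *-algebra \<open>A\<close> is the Hausdorff completion of
  \<open>A\<close> in its greatest C*-seminorm. By the Gelfand-Naimark theorem the C*-seminorms are exactly the
  seminorms \<open>a \<mapsto> \<parallel>\<rho>(a)\<parallel>\<close> for *-representations \<open>\<rho>\<close> of \<open>A\<close> on Hilbert spaces. They are
  all dominated by the norm of \<open>A\<close>; stating this as a condition makes the supremum visibly finite.\<close>

definition cstar_seminorm :: "'a star_algebra \<Rightarrow> ('a \<Rightarrow> real) \<Rightarrow> bool" where
  "cstar_seminorm A p \<longleftrightarrow>
     (\<forall>a\<in>elems A. 0 \<le> p a \<and> p a \<le> nrm A a) \<and>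
     (\<forall>a\<in>elems A. \<forall>b\<in>elems A. p (add A a b) \<le> p a + p b) \<and>
     (\<forall>c. \<forall>a\<in>elems A. p (scale A c a) = cmod c * p a) \<and>
     (\<forall>a\<in>elems A. \<forall>b\<in>elems A. p (mult A a b) \<le> p a * p b) \<and>
     (\<forall>a\<in>elems A. p (mult A (star A a) a) = (p a)\<^sup>2)"

definition env_norm :: "'a star_algebra \<Rightarrow> 'a \<Rightarrow> real" where
  "env_norm A a = Sup {p a | p. cstar_seminorm A p}"

definition env_dist :: "'a star_algebra \<Rightarrow> 'a \<Rightarrow> 'a \<Rightarrow> real" where
  "env_dist A a b = env_norm A (add A a (scale A (-1) b))"

definition env_Cauchy :: "'a star_algebra \<Rightarrow> (nat \<Rightarrow> 'a) set" where
  "env_Cauchy A = {s. range s \<subseteq> elems A \<and>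
     (\<forall>e>0. \<exists>M. \<forall>m\<ge>M. \<forall>n\<ge>M. env_dist A (s m) (s n) < e)}"

definition env_rel :: "'a star_algebra \<Rightarrow> ((nat \<Rightarrow> 'a) \<times> (nat \<Rightarrow> 'a)) set" where
  "env_rel A = {(s, t). s \<in> env_Cauchy A \<and> t \<in> env_Cauchy A \<and>
     (\<lambda>n. env_dist A (s n) (t n)) \<longlonglongrightarrow> 0}"

definition env_embed :: "'a star_algebra \<Rightarrow> 'a \<Rightarrow> (nat \<Rightarrow> 'a) set" where
  "env_embed A a = env_rel A `` {\<lambda>_. a}"

definition env_lift1 :: "'a star_algebra \<Rightarrow> ('a \<Rightarrow> 'a) \<Rightarrow> (nat \<Rightarrow> 'a) set \<Rightarrow> (nat \<Rightarrow> 'a) set" where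
  "env_lift1 A f S = (\<Union>s\<in>S. env_rel A `` {\<lambda>n. f (s n)})"

definition env_lift2 ::
  "'a star_algebra \<Rightarrow> ('a \<Rightarrow> 'a \<Rightarrow> 'a) \<Rightarrow> (nat \<Rightarrow> 'a) set \<Rightarrow> (nat \<Rightarrow> 'a) set \<Rightarrow> (nat \<Rightarrow> 'a) set" where
  "env_lift2 A f S T = (\<Union>s\<in>S. \<Union>t\<in>T. env_rel A `` {\<lambda>n. f (s n) (t n)})"

definition enveloping_cstar :: "'a star_algebra \<Rightarrow> (nat \<Rightarrow> 'a) set star_algebra" where
  "enveloping_cstar A =
    \<lparr>elems = env_Cauchy A // env_rel A,
     add = env_lift2 A (add A),
     scale = (\<lambda>c. env_lift1 A (scale A c)),
     mult = env_lift2 A (mult A),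
     star = env_lift1 A (star A),
     nrm = (\<lambda>S. THE r. \<forall>s\<in>S. (\<lambda>n. env_norm A (s n)) \<longlonglongrightarrow> r)\<rparr>"


section \<open>Function algebras\<close>

definition C_on :: "'y topology \<Rightarrow> 'y set \<Rightarrow> ('y \<Rightarrow> complex) set" where
  "C_on Y K = {f. continuous_map Y euclidean f \<and> (\<forall>y. y \<notin> K \<longrightarrow> f y = 0)}"

text \<open>Elements of \<open>C(Y)\<close> are extended by \<open>0\<close> to the whole type, so the supremum below is the
  one over \<open>Y\<close> (also for empty \<open>Y\<close>).\<close>

abbreviation C_all :: "'y topology \<Rightarrow> ('y \<Rightarrow> complex) set" where
  "C_all Y \<equiv> C_on Y (topspace Y)"

definition sup_norm :: "('y \<Rightarrow> complex) \<Rightarrow> real" where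
  "sup_norm f = (SUP y. cmod (f y))"

definition C_algebra :: "'y topology \<Rightarrow> ('y \<Rightarrow> complex) star_algebra" where
  "C_algebra Y =
    \<lparr>elems = C_all Y, add = (\<lambda>f g y. f y + g y), scale = (\<lambda>c f y. c * f y),
     mult = (\<lambda>f g y. f y * g y), star = (\<lambda>f y. cnj (f y)), nrm = sup_norm\<rparr>"

definition pullback :: "'y set \<Rightarrow> ('y \<Rightarrow> 'y) \<Rightarrow> ('y \<Rightarrow> complex) \<Rightarrow> 'y \<Rightarrow> complex" where
  "pullback D f b = (\<lambda>y. if y \<in> D then b (f y) else 0)"

text \<open>Domain of the \<open>n\<close>-th power of the partial map \<open>f : D \<rightarrow> S\<close>, \<open>D \<subseteq> S\<close>.\<close>

fun power_dom :: "'y set \<Rightarrow> 'y set \<Rightarrow> ('y \<Rightarrow> 'y) \<Rightarrow> nat \<Rightarrow> 'y set" where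
  "power_dom S D f 0 = S"
| "power_dom S D f (Suc n) = {y\<in>D. f y \<in> power_dom S D f n}"


section \<open>Covariant representations\<close>

text \<open>\<open>X\<close> is the space, \<open>D = \<Delta>\<^sub>1\<close> the domain of \<open>\<alpha>\<close> and \<open>\<alpha> ` D = \<Delta>\<^sub>-\<^sub>1\<close> its image.\<close>

definition cov_rep ::
  "'x topology \<Rightarrow> 'x set \<Rightarrow> ('x \<Rightarrow> 'x) \<Rightarrow>
   (('x \<Rightarrow> complex) \<Rightarrow> 'h::complex_hilbert_space \<Rightarrow>\<^sub>L 'h) \<Rightarrow> ('h \<Rightarrow>\<^sub>L 'h) \<Rightarrow> bool" where
  "cov_rep X D \<alpha> \<pi> U \<longleftrightarrow>
     star_hom (C_algebra X) (op_algebra bounded_ops) \<pi> \<and>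
     partial_isometry U \<and>
     initial_space U = {\<pi> a h | a h. a \<in> C_on X (\<alpha> ` D)} \<and>
     final_space U = {\<pi> a h | a h. a \<in> C_on X D} \<and>
     (\<forall>a\<in>C_all X. U o\<^sub>L \<pi> a o\<^sub>L adj U = \<pi> (pullback D \<alpha> a))"

definition cov_faith_rep ::
  "'x topology \<Rightarrow> 'x set \<Rightarrow> ('x \<Rightarrow> 'x) \<Rightarrow>
   (('x \<Rightarrow> complex) \<Rightarrow> 'h::complex_hilbert_space \<Rightarrow>\<^sub>L 'h) \<Rightarrow> ('h \<Rightarrow>\<^sub>L 'h) \<Rightarrow> bool" where
  "cov_faith_rep X D \<alpha> \<pi> U \<longleftrightarrow> cov_rep X D \<alpha> \<pi> U \<and> inj_on \<pi> (C_all X)"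


section \<open>The reversible extension\<close>

text \<open>\<open>X \<union> {0}\<close> is \<open>'x option\<close>, with \<open>None\<close> as the isolated point \<open>0\<close>.\<close>

definition adjoin_point :: "'x topology \<Rightarrow> 'x option topology" where
  "adjoin_point X = topology (\<lambda>V. openin X (Some -` V))"

lemma openin_adjoin_point: "openin (adjoin_point X) V \<longleftrightarrow> openin X (Some -` V)"
proof -
  have "istopology (\<lambda>V. openin X (Some -` V))"
    by (auto simp: istopology_def vimage_Union)
  then show ?thesis
    by (simp add: adjoin_point_def topology_inverse')
qed

lemma topspace_adjoin_point: "topspace (adjoin_point X) = insert None (Some ` topspace X)"
proof -
  have "openin (adjoin_point X) (insert None (Some ` topspace X))"
    by (simp add: openin_adjoin_point vimage_def image_iff)
  moreover have "V \<subseteq> insert None (Some ` topspace X)" if "openin (adjoin_point X) V" for V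
    using that openin_subset[of X "Some -` V"]
    by (force simp: openin_adjoin_point split: option.split intro: option.exhaust)
  ultimately show ?thesis
    by (metis openin_subset openin_topspace subset_antisym)
qed

definition ext_fin ::
  "'x topology \<Rightarrow> 'x set \<Rightarrow> ('x \<Rightarrow> 'x) \<Rightarrow> nat \<Rightarrow> (nat \<Rightarrow> 'x option) set" where
  "ext_fin X D \<alpha> N = {(\<lambda>n. if n \<le> N then Some (x n) else None) | x.
     (\<forall>n\<le>N. x n \<in> power_dom (topspace X) D \<alpha> n) \<and> x N \<notin> \<alpha> ` D \<and>
     (\<forall>n\<in>{1..N}. \<alpha> (x n) = x (n - 1))}"

definition ext_inf ::
  "'x topology \<Rightarrow> 'x set \<Rightarrow> ('x \<Rightarrow> 'x) \<Rightarrow> (nat \<Rightarrow> 'x option) set" where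
  "ext_inf X D \<alpha> = {(\<lambda>n. Some (x n)) | x.
     (\<forall>n. x n \<in> power_dom (topspace X) D \<alpha> n) \<and> (\<forall>n\<ge>1. \<alpha> (x n) = x (n - 1))}"

definition ext_space ::
  "'x topology \<Rightarrow> 'x set \<Rightarrow> ('x \<Rightarrow> 'x) \<Rightarrow> (nat \<Rightarrow> 'x option) topology" where
  "ext_space X D \<alpha> = subtopology (product_topology (\<lambda>_. adjoin_point X) UNIV)
     ((\<Union>N. ext_fin X D \<alpha> N) \<union> ext_inf X D \<alpha>)"

text \<open>On the extension the zeroth coordinate is never the point \<open>0\<close>.\<close>

definition ext_proj :: "(nat \<Rightarrow> 'x option) \<Rightarrow> 'x" where
  "ext_proj x = the (x 0)"

definition ext_map :: "('x \<Rightarrow> 'x) \<Rightarrow> (nat \<Rightarrow> 'x option) \<Rightarrow> nat \<Rightarrow> 'x option" where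
  "ext_map \<alpha> x = case_nat (Some (\<alpha> (ext_proj x))) x"

definition ext_preimage ::
  "'x topology \<Rightarrow> 'x set \<Rightarrow> ('x \<Rightarrow> 'x) \<Rightarrow> 'x set \<Rightarrow> (nat \<Rightarrow> 'x option) set" where
  "ext_preimage X D \<alpha> K = {x \<in> topspace (ext_space X D \<alpha>). ext_proj x \<in> K}"

text \<open>The domain of the \<open>n\<close>-th power of the extended map, \<open>n\<close> an integer; \<open>ext_dom X D \<alpha> 1\<close> is
  the preimage of \<open>\<Delta>\<^sub>1\<close> and \<open>ext_dom X D \<alpha> (-1)\<close> the preimage of \<open>\<Delta>\<^sub>-\<^sub>1\<close>.\<close>

definition ext_dom ::
  "'x topology \<Rightarrow> 'x set \<Rightarrow> ('x \<Rightarrow> 'x) \<Rightarrow> int \<Rightarrow> (nat \<Rightarrow> 'x option) set" where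
  "ext_dom X D \<alpha> n =
    (if 0 \<le> n
     then power_dom (topspace (ext_space X D \<alpha>)) (ext_preimage X D \<alpha> D) (ext_map \<alpha>) (nat n)
     else power_dom (topspace (ext_space X D \<alpha>)) (ext_preimage X D \<alpha> (\<alpha> ` D))
            (inv_into (ext_preimage X D \<alpha> D) (ext_map \<alpha>)) (nat (- n)))"

text \<open>The function \<open>[a\<^sub>0, a\<^sub>1, \<dots>]\<close>; for admissible \<open>a\<close> only finitely many terms are nonzero.\<close>

definition coeff_fun ::
  "'x topology \<Rightarrow> 'x set \<Rightarrow> ('x \<Rightarrow> 'x) \<Rightarrow> (nat \<Rightarrow> 'x \<Rightarrow> complex) \<Rightarrow> (nat \<Rightarrow> 'x option) \<Rightarrow> complex" where
  "coeff_fun X D \<alpha> a = (\<lambda>x. if x \<in> topspace (ext_space X D \<alpha>)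
     then \<Sum>n. (case x n of None \<Rightarrow> 0 | Some z \<Rightarrow> a n z) else 0)"

definition coeff_seq :: "'x topology \<Rightarrow> 'x set \<Rightarrow> ('x \<Rightarrow> 'x) \<Rightarrow> (nat \<Rightarrow> 'x \<Rightarrow> complex) \<Rightarrow> bool" where
  "coeff_seq X D \<alpha> a \<longleftrightarrow>
     (\<forall>n. a n \<in> C_on X (power_dom (topspace X) D \<alpha> n)) \<and> finite {n. a n \<noteq> (\<lambda>_. 0)}"


section \<open>The covariance algebra\<close>

definition ext_delta ::
  "'x topology \<Rightarrow> 'x set \<Rightarrow> ('x \<Rightarrow> 'x) \<Rightarrow>
   ((nat \<Rightarrow> 'x option) \<Rightarrow> complex) \<Rightarrow> (nat \<Rightarrow> 'x option) \<Rightarrow> complex" where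
  "ext_delta X D \<alpha> = pullback (ext_dom X D \<alpha> 1) (ext_map \<alpha>)"

text \<open>Integer powers of the partial automorphism; the \<open>n\<close>-th power is meaningful on
  \<open>C_on (ext_space X D \<alpha>) (ext_dom X D \<alpha> (- n))\<close> only.\<close>

definition ext_delta_power ::
  "'x topology \<Rightarrow> 'x set \<Rightarrow> ('x \<Rightarrow> 'x) \<Rightarrow> int \<Rightarrow>
   ((nat \<Rightarrow> 'x option) \<Rightarrow> complex) \<Rightarrow> (nat \<Rightarrow> 'x option) \<Rightarrow> complex" where
  "ext_delta_power X D \<alpha> n =
    (if 0 \<le> n then ext_delta X D \<alpha> ^^ nat n
     else inv_into (C_on (ext_space X D \<alpha>) (ext_dom X D \<alpha> (-1))) (ext_delta X D \<alpha>) ^^ nat (- n))"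

text \<open>The convolution series converges absolutely in the supremum norm, so its sum is computed
  pointwise.\<close>

definition L_algebra ::
  "'x topology \<Rightarrow> 'x set \<Rightarrow> ('x \<Rightarrow> 'x) \<Rightarrow>
   (int \<Rightarrow> (nat \<Rightarrow> 'x option) \<Rightarrow> complex) star_algebra" where
  "L_algebra X D \<alpha> =
    \<lparr>elems = {a. (\<forall>n. a n \<in> C_on (ext_space X D \<alpha>) (ext_dom X D \<alpha> n)) \<and>
                 (\<lambda>n. sup_norm (a n)) summable_on UNIV},
     add = (\<lambda>a b n x. a n x + b n x),
     scale = (\<lambda>c a n x. c * a n x),
     mult = (\<lambda>a b n x. \<Sum>\<^sub>\<infinity>k. ext_delta_power X D \<alpha> k
               (\<lambda>y. ext_delta_power X D \<alpha> (- k) (a k) y * b (n - k) y) x),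
     star = (\<lambda>a n. ext_delta_power X D \<alpha> n (\<lambda>y. cnj (a (- n) y))),
     nrm = (\<lambda>a. \<Sum>\<^sub>\<infinity>n. sup_norm (a n))\<rparr>"

definition covariance_algebra ::
  "'x topology \<Rightarrow> 'x set \<Rightarrow> ('x \<Rightarrow> 'x) \<Rightarrow>
   (nat \<Rightarrow> int \<Rightarrow> (nat \<Rightarrow> 'x option) \<Rightarrow> complex) set star_algebra" where
  "covariance_algebra X D \<alpha> = enveloping_cstar (L_algebra X D \<alpha>)"

text \<open>The element \<open>\<Sum>\<^sub>|\<^sub>n\<^sub>|\<^sub>\<le>\<^sub>N b(n) u\<^sup>n\<close> of \<open>L\<close>.\<close>

definition trig_poly ::
  "nat \<Rightarrow> (int \<Rightarrow> (nat \<Rightarrow> 'x option) \<Rightarrow> complex) \<Rightarrow> int \<Rightarrow> (nat \<Rightarrow> 'x option) \<Rightarrow> complex" where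
  "trig_poly N b = (\<lambda>n. if \<bar>n\<bar> \<le> int N then b n else (\<lambda>_. 0))"

end

theory Submission
  imports Defs
begin

text \<open>On functions \<open>[a\<^sub>0, \<dots>, a\<^sub>N]\<close> the representation is \<open>\<Sum>\<^sub>k U*\<^sup>k \<pi>(a\<^sub>k) U\<^sup>k\<close>. If \<open>x\<^sub>k\<^sub>+\<^sub>1 \<noteq> 0\<close>,
  then \<open>a\<^sub>k(x\<^sub>k) = \<delta>(a\<^sub>k)(x\<^sub>k\<^sub>+\<^sub>1)\<close>, and the operators obey the same rule; so one may assume that
  \<open>a\<^sub>0, \<dots>, a\<^sub>N\<^sub>-\<^sub>1\<close> vanish on \<open>\<Delta>\<^sub>-\<^sub>1\<close>, when every value of each \<open>a\<^sub>k\<close> is a value of the function. This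
  bounds the operator by \<open>N + 1\<close> times the supremum norm, and powers of \<open>b* b\<close> remove the factor.
  By the Stone-Weierstrass theorem the representation extends to a representation \<open>\<rho>\<close> of the
  continuous functions on the extension. It satisfies \<open>U\<^sup>k \<rho>(b) U\<^sup>m = \<rho>(\<delta>\<^sup>k(b)) U\<^sup>k\<^sup>+\<^sup>m\<close> for all
  integers \<open>k\<close>, \<open>m\<close>, whence \<open>a \<mapsto> \<Sum>\<^sub>n \<rho>(a(n)) U\<^sup>n\<close> is a contractive *-homomorphism on \<open>L\<close>, and it
  extends to the enveloping C*-algebra. The image is closed because elements of its closure can
  be lifted approximately with control of the enveloping norm; a polynomial approximation
  of the sine takes the place of spectral theory here.\<close>

section \<open>Operators on Hilbert spaces\<close>

text \<open>The main obstacle is that nothing composes as in a group. \<open>U^k U^m\<close> may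
  differ from \<open>U^(k+m)\<close> by a projection, and powers of the partial automorphism compose
  only up to a cut-off to a domain. Extending the automorphism and its inverse by zero to all
  functions makes both defects visible as one indicator function; they match, which is why the
  commutation rule holds for integers of either sign and turns the twisted convolution into
  composition of operators. The factor \<open>N + 1\<close> can be removed by taking powers only
  because products of functions with coefficients up to \<open>N\<close> again have coefficients up
  to \<open>N\<close>, so it does not grow with the power. For the closed image, every operator
  \<open>T\<close> in the closure has an approximate preimage of enveloping norm at most
  \<open>40 * norm T\<close> whose image misses \<open>T\<close> by at most
  \<open>3/4 * norm T\<close>. Iterating on the error, as in the open mapping theorem, gives an
  exact preimage in the completion. The number of factors in the approximating power may depend on
  the element, since the final bounds do not involve it.\<close>

lemma scaleC_zero_right [simp]: "c *\<^sub>C (0::'a::complex_hilbert_space) = 0"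
  using scaleC_add_right[of c "0::'a" 0] by simp

lemma scaleC_zero_left [simp]: "0 *\<^sub>C (x::'a::complex_hilbert_space) = 0"
  using scaleC_add_left[of 0 0 x] by simp

lemma scaleC_one [simp]: "1 *\<^sub>C (x::'a::complex_hilbert_space) = x"
  using scaleR_scaleC[of 1 x] by simp

lemma scaleC_minus_right: "c *\<^sub>C (- x) = - (c *\<^sub>C (x::'a::complex_hilbert_space))"
  using scaleC_add_right[of c x "- x"] by (simp add: eq_neg_iff_add_eq_0 add.commute)

lemma scaleC_minus_left: "(- c) *\<^sub>C x = - (c *\<^sub>C (x::'a::complex_hilbert_space))"
  using scaleC_add_left[of c "- c" x] by (simp add: eq_neg_iff_add_eq_0 add.commute)

lemma scaleC_diff_right: "c *\<^sub>C (x - y) = c *\<^sub>C x - c *\<^sub>C (y::'a::complex_hilbert_space)"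
  using scaleC_add_right[of c x "- y"] by (simp add: scaleC_minus_right)

lemma cinner_zero_right [simp]: "cinner x (0::'a::complex_hilbert_space) = 0"
  using cinner_add_right[of x 0 0] by simp

lemma cinner_zero_left [simp]: "cinner (0::'a::complex_hilbert_space) x = 0"
  by (subst cinner_commute) simp

lemma cinner_minus_right: "cinner x (- y) = - cinner x (y::'a::complex_hilbert_space)"
  using cinner_add_right[of x y "- y"] by (simp add: eq_neg_iff_add_eq_0 add.commute)

lemma cinner_diff_right: "cinner x (y - z) = cinner x y - cinner x (z::'a::complex_hilbert_space)"
  using cinner_add_right[of x y "- z"] by (simp add: cinner_minus_right)

lemma cinner_add_left: "cinner (x + y) z = cinner x z + cinner y (z::'a::complex_hilbert_space)"
  by (metis cinner_add_right cinner_commute complex_cnj_add)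

lemma cinner_diff_left: "cinner (x - y) z = cinner x z - cinner y (z::'a::complex_hilbert_space)"
  by (metis cinner_diff_right cinner_commute complex_cnj_diff)

lemma cinner_scaleC_left: "cinner (c *\<^sub>C x) y = cnj c * cinner x (y::'a::complex_hilbert_space)"
  by (metis cinner_scaleC_right cinner_commute complex_cnj_mult)

lemma cinner_scaleR_right:
  "cinner x (r *\<^sub>R y) = of_real r * cinner x (y::'a::complex_hilbert_space)"
  by (simp add: scaleR_scaleC cinner_scaleC_right)

lemma cinner_self: "cinner x x = of_real ((norm (x::'a::complex_hilbert_space))\<^sup>2)"
proof -
  have "Im (cinner x x) = 0"
    using cinner_commute[of x x] by (metis complex_cnj_cancel_iff complex_cnj_complex_of_real
        Reals_cnj_iff complex_is_Real_iff)
  moreover have "Re (cinner x x) \<ge> 0"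
    using norm_eq_sqrt_cinner[of x] norm_ge_zero[of x] real_sqrt_lt_0_iff[of "Re (cinner x x)"]
    by linarith
  ultimately show ?thesis
    by (simp add: complex_eq_iff norm_eq_sqrt_cinner)
qed

lemma Re_cinner_self: "Re (cinner x x) = (norm (x::'a::complex_hilbert_space))\<^sup>2"
  by (simp add: cinner_self)

lemma norm_scaleC: "norm (c *\<^sub>C x) = cmod c * norm (x::'a::complex_hilbert_space)"
proof -
  have "complex_of_real ((norm (c *\<^sub>C x))\<^sup>2) = cnj c * c * of_real ((norm x)\<^sup>2)"
    by (simp only: cinner_self[symmetric] cinner_scaleC_left cinner_scaleC_right ac_simps)
  also have "\<dots> = of_real ((cmod c * norm x)\<^sup>2)"
    by (metis complex_norm_square mult.commute of_real_mult power_mult_distrib)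
  finally have "(norm (c *\<^sub>C x))\<^sup>2 = (cmod c * norm x)\<^sup>2"
    using of_real_eq_iff by blast
  then show ?thesis by simp
qed

lemma cinner_zero_iff:
  fixes x :: "'a::complex_hilbert_space"
  assumes "\<And>y. cinner y x = 0"
  shows "x = 0"
  using assms[of x] by (simp add: cinner_self)

lemma cinner_eqI:
  fixes x :: "'a::complex_hilbert_space"
  assumes "\<And>z. cinner z x = cinner z y"
  shows "x = y"
  using cinner_zero_iff[of "x - y"] assms by (simp add: cinner_diff_right)

lemma cinner_eqI_left:
  fixes x :: "'a::complex_hilbert_space"
  assumes "\<And>z. cinner x z = cinner y z"
  shows "x = y"
  by (rule cinner_eqI) (metis assms cinner_commute)

lemma norm_diff_square:
  "(norm (x - y))\<^sup>2 = (norm x)\<^sup>2 + (norm y)\<^sup>2 - 2 * Re (cinner x (y::'a::complex_hilbert_space))"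
proof -
  have "Re (cinner y x) = Re (cinner x y)"
    by (subst cinner_commute) simp
  then show ?thesis
    unfolding Re_cinner_self[symmetric] by (simp add: cinner_diff_left cinner_diff_right)
qed

lemma norm_add_square:
  "(norm (x + y))\<^sup>2 = (norm x)\<^sup>2 + (norm y)\<^sup>2 + 2 * Re (cinner x (y::'a::complex_hilbert_space))"
  using norm_diff_square[of x "- y"] by (simp add: cinner_minus_right)

lemma Re_cinner_le: "Re (cinner x y) \<le> norm x * norm (y::'a::complex_hilbert_space)"
proof (cases "x = 0 \<or> y = 0")
  case False
  \<comment> \<open>This scale gives \<open>s *\<^sub>R x\<close> the norm of \<open>y\<close>, so
    that the expanded square of the difference is already the estimate times a constant.\<close>
  define s where "s = norm y / norm x"
  have "0 \<le> (norm (s *\<^sub>R x - y))\<^sup>2" by simp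
  also have "\<dots> = s\<^sup>2 * (norm x)\<^sup>2 + (norm y)\<^sup>2 - 2 * s * Re (cinner x y)"
    by (simp add: norm_diff_square power_mult_distrib scaleR_scaleC norm_scaleC cinner_scaleC_left)
  also have "s\<^sup>2 * (norm x)\<^sup>2 = (norm y)\<^sup>2"
    using False by (simp add: s_def power_divide)
  finally have "s * Re (cinner x y) \<le> (norm y)\<^sup>2" by simp
  then show ?thesis
    using False by (simp add: s_def field_simps power2_eq_square)
qed auto

lemma cauchy_schwarz: "cmod (cinner x y) \<le> norm x * norm (y::'a::complex_hilbert_space)"
proof (cases "cinner x y = 0")
  case False
  define c where "c = cnj (cinner x y) / of_real (cmod (cinner x y))"
  have "cmod c = 1"
    using False by (simp add: c_def norm_divide)
  have "cinner x (c *\<^sub>C y) = of_real (cmod (cinner x y))"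
    using False complex_norm_square[of "cinner x y"]
    by (simp add: c_def cinner_scaleC_right power2_eq_square mult.commute divide_eq_eq)
  then show ?thesis
    using Re_cinner_le[of x "c *\<^sub>C y"] \<open>cmod c = 1\<close> by (simp add: norm_scaleC)
qed simp

section \<open>Riesz representation and adjoints\<close>

lemma bounded_linear_cinner_right: "bounded_linear (cinner (x::'a::complex_hilbert_space))"
proof (rule bounded_linear_intro[where K = "norm x"])
  show "cmod (cinner x y) \<le> norm y * norm x" for y
    using cauchy_schwarz[of x y] by (simp add: mult.commute)
qed (auto simp: cinner_add_right cinner_scaleR_right scaleR_conv_of_real)

lemma bounded_linear_scaleC: "bounded_linear (\<lambda>x::'a::complex_hilbert_space. c *\<^sub>C x)"
proof (rule bounded_linear_intro[where K = "cmod c"])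
  show "norm (c *\<^sub>C x) \<le> norm x * cmod c" for x :: 'a
    by (simp add: norm_scaleC mult.commute)
qed (auto simp: scaleC_add_right scaleR_scaleC scaleC_scaleC mult.commute)

text \<open>The representing vector is a multiple of the point of the hyperplane
  \<open>f x = 1\<close> nearest to the origin; nearness makes it orthogonal to the kernel of
  \<open>f\<close>.\<close>

lemma riesz_representation:
  fixes f :: "'h::complex_hilbert_space \<Rightarrow> complex"
  assumes bl: "bounded_linear f" and cl: "\<And>c x. f (c *\<^sub>C x) = c * f x"
  shows "\<exists>y. \<forall>x. f x = cinner y x"
proof (cases "\<forall>x. f x = 0")
  case True
  then show ?thesis by (intro exI[of _ 0]) simp
next
  case False
  interpret f: bounded_linear f by (rule bl)
  from False obtain v where "f v \<noteq> 0" by blast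
  define K where "K = {x. f x = 1}"
  have "f ((1 / f v) *\<^sub>C v) = 1" using \<open>f v \<noteq> 0\<close> by (simp add: cl)
  then have ne: "K \<noteq> {}" by (auto simp: K_def)
  define m where "m = Inf (norm ` K)"
  have bdd: "bdd_below (norm ` K)" by (rule bdd_belowI[of _ 0]) auto
  have m_le: "m \<le> norm x" if "x \<in> K" for x
    unfolding m_def using that bdd by (intro cInf_lower) auto
  have m0: "0 \<le> m"
    unfolding m_def using ne by (intro cInf_greatest) auto
  have "\<exists>x\<in>K. norm x < m + 1 / real (Suc n)" for n
    using cInf_lessD[of "norm ` K" "m + 1 / real (Suc n)"] ne by (auto simp: m_def)
  then obtain s where sK: "\<And>n. s n \<in> K" and s_lt: "\<And>n. norm (s n) < m + 1 / real (Suc n)"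
    by metis
  have lim_norm: "(\<lambda>n. norm (s n)) \<longlonglongrightarrow> m"
  proof (rule real_tendsto_sandwich[of "\<lambda>_. m" _ _ "\<lambda>n. m + 1 / real (Suc n)"])
    show "(\<lambda>n. m + 1 / real (Suc n)) \<longlonglongrightarrow> m"
      using tendsto_add[OF tendsto_const LIMSEQ_inverse_real_of_nat, of m]
      by (simp add: inverse_eq_divide)
  qed (use m_le sK s_lt in \<open>auto intro!: always_eventually less_imp_le\<close>)
  \<comment> \<open>Parallelogram law: the midpoint of two points of \<open>K\<close> lies in
    \<open>K\<close>, so their sum has norm at least \<open>2 * m\<close>.\<close>
  have par: "(norm (s i - s j))\<^sup>2 \<le> 2 * (norm (s i))\<^sup>2 + 2 * (norm (s j))\<^sup>2 - 4 * m\<^sup>2" for i j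
  proof -
    have "(1/2) *\<^sub>R (s i + s j) \<in> K"
      using sK[of i] sK[of j] by (simp add: K_def f.scaleR f.add scaleR_conv_of_real)
    then have "m \<le> norm ((1/2) *\<^sub>R (s i + s j))" by (rule m_le)
    then have "(2 * m)\<^sup>2 \<le> (norm (s i + s j))\<^sup>2"
      using m0 by (intro power_mono) auto
    then show ?thesis
      using norm_add_square[of "s i" "s j"] norm_diff_square[of "s i" "s j"]
      by (simp add: power_mult_distrib)
  qed
  have "Cauchy s"
  proof (rule metric_CauchyI)
    fix e :: real assume "e > 0"
    have "(\<lambda>n. 2 * (norm (s n))\<^sup>2 - 2 * m\<^sup>2) \<longlonglongrightarrow> 2 * m\<^sup>2 - 2 * m\<^sup>2"
      by (intro tendsto_intros lim_norm)
    then have "\<forall>\<^sub>F n in sequentially. 2 * (norm (s n))\<^sup>2 - 2 * m\<^sup>2 < e\<^sup>2 / 2"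
      using \<open>e > 0\<close> by (intro order_tendstoD) auto
    then obtain M where M: "\<And>n. n \<ge> M \<Longrightarrow> 2 * (norm (s n))\<^sup>2 - 2 * m\<^sup>2 < e\<^sup>2 / 2"
      by (auto simp: eventually_sequentially)
    have "dist (s i) (s j) < e" if "i \<ge> M" "j \<ge> M" for i j
    proof -
      have "(norm (s i - s j))\<^sup>2 < e\<^sup>2"
        using par[of i j] M[OF that(1)] M[OF that(2)] by linarith
      then show ?thesis
        using \<open>e > 0\<close> by (simp add: dist_norm power2_less_imp_less)
    qed
    then show "\<exists>M. \<forall>i\<ge>M. \<forall>j\<ge>M. dist (s i) (s j) < e" by blast
  qed
  then obtain z where z: "s \<longlonglongrightarrow> z"
    by (meson Cauchy_convergent_iff convergent_def)
  have "f z = 1"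
  proof -
    have "(\<lambda>n. f (s n)) \<longlonglongrightarrow> f z" by (intro f.tendsto z)
    moreover have "(\<lambda>n. f (s n)) = (\<lambda>_. 1)" using sK by (auto simp: K_def)
    ultimately show ?thesis by (simp add: LIMSEQ_const_iff)
  qed
  have "norm z = m"
    using lim_norm tendsto_norm[OF z] LIMSEQ_unique by blast
  have z0: "z \<noteq> 0" using \<open>f z = 1\<close> f.zero by auto
  have orth: "cinner z w = 0" if "f w = 0" for w
  proof (cases "w = 0")
    case False
    \<comment> \<open>The coefficient of the projection of \<open>z\<close> to \<open>w\<close>.
      Subtracting that projection stays in \<open>K\<close>, so minimality of \<open>norm z\<close>
      forces it to vanish.\<close>
    define c where "c = cinner w z / of_real ((norm w)\<^sup>2)"
    have "f (z - c *\<^sub>C w) = 1"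
      by (simp add: f.diff cl that \<open>f z = 1\<close>)
    then have "(norm z)\<^sup>2 \<le> (norm (z - c *\<^sub>C w))\<^sup>2"
      using m_le[of "z - c *\<^sub>C w"] \<open>norm z = m\<close> m0 by (simp add: K_def)
    also have "\<dots> = (norm z)\<^sup>2 + (cmod c * norm w)\<^sup>2 - 2 * Re (c * cinner z w)"
      by (simp add: norm_diff_square norm_scaleC cinner_scaleC_right)
    also have "c * cinner z w = of_real ((cmod (cinner z w))\<^sup>2 / (norm w)\<^sup>2)"
      using cinner_commute[of w z] complex_norm_square[of "cinner z w"]
      by (simp add: c_def mult.commute)
    also have "(cmod c * norm w)\<^sup>2 = (cmod (cinner z w))\<^sup>2 / (norm w)\<^sup>2"
    proof -
      have "cmod (cinner z w) = cmod (cinner w z)"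
        by (metis cinner_commute complex_mod_cnj)
      then have "cmod c = cmod (cinner z w) / (norm w)\<^sup>2"
        by (simp add: c_def norm_divide norm_power)
      then show ?thesis
        using False by (simp add: power_mult_distrib power_divide power2_eq_square)
    qed
    finally have "(cmod (cinner z w))\<^sup>2 / (norm w)\<^sup>2 \<le> 0" by simp
    then show ?thesis
      using False by (simp add: divide_le_0_iff)
  qed simp
  have "f x = cinner ((1 / of_real ((norm z)\<^sup>2)) *\<^sub>C z) x" for x
  proof -
    have "f (x - f x *\<^sub>C z) = 0" by (simp add: f.diff cl \<open>f z = 1\<close>)
    then have "cinner z x = f x * of_real ((norm z)\<^sup>2)"
      using orth by (fastforce simp: cinner_diff_right cinner_scaleC_right cinner_self)
    then show ?thesis
      using z0 by (simp add: cinner_scaleC_left)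
  qed
  then show ?thesis by blast
qed

lemma bounded_opsD: "T \<in> bounded_ops \<Longrightarrow> blinfun_apply T (c *\<^sub>C h) = c *\<^sub>C T h"
  by (simp add: bounded_ops_def)

text \<open>Riesz supplies the value at each \<open>x\<close> separately; linearity comes from
  uniqueness, and the bound from pairing \<open>s x\<close> with itself.\<close>

lemma adjoint_exists:
  fixes T :: "'h::complex_hilbert_space \<Rightarrow>\<^sub>L 'h"
  assumes T: "T \<in> bounded_ops"
  shows "\<exists>S :: 'h \<Rightarrow>\<^sub>L 'h. \<forall>x y. cinner (S x) y = cinner x (T y)"
proof -
  have "\<exists>z. \<forall>y. cinner x (T y) = cinner z y" for x
  proof (rule riesz_representation)
    show "bounded_linear (\<lambda>y. cinner x (T y))"
      using bounded_linear_compose[OF bounded_linear_cinner_right blinfun.bounded_linear_right] .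
  qed (simp add: bounded_opsD[OF T] cinner_scaleC_right)
  then obtain s where s: "\<And>x y. cinner x (T y) = cinner (s x) y" by metis
  have "bounded_linear s"
  proof (rule bounded_linear_intro[where K = "norm T"])
    show "s (x + y) = s x + s y" for x y
      by (rule cinner_eqI_left) (simp add: s[symmetric] cinner_add_left)
    show "s (r *\<^sub>R x) = r *\<^sub>R s x" for r x
      by (rule cinner_eqI_left) (simp add: s[symmetric] scaleR_scaleC cinner_scaleC_left)
    show "norm (s x) \<le> norm x * norm T" for x
    proof (cases "s x = 0")
      case False
      have "(norm (s x))\<^sup>2 = Re (cinner x (T (s x)))"
        by (simp add: s Re_cinner_self)
      also have "\<dots> \<le> norm x * norm (T (s x))" by (rule Re_cinner_le)
      also have "\<dots> \<le> norm x * (norm T * norm (s x))"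
        by (intro mult_left_mono norm_blinfun) simp
      finally show ?thesis using False by (simp add: power2_eq_square)
    qed simp
  qed
  then show ?thesis
    by (intro exI[of _ "Blinfun s"]) (simp add: bounded_linear_Blinfun_apply s)
qed

lemma adj_eqI:
  fixes S T :: "'h::complex_hilbert_space \<Rightarrow>\<^sub>L 'h"
  assumes "\<And>x y. cinner (S x) y = cinner x (T y)"
  shows "adj T = S"
  unfolding adj_def
proof (rule the_equality)
  fix S' :: "'h \<Rightarrow>\<^sub>L 'h"
  assume "\<forall>x y. cinner (S' x) y = cinner x (T y)"
  then show "S' = S"
    by - (rule blinfun_eqI, rule cinner_eqI_left, simp add: assms)
qed (simp add: assms)

lemma cinner_adj_left:
  fixes T :: "'h::complex_hilbert_space \<Rightarrow>\<^sub>L 'h"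
  assumes "T \<in> bounded_ops"
  shows "cinner (adj T x) y = cinner x (T y)"
proof -
  obtain S :: "'h \<Rightarrow>\<^sub>L 'h" where S: "\<And>x y. cinner (S x) y = cinner x (T y)"
    using adjoint_exists[OF assms] by blast
  then show ?thesis by (simp add: adj_eqI[OF S])
qed

lemma cinner_adj_right:
  fixes T :: "'h::complex_hilbert_space \<Rightarrow>\<^sub>L 'h"
  assumes "T \<in> bounded_ops"
  shows "cinner x (adj T y) = cinner (T x) y"
  by (metis assms cinner_adj_left cinner_commute)

lemma adj_bounded_ops [simp, intro]: "T \<in> bounded_ops \<Longrightarrow> adj T \<in> bounded_ops"
  unfolding bounded_ops_def mem_Collect_eq
  by (intro allI, rule cinner_eqI_left)
    (simp add: cinner_adj_left cinner_scaleC_left cinner_scaleC_right bounded_ops_def)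

lemma scale_op_apply [simp]: "blinfun_apply (scale_op c T) h = c *\<^sub>C T h"
  unfolding scale_op_def
  by (subst bounded_linear_Blinfun_apply)
    (auto intro: bounded_linear_compose[OF bounded_linear_scaleC blinfun.bounded_linear_right])

lemma bounded_ops_intros [simp, intro]:
  "0 \<in> bounded_ops"
  "id_blinfun \<in> bounded_ops"
  "S \<in> bounded_ops \<Longrightarrow> T \<in> bounded_ops \<Longrightarrow> S + T \<in> bounded_ops"
  "S \<in> bounded_ops \<Longrightarrow> T \<in> bounded_ops \<Longrightarrow> S - T \<in> bounded_ops"
  "S \<in> bounded_ops \<Longrightarrow> T \<in> bounded_ops \<Longrightarrow> S o\<^sub>L T \<in> bounded_ops"
  "T \<in> bounded_ops \<Longrightarrow> scale_op c T \<in> bounded_ops"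
  by (auto simp: bounded_ops_def blinfun.bilinear_simps scaleC_add_right scaleC_diff_right
      scaleC_scaleC mult.commute)

lemma closed_bounded_ops: "closed (bounded_ops :: ('h::complex_hilbert_space \<Rightarrow>\<^sub>L 'h) set)"
proof -
  have "closed {T :: 'h \<Rightarrow>\<^sub>L 'h. T (c *\<^sub>C h) = c *\<^sub>C T h}" for c h
    by (intro closed_Collect_eq continuous_intros
        bounded_linear.continuous_on[OF bounded_linear_scaleC])
  then have "closed (\<Inter>c. \<Inter>h. {T :: 'h \<Rightarrow>\<^sub>L 'h. T (c *\<^sub>C h) = c *\<^sub>C T h})"
    by (intro closed_INT ballI)
  also have "(\<Inter>c. \<Inter>h. {T :: 'h \<Rightarrow>\<^sub>L 'h. T (c *\<^sub>C h) = c *\<^sub>C T h}) = bounded_ops"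
    by (auto simp: bounded_ops_def)
  finally show ?thesis .
qed

lemma adj_add: "S \<in> bounded_ops \<Longrightarrow> T \<in> bounded_ops \<Longrightarrow> adj (S + T) = adj S + adj T"
  by (rule adj_eqI)
    (simp add: blinfun.bilinear_simps cinner_add_left cinner_add_right cinner_adj_left)

lemma adj_diff: "S \<in> bounded_ops \<Longrightarrow> T \<in> bounded_ops \<Longrightarrow> adj (S - T) = adj S - adj T"
  by (rule adj_eqI)
    (simp add: blinfun.bilinear_simps cinner_diff_left cinner_diff_right cinner_adj_left)

lemma adj_comp: "S \<in> bounded_ops \<Longrightarrow> T \<in> bounded_ops \<Longrightarrow> adj (S o\<^sub>L T) = adj T o\<^sub>L adj S"
  by (rule adj_eqI) (simp add: cinner_adj_left)

lemma adj_adj [simp]: "T \<in> bounded_ops \<Longrightarrow> adj (adj T) = T"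
  by (rule adj_eqI) (simp add: cinner_adj_right)

lemma adj_id [simp]: "adj id_blinfun = id_blinfun"
  by (rule adj_eqI) simp

text \<open>Cauchy-Schwarz gives \<open>le\<close> for every \<open>S\<close>. Used for
  \<open>T\<close> and for \<open>adj T\<close> it makes their norms equal, and submultiplicativity
  then closes the C*-identity.\<close>

lemma norm_adj_comp_self:
  fixes T :: "'h::complex_hilbert_space \<Rightarrow>\<^sub>L 'h"
  assumes T: "T \<in> bounded_ops"
  shows "norm (adj T o\<^sub>L T) = (norm T)\<^sup>2"
    and norm_adj: "norm (adj T) = norm T"
proof -
  have le: "(norm S)\<^sup>2 \<le> norm (adj S o\<^sub>L S)" if "S \<in> bounded_ops" for S :: "'h \<Rightarrow>\<^sub>L 'h"
  proof -
    have "norm (S h) \<le> sqrt (norm (adj S o\<^sub>L S)) * norm h" for h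
    proof -
      have "(norm (S h))\<^sup>2 = Re (cinner h ((adj S o\<^sub>L S) h))"
        using that by (simp add: cinner_adj_right Re_cinner_self)
      also have "\<dots> \<le> norm h * norm ((adj S o\<^sub>L S) h)" by (rule Re_cinner_le)
      also have "\<dots> \<le> norm h * (norm (adj S o\<^sub>L S) * norm h)"
        by (intro mult_left_mono norm_blinfun) simp
      also have "\<dots> = (sqrt (norm (adj S o\<^sub>L S)) * norm h)\<^sup>2"
        by (simp add: power_mult_distrib power2_eq_square)
      finally show ?thesis by (rule power2_le_imp_le) simp
    qed
    then have "norm S \<le> sqrt (norm (adj S o\<^sub>L S))"
      by (intro norm_blinfun_bound) auto
    then show ?thesis
      by (simp add: real_le_rsqrt sqrt_ge_absD)
  qed
  have le2: "norm S \<le> norm (adj S)" if "S \<in> bounded_ops" for S :: "'h \<Rightarrow>\<^sub>L 'h"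
  proof (cases "S = 0")
    case False
    have "(norm S)\<^sup>2 \<le> norm (adj S) * norm S"
      using le[OF that] norm_blinfun_compose[of "adj S" S] by linarith
    then show ?thesis using False by (simp add: power2_eq_square)
  qed simp
  show eq: "norm (adj T) = norm T"
    using le2[OF T] le2[of "adj T"] T by simp
  show "norm (adj T o\<^sub>L T) = (norm T)\<^sup>2"
    using le[OF T] norm_blinfun_compose[of "adj T" T] eq by (simp add: power2_eq_square)
qed

lemma norm_scale_op: "norm (scale_op c T) = cmod c * norm T"
proof -
  have le: "norm (scale_op c T) \<le> cmod c * norm T" for c :: complex and T :: "'h::complex_hilbert_space \<Rightarrow>\<^sub>L 'h"
  proof (rule norm_blinfun_bound)
    show "norm (scale_op c T h) \<le> cmod c * norm T * norm h" for h
      using mult_left_mono[OF norm_blinfun[of T h], of "cmod c"]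
      by (simp add: norm_scaleC mult.assoc)
  qed simp
  show ?thesis
  proof (cases "c = 0")
    case True
    then show ?thesis using le[of c T] by simp
  next
    case False
    have "scale_op (1 / c) (scale_op c T) = T"
      using False by (intro blinfun_eqI) (simp add: scaleC_scaleC)
    then have "norm T \<le> cmod (1 / c) * norm (scale_op c T)"
      using le[of "1 / c" "scale_op c T"] by simp
    then show ?thesis
      using le[of c T] False by (simp add: norm_divide field_simps)
  qed
qed

lemma scale_op_simps:
  "scale_op c (S + T) = scale_op c S + scale_op c T"
  "scale_op c (S - T) = scale_op c S - scale_op c T"
  "scale_op c (scale_op d T) = scale_op (c * d) T"
  "scale_op c S o\<^sub>L T = scale_op c (S o\<^sub>L T)"
  "scale_op 1 T = T"
  "scale_op (- 1) T = - T"
  by (auto intro!: blinfun_eqI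
      simp: blinfun.bilinear_simps scaleC_add_right scaleC_diff_right scaleC_scaleC scaleC_minus_left)

lemma comp_scale_op: "S \<in> bounded_ops \<Longrightarrow> S o\<^sub>L scale_op c T = scale_op c (S o\<^sub>L T)"
  by (rule blinfun_eqI) (simp add: bounded_opsD)

lemma tendsto_scale_op:
  fixes T :: "'a::complex_hilbert_space \<Rightarrow>\<^sub>L 'a"
  shows "(f \<longlongrightarrow> T) F \<Longrightarrow> ((\<lambda>n. scale_op c (f n)) \<longlongrightarrow> scale_op c T) F"
proof -
  have "bounded_linear (scale_op c :: ('a \<Rightarrow>\<^sub>L 'a) \<Rightarrow> _)"
    by (rule bounded_linear_intro[where K = "cmod c"])
      (auto intro!: blinfun_eqI simp: norm_scale_op mult.commute blinfun.bilinear_simps scaleC_add_right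
        scaleR_scaleC scaleC_scaleC)
  then show "(f \<longlongrightarrow> T) F \<Longrightarrow> ((\<lambda>n. scale_op c (f n)) \<longlongrightarrow> scale_op c T) F"
    by (rule bounded_linear.tendsto)
qed

lemma tendsto_adj:
  assumes f: "(f \<longlongrightarrow> T) F" and F: "F \<noteq> bot" and bounded: "\<And>n. f n \<in> bounded_ops"
  shows "((\<lambda>n. adj (f n)) \<longlongrightarrow> adj T) F"
proof -
  have T: "T \<in> bounded_ops"
    using bounded by (intro Lim_in_closed_set[OF closed_bounded_ops _ F f] always_eventually) simp
  have "norm (adj (f n) - adj T) = norm (f n - T)" for n
    using bounded T by (metis adj_diff bounded_ops_intros(4) norm_adj)
  then show ?thesis
    using f by (simp add: tendsto_iff dist_norm)
qed

text \<open>Polarisation: the diagonal at \<open>x + y\<close> yields the sum and at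
  \<open>x + i y\<close> the difference of the two mixed terms.\<close>

lemma cinner_diagonal_eqI:
  fixes S T :: "'h::complex_hilbert_space \<Rightarrow>\<^sub>L 'h"
  assumes S: "S \<in> bounded_ops" and T: "T \<in> bounded_ops"
    and eq: "\<And>h. cinner h (S h) = cinner h (T h)"
  shows "S = T"
proof (rule blinfun_eqI, rule cinner_eqI)
  fix y x
  define V where "V = S - T"
  have V: "V \<in> bounded_ops" and V0: "\<And>h. cinner h (V h) = 0"
    using S T eq by (auto simp: V_def blinfun.bilinear_simps cinner_diff_right)
  have 1: "cinner x (V y) + cinner y (V x) = 0"
    using V0[of "x + y"] V0[of x] V0[of y]
    by (simp add: blinfun.bilinear_simps cinner_add_left cinner_add_right add.commute)
  have 2: "\<i> * cinner x (V y) - \<i> * cinner y (V x) = 0"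
    using V0[of "x + \<i> *\<^sub>C y"] V0[of x] V0[of y]
    by (simp add: blinfun.bilinear_simps cinner_add_left cinner_add_right bounded_opsD[OF V]
        cinner_scaleC_left cinner_scaleC_right)
  have "cinner x (V y) = cinner y (V x)"
    using 2 by (metis complex_i_not_zero mult_cancel_left right_minus_eq)
  then have "cinner x (V y) = 0" using 1 by simp
  then show "cinner x (S y) = cinner x (T y)"
    by (simp add: V_def blinfun.bilinear_simps cinner_diff_right)
qed

section \<open>Representations of enveloping C*-algebras\<close>

text \<open>The laws are relative to the carrier \<open>elems A\<close>. Products of three factors
  are never rebracketed below, whence the name; the unit is there to form powers of
  \<open>add A e w\<close>.\<close>

locale unital_nonassoc_star_algebra =
  fixes A :: "'a star_algebra" and e :: 'a
  assumes add_closed: "\<lbrakk>a \<in> elems A; b \<in> elems A\<rbrakk> \<Longrightarrow> add A a b \<in> elems A"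
    and scale_closed: "a \<in> elems A \<Longrightarrow> scale A z a \<in> elems A"
    and mult_closed: "\<lbrakk>a \<in> elems A; b \<in> elems A\<rbrakk> \<Longrightarrow> mult A a b \<in> elems A"
    and star_closed: "a \<in> elems A \<Longrightarrow> star A a \<in> elems A"
    and unit_closed: "e \<in> elems A"
    and add_assoc: "\<lbrakk>a \<in> elems A; b \<in> elems A; c \<in> elems A\<rbrakk> \<Longrightarrow>
      add A (add A a b) c = add A a (add A b c)"
    and add_commute: "\<lbrakk>a \<in> elems A; b \<in> elems A\<rbrakk> \<Longrightarrow> add A a b = add A b a"
    and add_scale_zero: "\<lbrakk>a \<in> elems A; b \<in> elems A\<rbrakk> \<Longrightarrow> add A a (scale A 0 b) = a"
    and scale_add_right: "\<lbrakk>a \<in> elems A; b \<in> elems A\<rbrakk> \<Longrightarrow>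
      scale A z (add A a b) = add A (scale A z a) (scale A z b)"
    and scale_add_left: "a \<in> elems A \<Longrightarrow> scale A (z + w) a = add A (scale A z a) (scale A w a)"
    and scale_scale: "a \<in> elems A \<Longrightarrow> scale A z (scale A w a) = scale A (z * w) a"
    and scale_one: "a \<in> elems A \<Longrightarrow> scale A 1 a = a"
    and mult_add_left: "\<lbrakk>a \<in> elems A; b \<in> elems A; c \<in> elems A\<rbrakk> \<Longrightarrow>
      mult A (add A a b) c = add A (mult A a c) (mult A b c)"
    and mult_add_right: "\<lbrakk>a \<in> elems A; b \<in> elems A; c \<in> elems A\<rbrakk> \<Longrightarrow>
      mult A a (add A b c) = add A (mult A a b) (mult A a c)"
    and mult_scale_left: "\<lbrakk>a \<in> elems A; b \<in> elems A\<rbrakk> \<Longrightarrow>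
      mult A (scale A z a) b = scale A z (mult A a b)"
    and mult_scale_right: "\<lbrakk>a \<in> elems A; b \<in> elems A\<rbrakk> \<Longrightarrow>
      mult A a (scale A z b) = scale A z (mult A a b)"
    and mult_unit_left: "a \<in> elems A \<Longrightarrow> mult A e a = a"
    and mult_unit_right: "a \<in> elems A \<Longrightarrow> mult A a e = a"
    and star_add: "\<lbrakk>a \<in> elems A; b \<in> elems A\<rbrakk> \<Longrightarrow>
      star A (add A a b) = add A (star A a) (star A b)"
    and star_scale: "a \<in> elems A \<Longrightarrow> star A (scale A z a) = scale A (cnj z) (star A a)"
    and star_star: "a \<in> elems A \<Longrightarrow> star A (star A a) = a"
    and star_unit: "star A e = e"
    and nrm_nonneg: "a \<in> elems A \<Longrightarrow> 0 \<le> nrm A a"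
begin

lemmas closed = add_closed scale_closed mult_closed star_closed unit_closed

abbreviation sub :: "'a \<Rightarrow> 'a \<Rightarrow> 'a" where
  "sub a b \<equiv> add A a (scale A (-1) b)"

lemma add_left_commute:
  "\<lbrakk>a \<in> elems A; b \<in> elems A; c \<in> elems A\<rbrakk> \<Longrightarrow> add A a (add A b c) = add A b (add A a c)"
  by (metis add_assoc add_commute)

lemmas ac = add_assoc add_commute add_left_commute

lemma sub_self: "a \<in> elems A \<Longrightarrow> sub a a = scale A 0 a"
  using scale_add_left[of a 1 "-1"] by (simp add: scale_one)

lemma sub_add_sub:
  "\<lbrakk>a \<in> elems A; b \<in> elems A; c \<in> elems A; d \<in> elems A\<rbrakk> \<Longrightarrow>
    sub (add A a b) (add A c d) = add A (sub a c) (sub b d)"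
  by (simp add: closed scale_add_right ac)

lemma add_sub_cancel:
  assumes "a \<in> elems A" "b \<in> elems A"
  shows "add A a (sub b a) = b"
proof -
  have "add A a (sub b a) = add A b (sub a a)"
    using assms by (simp add: closed ac)
  then show ?thesis using assms by (simp add: sub_self add_scale_zero)
qed

lemma sub_trans:
  assumes "a \<in> elems A" "b \<in> elems A" "c \<in> elems A"
  shows "add A (sub a b) (sub b c) = sub a c"
proof -
  have "add A (sub a b) (sub b c) = add A (sub a c) (sub b b)"
    using assms by (simp add: closed ac)
  then show ?thesis using assms by (simp add: sub_self add_scale_zero closed)
qed

lemma sub_commute: "\<lbrakk>a \<in> elems A; b \<in> elems A\<rbrakk> \<Longrightarrow> sub b a = scale A (-1) (sub a b)"
  by (simp add: closed scale_add_right scale_scale scale_one add_commute)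

lemma sub_scale: "\<lbrakk>a \<in> elems A; b \<in> elems A\<rbrakk> \<Longrightarrow> sub (scale A c a) (scale A c b) = scale A c (sub a b)"
  by (simp add: closed scale_add_right scale_scale mult.commute)

lemma sub_star: "\<lbrakk>a \<in> elems A; b \<in> elems A\<rbrakk> \<Longrightarrow> sub (star A a) (star A b) = star A (sub a b)"
  by (simp add: closed star_add star_scale)

lemma sub_mult:
  assumes "a \<in> elems A" "b \<in> elems A" "c \<in> elems A" "d \<in> elems A"
  shows "sub (mult A a b) (mult A c d) = add A (mult A a (sub b d)) (mult A (sub a c) d)"
proof -
  have "add A (mult A a (sub b d)) (mult A (sub a c) d) =
      add A (sub (mult A a b) (mult A a d)) (sub (mult A a d) (mult A c d))"
    using assms
    by (simp add: closed mult_add_right mult_add_left mult_scale_right mult_scale_left)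
  then show ?thesis using assms by (simp add: sub_trans closed)
qed

definition "hermitian a \<longleftrightarrow> a \<in> elems A \<and> star A a = a"

text \<open>Reduces lifting to hermitian elements, which are the ones that have almost unitary
  companions.\<close>

lemma hermitian_parts:
  assumes a: "a \<in> elems A"
  defines "h1 \<equiv> scale A (1/2) (add A a (star A a))"
    and "h2 \<equiv> scale A (1/(2*\<i>)) (sub a (star A a))"
  shows "hermitian h1" "hermitian h2" "add A h1 (scale A \<i> h2) = a"
proof -
  show "hermitian h1"
    using a by (simp add: hermitian_def h1_def closed star_scale star_add star_star add_commute)
  have "star A h2 = scale A (1/(2*\<i>)) (scale A (-1) (sub (star A a) a))"
    using a by (simp add: h2_def closed star_scale star_add star_star scale_scale)
  then show "hermitian h2"
    using a by (simp add: hermitian_def h2_def closed sub_commute[of "star A a" a])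
  have "add A h1 (scale A \<i> h2) = scale A (1/2) (add A (add A a (star A a)) (sub a (star A a)))"
    using a by (simp add: h1_def h2_def closed scale_scale scale_add_right)
  also have "add A (add A a (star A a)) (sub a (star A a)) =
      add A (add A a a) (sub (star A a) (star A a))"
    using a by (simp add: closed ac)
  also have "\<dots> = add A a a"
    using a by (simp add: closed sub_self add_scale_zero)
  also have "scale A (1/2) (add A a a) = a"
    using a scale_add_left[of a "1/2" "1/2"] by (simp add: scale_add_right scale_one)
  finally show "add A h1 (scale A \<i> h2) = a" .
qed

section \<open>The greatest C*-seminorm\<close>

lemma zero_cstar_seminorm: "cstar_seminorm A (\<lambda>_. 0)"
  by (simp add: cstar_seminorm_def nrm_nonneg)

lemma cstar_seminormD:
  assumes "cstar_seminorm A p"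
  shows "a \<in> elems A \<Longrightarrow> 0 \<le> p a"
    and "a \<in> elems A \<Longrightarrow> p a \<le> nrm A a"
    and "\<lbrakk>a \<in> elems A; b \<in> elems A\<rbrakk> \<Longrightarrow> p (add A a b) \<le> p a + p b"
    and "a \<in> elems A \<Longrightarrow> p (scale A c a) = cmod c * p a"
    and "\<lbrakk>a \<in> elems A; b \<in> elems A\<rbrakk> \<Longrightarrow> p (mult A a b) \<le> p a * p b"
    and "a \<in> elems A \<Longrightarrow> p (mult A (star A a) a) = (p a)\<^sup>2"
  using assms unfolding cstar_seminorm_def by blast+

lemma cstar_seminorm_le_env:
  assumes "cstar_seminorm A p" "a \<in> elems A"
  shows "p a \<le> env_norm A a"
  unfolding env_norm_def
  using assms by (intro cSup_upper) (auto simp: bdd_above_def dest: cstar_seminormD(2))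

lemma env_norm_least:
  assumes "\<And>p. cstar_seminorm A p \<Longrightarrow> p a \<le> r"
  shows "env_norm A a \<le> r"
  unfolding env_norm_def using assms zero_cstar_seminorm by (intro cSup_least) auto

text \<open>Upper estimates pass to a supremum directly. The two equalities need a converse: scaling
  is undone by \<open>1 / c\<close>, and in the C*-identity the square root is taken seminorm by
  seminorm before passing to the supremum.\<close>

lemma env_norm_cstar: "cstar_seminorm A (env_norm A)"
proof -
  note le = cstar_seminorm_le_env
  have nonneg: "0 \<le> env_norm A a" if "a \<in> elems A" for a
    using le[OF zero_cstar_seminorm that] .
  have scale_le: "env_norm A (scale A c a) \<le> cmod c * env_norm A a" if "a \<in> elems A" for c a
    by (rule env_norm_least) (simp add: cstar_seminormD(4) that mult_left_mono le)
  have scale: "env_norm A (scale A c a) = cmod c * env_norm A a" if a: "a \<in> elems A" for c a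
  proof (cases "c = 0")
    case True
    then show ?thesis
      using scale_le[OF a, of c] nonneg[of "scale A c a"] a by (simp add: closed)
  next
    case False
    then have "env_norm A a \<le> cmod (1 / c) * env_norm A (scale A c a)"
      using scale_le[of "scale A c a" "1 / c"] a by (simp add: closed scale_scale scale_one)
    then show ?thesis
      using scale_le[OF a, of c] False by (simp add: norm_divide field_simps)
  qed
  have cstar: "env_norm A (mult A (star A a) a) = (env_norm A a)\<^sup>2" if a: "a \<in> elems A" for a
  proof (rule antisym)
    show "env_norm A (mult A (star A a) a) \<le> (env_norm A a)\<^sup>2"
      by (rule env_norm_least) (simp add: cstar_seminormD that power_mono le)
    have "env_norm A a \<le> sqrt (env_norm A (mult A (star A a) a))"
    proof (rule env_norm_least)
      fix p assume p: "cstar_seminorm A p"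
      have "(p a)\<^sup>2 \<le> env_norm A (mult A (star A a) a)"
        using le[OF p, of "mult A (star A a) a"] a by (simp add: closed cstar_seminormD(6)[OF p])
      then show "p a \<le> sqrt (env_norm A (mult A (star A a) a))"
        by (rule real_le_rsqrt)
    qed
    then show "(env_norm A a)\<^sup>2 \<le> env_norm A (mult A (star A a) a)"
      using nonneg[OF a] nonneg[of "mult A (star A a) a"] a
      by (metis closed(3,4) power_mono real_sqrt_pow2)
  qed
  have "env_norm A a \<le> nrm A a" if "a \<in> elems A" for a
    by (rule env_norm_least) (simp add: cstar_seminormD that)
  moreover have "env_norm A (add A a b) \<le> env_norm A a + env_norm A b"
    if "a \<in> elems A" "b \<in> elems A" for a b
    by (rule env_norm_least)
      (meson add_mono cstar_seminormD(3) le order_trans that)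
  moreover have "env_norm A (mult A a b) \<le> env_norm A a * env_norm A b"
    if "a \<in> elems A" "b \<in> elems A" for a b
    by (rule env_norm_least)
      (meson mult_mono cstar_seminormD(1,5) le order_trans that nonneg)
  ultimately show ?thesis
    unfolding cstar_seminorm_def using nonneg scale cstar by simp
qed

lemmas env_norm_simps =
  cstar_seminormD(4)[OF env_norm_cstar] cstar_seminormD(6)[OF env_norm_cstar]
lemmas env_norm_nonneg = cstar_seminormD(1)[OF env_norm_cstar]
lemmas env_norm_add = cstar_seminormD(3)[OF env_norm_cstar]
lemmas env_norm_mult = cstar_seminormD(5)[OF env_norm_cstar]

lemma env_norm_star:
  assumes a: "a \<in> elems A"
  shows "env_norm A (star A a) = env_norm A a"
proof -
  have le: "env_norm A b \<le> env_norm A (star A b)" if b: "b \<in> elems A" for b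
  proof (cases "env_norm A b = 0")
    case False
    have "(env_norm A b)\<^sup>2 \<le> env_norm A (star A b) * env_norm A b"
      using env_norm_mult[of "star A b" b] b by (simp add: closed env_norm_simps)
    then show ?thesis
      using False env_norm_nonneg[OF b] by (simp add: power2_eq_square)
  qed (simp add: b closed env_norm_nonneg)
  show ?thesis
    using le[OF a] le[of "star A a"] a by (simp add: closed star_star)
qed

lemma env_norm_unit: "env_norm A e \<le> 1"
proof (rule ccontr)
  assume "\<not> env_norm A e \<le> 1"
  moreover have "env_norm A e = (env_norm A e)\<^sup>2"
    using env_norm_simps(2)[of e] by (simp add: closed star_unit mult_unit_left)
  ultimately show False by (simp add: power2_eq_square)
qed

section \<open>The Hausdorff completion and its operations\<close>

lemma env_dist_self: "a \<in> elems A \<Longrightarrow> env_dist A a a = 0"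
  by (simp add: env_dist_def sub_self env_norm_simps)

lemma env_dist_nonneg: "\<lbrakk>a \<in> elems A; b \<in> elems A\<rbrakk> \<Longrightarrow> 0 \<le> env_dist A a b"
  by (simp add: env_dist_def env_norm_nonneg closed)

lemma env_dist_commute: "\<lbrakk>a \<in> elems A; b \<in> elems A\<rbrakk> \<Longrightarrow> env_dist A a b = env_dist A b a"
  using sub_commute[of a b] by (simp add: env_dist_def closed env_norm_simps)

lemma env_dist_triangle:
  "\<lbrakk>a \<in> elems A; b \<in> elems A; c \<in> elems A\<rbrakk> \<Longrightarrow> env_dist A a c \<le> env_dist A a b + env_dist A b c"
  using env_norm_add[of "sub a b" "sub b c"] sub_trans[of a b c]
  by (simp add: env_dist_def closed)

lemma env_dist_add:
  "\<lbrakk>a \<in> elems A; b \<in> elems A; c \<in> elems A; d \<in> elems A\<rbrakk> \<Longrightarrow>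
    env_dist A (add A a b) (add A c d) \<le> env_dist A a c + env_dist A b d"
  using env_norm_add[of "sub a c" "sub b d"]
  by (simp only: env_dist_def closed sub_add_sub)

lemma env_dist_scale:
  "\<lbrakk>a \<in> elems A; b \<in> elems A\<rbrakk> \<Longrightarrow> env_dist A (scale A c a) (scale A c b) = cmod c * env_dist A a b"
  by (simp only: env_dist_def sub_scale) (simp add: closed env_norm_simps)

lemma env_dist_star:
  "\<lbrakk>a \<in> elems A; b \<in> elems A\<rbrakk> \<Longrightarrow> env_dist A (star A a) (star A b) = env_dist A a b"
  by (simp only: env_dist_def sub_star) (simp add: closed env_norm_star)

lemma env_dist_mult:
  assumes "a \<in> elems A" "b \<in> elems A" "c \<in> elems A" "d \<in> elems A"
  shows "env_dist A (mult A a b) (mult A c d) \<le>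
    env_norm A a * env_dist A b d + env_dist A a c * env_norm A d"
  using assms env_norm_add[of "mult A a (sub b d)" "mult A (sub a c) d"]
    env_norm_mult[of a "sub b d"] env_norm_mult[of "sub a c" d]
  by (simp add: env_dist_def closed sub_mult)

lemma env_norm_le_dist:
  assumes "a \<in> elems A" "b \<in> elems A"
  shows "env_norm A a \<le> env_norm A b + env_dist A a b"
  using assms env_norm_add[of b "sub a b"] by (simp add: env_dist_def closed add_sub_cancel)

lemma env_CauchyD: "s \<in> env_Cauchy A \<Longrightarrow> s n \<in> elems A"
  by (auto simp: env_Cauchy_def)

lemma env_Cauchy_bounded:
  assumes s: "s \<in> env_Cauchy A"
  obtains K where "K > 0" "\<And>n. env_norm A (s n) \<le> K"
proof -
  obtain M where M: "\<And>m n. m \<ge> M \<Longrightarrow> n \<ge> M \<Longrightarrow> env_dist A (s m) (s n) < 1"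
    using s by (force simp: env_Cauchy_def)
  define K where "K = 1 + (\<Sum>i\<le>M. env_norm A (s i))"
  have sum0: "0 \<le> (\<Sum>i\<in>I. env_norm A (s i))" for I
    by (intro sum_nonneg) (simp add: env_norm_nonneg env_CauchyD[OF s])
  have le: "env_norm A (s i) \<le> (\<Sum>i\<le>M. env_norm A (s i))" if "i \<le> M" for i
    using that by (intro member_le_sum) (auto simp: env_norm_nonneg env_CauchyD[OF s])
  have "env_norm A (s n) \<le> K" for n
  proof (cases "n \<le> M")
    case True then show ?thesis using le[of n] by (simp add: K_def)
  next
    case False
    then show ?thesis
      using env_norm_le_dist[of "s n" "s M"] M[of n M] le[of M] env_CauchyD[OF s]
      by (simp add: K_def)
  qed
  then show ?thesis using that[of K] sum0[of "{..M}"] by (simp add: K_def)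
qed

text \<open>One estimate serves all four operations; for the unary ones \<open>f\<close> ignores its
  second argument and \<open>t\<close> is taken to be \<open>s\<close>. The Lipschitz condition is
  imposed along the given sequences only, since multiplication is Lipschitz merely on bounded
  sets.\<close>

lemma env_Cauchy_bilinear:
  assumes s: "s \<in> env_Cauchy A" and t: "t \<in> env_Cauchy A"
    and f: "\<And>a b. a \<in> elems A \<Longrightarrow> b \<in> elems A \<Longrightarrow> f a b \<in> elems A"
    and K: "K > 0" "\<And>m n. env_dist A (f (s m) (t m)) (f (s n) (t n)) \<le>
      K * env_dist A (s m) (s n) + K * env_dist A (t m) (t n)"
  shows "(\<lambda>n. f (s n) (t n)) \<in> env_Cauchy A"
proof -
  have "\<exists>M. \<forall>m\<ge>M. \<forall>n\<ge>M. env_dist A (f (s m) (t m)) (f (s n) (t n)) < r" if "r > 0" for r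
  proof -
    have r: "r / (2 * K) > 0" using that K by simp
    obtain M1 where M1: "\<And>m n. m \<ge> M1 \<Longrightarrow> n \<ge> M1 \<Longrightarrow> env_dist A (s m) (s n) < r / (2 * K)"
      using s r unfolding env_Cauchy_def mem_Collect_eq by meson
    obtain M2 where M2: "\<And>m n. m \<ge> M2 \<Longrightarrow> n \<ge> M2 \<Longrightarrow> env_dist A (t m) (t n) < r / (2 * K)"
      using t r unfolding env_Cauchy_def mem_Collect_eq by meson
    have "env_dist A (f (s m) (t m)) (f (s n) (t n)) < r" if "m \<ge> max M1 M2" "n \<ge> max M1 M2" for m n
    proof -
      have "K * env_dist A (s m) (s n) < r / 2" "K * env_dist A (t m) (t n) < r / 2"
        using M1[of m n] M2[of m n] that K by (simp_all add: field_simps)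
      then show ?thesis using K(2)[of m n] by linarith
    qed
    then show ?thesis by blast
  qed
  then show ?thesis
    using f env_CauchyD[OF s] env_CauchyD[OF t] by (auto simp: env_Cauchy_def)
qed

lemma env_rel_bilinear:
  assumes s: "(s, s') \<in> env_rel A" and t: "(t, t') \<in> env_rel A"
    and f: "(\<lambda>n. f (s n) (t n)) \<in> env_Cauchy A" "(\<lambda>n. f (s' n) (t' n)) \<in> env_Cauchy A"
    and K: "\<And>n. env_dist A (f (s n) (t n)) (f (s' n) (t' n)) \<le>
      K * env_dist A (s n) (s' n) + K * env_dist A (t n) (t' n)"
  shows "((\<lambda>n. f (s n) (t n)), (\<lambda>n. f (s' n) (t' n))) \<in> env_rel A"
proof -
  have "(\<lambda>n. env_dist A (s n) (s' n)) \<longlonglongrightarrow> 0" "(\<lambda>n. env_dist A (t n) (t' n)) \<longlonglongrightarrow> 0"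
    using s t by (auto simp: env_rel_def)
  then have "(\<lambda>n. K * env_dist A (s n) (s' n) + K * env_dist A (t n) (t' n)) \<longlonglongrightarrow> K * 0 + K * 0"
    by (intro tendsto_intros)
  then have "(\<lambda>n. K * env_dist A (s n) (s' n) + K * env_dist A (t n) (t' n)) \<longlonglongrightarrow> 0" by simp
  then have "(\<lambda>n. env_dist A (f (s n) (t n)) (f (s' n) (t' n))) \<longlonglongrightarrow> 0"
  proof (rule real_tendsto_sandwich[OF _ _ tendsto_const, rotated 2])
    show "\<forall>\<^sub>F n in sequentially. 0 \<le> env_dist A (f (s n) (t n)) (f (s' n) (t' n))"
      using env_CauchyD[OF f(1)] env_CauchyD[OF f(2)] by (simp add: env_dist_nonneg)
    show "\<forall>\<^sub>F n in sequentially. env_dist A (f (s n) (t n)) (f (s' n) (t' n)) \<le>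
        K * env_dist A (s n) (s' n) + K * env_dist A (t n) (t' n)"
      using K by simp
  qed
  then show ?thesis using f by (simp add: env_rel_def)
qed

lemma env_equiv: "equiv (env_Cauchy A) (env_rel A)"
proof (rule equivI)
  show "env_rel A \<subseteq> env_Cauchy A \<times> env_Cauchy A"
    by (auto simp: env_rel_def)
  show "refl_on (env_Cauchy A) (env_rel A)"
    by (auto simp: refl_on_def env_rel_def env_dist_self env_CauchyD)
  show "sym (env_rel A)"
    by (auto simp: sym_def env_rel_def env_dist_commute[OF env_CauchyD env_CauchyD])
  show "trans (env_rel A)"
  proof (rule transI)
    fix s t u assume st: "(s, t) \<in> env_rel A" and tu: "(t, u) \<in> env_rel A"
    then have c: "s \<in> env_Cauchy A" "t \<in> env_Cauchy A" "u \<in> env_Cauchy A"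
      by (auto simp: env_rel_def)
    have "(\<lambda>n. env_dist A (s n) (t n) + env_dist A (t n) (u n)) \<longlonglongrightarrow> 0 + 0"
      using st tu by (intro tendsto_add) (auto simp: env_rel_def)
    then have lim: "(\<lambda>n. env_dist A (s n) (t n) + env_dist A (t n) (u n)) \<longlonglongrightarrow> 0" by simp
    have "(\<lambda>n. env_dist A (s n) (u n)) \<longlonglongrightarrow> 0"
      using c[THEN env_CauchyD]
      by (intro real_tendsto_sandwich[OF _ _ tendsto_const lim])
        (auto intro!: always_eventually env_dist_nonneg env_dist_triangle)
    then show "(s, u) \<in> env_rel A" using c by (simp add: env_rel_def)
  qed
qed

lemma mult_env_Cauchy:
  assumes s: "s \<in> env_Cauchy A" and t: "t \<in> env_Cauchy A"
  shows "(\<lambda>n. mult A (s n) (t n)) \<in> env_Cauchy A"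
proof -
  obtain K1 K2 where K: "K1 > 0" "\<And>n. env_norm A (s n) \<le> K1" "K2 > 0" "\<And>n. env_norm A (t n) \<le> K2"
    using env_Cauchy_bounded[OF s] env_Cauchy_bounded[OF t] by metis
  show ?thesis
  proof (rule env_Cauchy_bilinear[OF s t, where K = "K1 + K2"])
    fix m n
    note in_A = env_CauchyD[OF s] env_CauchyD[OF t]
    have "env_dist A (mult A (s m) (t m)) (mult A (s n) (t n)) \<le>
        env_norm A (s m) * env_dist A (t m) (t n) + env_dist A (s m) (s n) * env_norm A (t n)"
      by (intro env_dist_mult in_A)
    also have "\<dots> \<le> (K1 + K2) * env_dist A (t m) (t n) + env_dist A (s m) (s n) * (K1 + K2)"
      using K(1,3) K(2)[of m] K(4)[of n]
      by (intro add_mono mult_mono env_dist_nonneg env_norm_nonneg in_A) auto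
    finally show "env_dist A (mult A (s m) (t m)) (mult A (s n) (t n)) \<le>
        (K1 + K2) * env_dist A (s m) (s n) + (K1 + K2) * env_dist A (t m) (t n)"
      by (simp add: mult.commute)
  qed (use K in \<open>auto simp: closed\<close>)
qed

lemma mult_env_rel:
  assumes s: "(s, s') \<in> env_rel A" and t: "(t, t') \<in> env_rel A"
  shows "((\<lambda>n. mult A (s n) (t n)), (\<lambda>n. mult A (s' n) (t' n))) \<in> env_rel A"
proof -
  have c: "s \<in> env_Cauchy A" "s' \<in> env_Cauchy A" "t \<in> env_Cauchy A" "t' \<in> env_Cauchy A"
    using s t by (auto simp: env_rel_def)
  obtain K1 K2 where K: "K1 > 0" "\<And>n. env_norm A (s n) \<le> K1" "K2 > 0" "\<And>n. env_norm A (t' n) \<le> K2"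
    using env_Cauchy_bounded[OF c(1)] env_Cauchy_bounded[OF c(4)] by metis
  show ?thesis
  proof (rule env_rel_bilinear[OF s t, where K = "K1 + K2"])
    fix n
    note in_A = c[THEN env_CauchyD]
    have "env_dist A (mult A (s n) (t n)) (mult A (s' n) (t' n)) \<le>
        env_norm A (s n) * env_dist A (t n) (t' n) + env_dist A (s n) (s' n) * env_norm A (t' n)"
      by (intro env_dist_mult in_A)
    also have "\<dots> \<le> (K1 + K2) * env_dist A (t n) (t' n) + env_dist A (s n) (s' n) * (K1 + K2)"
      using K(1,3) K(2)[of n] K(4)[of n]
      by (intro add_mono mult_mono env_dist_nonneg env_norm_nonneg in_A) auto
    finally show "env_dist A (mult A (s n) (t n)) (mult A (s' n) (t' n)) \<le>
        (K1 + K2) * env_dist A (s n) (s' n) + (K1 + K2) * env_dist A (t n) (t' n)"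
      by (simp add: mult.commute)
  qed (use c in \<open>auto intro: mult_env_Cauchy\<close>)
qed

lemma add_env_Cauchy:
  assumes s: "s \<in> env_Cauchy A" and t: "t \<in> env_Cauchy A"
  shows "(\<lambda>n. add A (s n) (t n)) \<in> env_Cauchy A"
  by (rule env_Cauchy_bilinear[OF s t, where K = 1])
    (use env_CauchyD[OF s] env_CauchyD[OF t] in \<open>auto simp: closed intro: env_dist_add\<close>)

lemma add_env_rel:
  assumes s: "(s, s') \<in> env_rel A" and t: "(t, t') \<in> env_rel A"
  shows "((\<lambda>n. add A (s n) (t n)), (\<lambda>n. add A (s' n) (t' n))) \<in> env_rel A"
proof -
  have c: "s \<in> env_Cauchy A" "s' \<in> env_Cauchy A" "t \<in> env_Cauchy A" "t' \<in> env_Cauchy A"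
    using s t by (auto simp: env_rel_def)
  show ?thesis
    by (rule env_rel_bilinear[OF s t, where K = 1])
      (use c[THEN env_CauchyD] in \<open>auto intro: env_dist_add add_env_Cauchy c\<close>)
qed

lemma scale_env_Cauchy:
  assumes s: "s \<in> env_Cauchy A"
  shows "(\<lambda>n. scale A c (s n)) \<in> env_Cauchy A"
proof (rule env_Cauchy_bilinear[OF s s, where K = "cmod c + 1" and f = "\<lambda>a b. scale A c a"])
  show "env_dist A (scale A c (s m)) (scale A c (s n)) \<le>
      (cmod c + 1) * env_dist A (s m) (s n) + (cmod c + 1) * env_dist A (s m) (s n)" for m n
    using env_dist_nonneg[of "s m" "s n"] env_CauchyD[OF s]
    by (simp add: env_dist_scale algebra_simps)
qed (use env_CauchyD[OF s] norm_ge_zero[of c] in \<open>auto simp: closed intro: add_nonneg_pos\<close>)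

lemma scale_env_rel:
  assumes s: "(s, s') \<in> env_rel A"
  shows "((\<lambda>n. scale A c (s n)), (\<lambda>n. scale A c (s' n))) \<in> env_rel A"
proof -
  have c: "s \<in> env_Cauchy A" "s' \<in> env_Cauchy A"
    using s by (auto simp: env_rel_def)
  show ?thesis
    by (rule env_rel_bilinear[OF s s, where K = "cmod c" and f = "\<lambda>a b. scale A c a"])
      (use c[THEN env_CauchyD] in \<open>auto simp: env_dist_scale env_dist_nonneg intro: scale_env_Cauchy c\<close>)
qed

lemma star_env_Cauchy:
  assumes s: "s \<in> env_Cauchy A"
  shows "(\<lambda>n. star A (s n)) \<in> env_Cauchy A"
  by (rule env_Cauchy_bilinear[OF s s, where K = 1 and f = "\<lambda>a b. star A a"])
    (use env_CauchyD[OF s] in \<open>auto simp: closed env_dist_star env_dist_nonneg\<close>)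

lemma star_env_rel:
  assumes s: "(s, s') \<in> env_rel A"
  shows "((\<lambda>n. star A (s n)), (\<lambda>n. star A (s' n))) \<in> env_rel A"
proof -
  have c: "s \<in> env_Cauchy A" "s' \<in> env_Cauchy A"
    using s by (auto simp: env_rel_def)
  show ?thesis
    by (rule env_rel_bilinear[OF s s, where K = 1 and f = "\<lambda>a b. star A a"])
      (use c[THEN env_CauchyD] in \<open>auto simp: env_dist_star env_dist_nonneg intro: star_env_Cauchy c\<close>)
qed

text \<open>All classes in the union defining \<open>env_lift1\<close> coincide, so the union
  collapses to the class of any one representative.\<close>

lemma env_lift1_class:
  assumes s: "s \<in> env_Cauchy A"
    and f: "\<And>s s'. (s, s') \<in> env_rel A \<Longrightarrow> ((\<lambda>n. f (s n)), (\<lambda>n. f (s' n))) \<in> env_rel A"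
  shows "env_lift1 A f (env_rel A `` {s}) = env_rel A `` {\<lambda>n. f (s n)}"
  unfolding env_lift1_def
  by (rule UN_equiv_class[OF env_equiv _ s, of "\<lambda>s. env_rel A `` {\<lambda>n. f (s n)}"])
    (intro congruentI equiv_class_eq[OF env_equiv] f)

lemma env_lift2_class:
  assumes s: "s \<in> env_Cauchy A" and t: "t \<in> env_Cauchy A"
    and f: "\<And>s s' t t'. (s, s') \<in> env_rel A \<Longrightarrow> (t, t') \<in> env_rel A \<Longrightarrow>
      ((\<lambda>n. f (s n) (t n)), (\<lambda>n. f (s' n) (t' n))) \<in> env_rel A"
  shows "env_lift2 A f (env_rel A `` {s}) (env_rel A `` {t}) = env_rel A `` {\<lambda>n. f (s n) (t n)}"
proof -
  have "congruent2 (env_rel A) (env_rel A) (\<lambda>s t. env_rel A `` {\<lambda>n. f (s n) (t n)})"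
    by (intro congruent2I' equiv_class_eq[OF env_equiv] f)
  then show ?thesis
    unfolding env_lift2_def
    using UN_equiv_class2[OF env_equiv env_equiv _ s t, of "\<lambda>s t. env_rel A `` {\<lambda>n. f (s n) (t n)}"]
    by auto
qed

end

text \<open>A bound independent of \<open>n\<close>, for the remainder in
  \<open>norm_\<phi>_pow_linear_approx\<close>: the power is at most \<open>exp u\<close>, and
  \<open>exp u \<le> 1 + u + u^2\<close> on the unit interval.\<close>

lemma exp_minus_linear_le_square:
  assumes "0 \<le> u" "u \<le> 1" "n > 0"
  shows "(1 + u / real n) ^ n - 1 - real n * (u / real n) \<le> u\<^sup>2"
proof -
  have "(1 + u / real n) ^ n \<le> exp (u / real n) ^ n"
    using assms by (intro power_mono exp_ge_add_one_self) auto
  also have "\<dots> = exp u" using assms by (simp add: exp_of_nat_mult[symmetric])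
  also have "\<dots> \<le> 1 + u + u\<^sup>2" using exp_bound[of u] assms by simp
  finally show ?thesis using assms by simp
qed

section \<open>Extension of a contractive representation to the completion\<close>

locale contractive_star_rep = unital_nonassoc_star_algebra A e
  for A :: "'a star_algebra" and e :: 'a +
  fixes \<phi> :: "'a \<Rightarrow> 'h::complex_hilbert_space \<Rightarrow>\<^sub>L 'h"
  assumes star_hom: "star_hom A (op_algebra bounded_ops) \<phi>"
    and norm_le_nrm: "a \<in> elems A \<Longrightarrow> norm (\<phi> a) \<le> nrm A a"
begin

lemma \<phi>_bounded: "a \<in> elems A \<Longrightarrow> \<phi> a \<in> bounded_ops"
  and \<phi>_add: "\<lbrakk>a \<in> elems A; b \<in> elems A\<rbrakk> \<Longrightarrow> \<phi> (add A a b) = \<phi> a + \<phi> b"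
  and \<phi>_scale: "a \<in> elems A \<Longrightarrow> \<phi> (scale A c a) = scale_op c (\<phi> a)"
  and \<phi>_mult: "\<lbrakk>a \<in> elems A; b \<in> elems A\<rbrakk> \<Longrightarrow> \<phi> (mult A a b) = \<phi> a o\<^sub>L \<phi> b"
  and \<phi>_star: "a \<in> elems A \<Longrightarrow> \<phi> (star A a) = adj (\<phi> a)"
  using star_hom by (auto simp: star_hom_def op_algebra_def)

lemma \<phi>_sub: "\<lbrakk>a \<in> elems A; b \<in> elems A\<rbrakk> \<Longrightarrow> \<phi> (sub a b) = \<phi> a - \<phi> b"
  by (simp add: \<phi>_add \<phi>_scale closed scale_op_simps)

text \<open>Improves contractivity from \<open>nrm A\<close> to the enveloping norm, as needed for
  continuity on the completion.\<close>

lemma norm_\<phi>_cstar_seminorm: "cstar_seminorm A (\<lambda>a. norm (\<phi> a))"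
  by (auto simp: cstar_seminorm_def norm_le_nrm \<phi>_add \<phi>_scale \<phi>_mult \<phi>_star closed norm_triangle_ineq
      norm_scale_op norm_blinfun_compose norm_adj_comp_self \<phi>_bounded)

lemma norm_\<phi>_le_env: "a \<in> elems A \<Longrightarrow> norm (\<phi> a) \<le> env_norm A a"
  by (rule cstar_seminorm_le_env[OF norm_\<phi>_cstar_seminorm])

lemma norm_\<phi>_diff_le: "\<lbrakk>a \<in> elems A; b \<in> elems A\<rbrakk> \<Longrightarrow> norm (\<phi> a - \<phi> b) \<le> env_dist A a b"
  using norm_\<phi>_le_env[of "sub a b"] by (simp add: env_dist_def \<phi>_sub closed)

definition extension :: "(nat \<Rightarrow> 'a) set \<Rightarrow> 'h \<Rightarrow>\<^sub>L 'h" where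
  "extension S = (THE T. \<forall>s\<in>S. (\<lambda>n. \<phi> (s n)) \<longlonglongrightarrow> T)"

text \<open>Images of a Cauchy sequence are Cauchy, and images of equivalent sequences differ by a
  null sequence; hence the description in \<open>extension\<close> has exactly one solution.\<close>

lemma extension_lim:
  assumes s: "s \<in> env_Cauchy A"
  shows "(\<lambda>n. \<phi> (s n)) \<longlonglongrightarrow> extension (env_rel A `` {s})"
proof -
  have "Cauchy (\<lambda>n. \<phi> (s n))"
  proof (rule metric_CauchyI)
    fix r :: real assume "r > 0"
    then obtain M where "\<And>m n. m \<ge> M \<Longrightarrow> n \<ge> M \<Longrightarrow> env_dist A (s m) (s n) < r"
      using s unfolding env_Cauchy_def mem_Collect_eq by meson
    then show "\<exists>M. \<forall>m\<ge>M. \<forall>n\<ge>M. dist (\<phi> (s m)) (\<phi> (s n)) < r"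
      using norm_\<phi>_diff_le[OF env_CauchyD[OF s] env_CauchyD[OF s]]
      by (metis dist_norm le_less_trans)
  qed
  then obtain T where T: "(\<lambda>n. \<phi> (s n)) \<longlonglongrightarrow> T"
    by (meson Cauchy_convergent_iff convergent_def)
  have lim: "(\<lambda>n. \<phi> (t n)) \<longlonglongrightarrow> T" if "(s, t) \<in> env_rel A" for t
  proof -
    have t: "t \<in> env_Cauchy A" and st: "(\<lambda>n. env_dist A (s n) (t n)) \<longlonglongrightarrow> 0"
      using that by (auto simp: env_rel_def)
    have "(\<lambda>n. \<phi> (s n) - \<phi> (t n)) \<longlonglongrightarrow> 0"
      using norm_\<phi>_diff_le[OF env_CauchyD[OF s] env_CauchyD[OF t]]
      by (intro Lim_null_comparison[OF _ st] always_eventually allI)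
    then show ?thesis
      using tendsto_diff[OF T, of "\<lambda>n. \<phi> (s n) - \<phi> (t n)" 0] by simp
  qed
  have "(s, s) \<in> env_rel A"
    using s by (simp add: env_rel_def env_dist_self env_CauchyD)
  then have "extension (env_rel A `` {s}) = T"
    unfolding extension_def using lim by (intro the_equality) (auto intro: LIMSEQ_unique)
  then show ?thesis using T by simp
qed

lemma extension_eqI:
  assumes "s \<in> env_Cauchy A" "(\<lambda>n. \<phi> (s n)) \<longlonglongrightarrow> T"
  shows "extension (env_rel A `` {s}) = T"
  using LIMSEQ_unique extension_lim assms by blast

lemma env_const_Cauchy: "a \<in> elems A \<Longrightarrow> (\<lambda>_. a) \<in> env_Cauchy A"
  by (auto simp: env_Cauchy_def env_dist_self)

lemma extension_embed: "a \<in> elems A \<Longrightarrow> extension (env_embed A a) = \<phi> a"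
  unfolding env_embed_def by (rule extension_eqI) (auto intro: env_const_Cauchy)

section \<open>Closedness of the image\<close>

primrec pow :: "'a \<Rightarrow> nat \<Rightarrow> 'a" where
  "pow a 0 = e"
| "pow a (Suc n) = mult A a (pow a n)"

lemma pow_closed: "a \<in> elems A \<Longrightarrow> pow a n \<in> elems A"
  by (induction n) (auto simp: closed)

lemma env_norm_pow: "a \<in> elems A \<Longrightarrow> env_norm A (pow a n) \<le> env_norm A a ^ n"
proof (induction n)
  case (Suc n)
  then have "env_norm A (pow a (Suc n)) \<le> env_norm A a * env_norm A (pow a n)"
    by (simp add: env_norm_mult pow_closed)
  also have "\<dots> \<le> env_norm A a * env_norm A a ^ n"
    using Suc by (intro mult_left_mono) (auto simp: env_norm_nonneg)
  finally show ?case by simp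
qed (simp add: env_norm_unit)

text \<open>With \<open>E\<close> the remainder of order \<open>n\<close>, the next one is
  \<open>(P + W) E + n W^2\<close>. The right-hand side satisfies the same recursion with scalars
  \<open>1 + norm W\<close> and \<open>norm W\<close>, so it majorises the remainder.\<close>

lemma norm_\<phi>_pow_linear_approx:
  assumes w: "w \<in> elems A"
  shows "norm (\<phi> (pow (add A e w) n) - \<phi> e - real n *\<^sub>R \<phi> w) \<le>
    (1 + norm (\<phi> w)) ^ n - 1 - real n * norm (\<phi> w)"
proof (induction n)
  case (Suc n)
  define P W where "P = \<phi> e" and "W = \<phi> w"
  define E where "E = \<phi> (pow (add A e w) n) - P - real n *\<^sub>R W"
  have PW: "P o\<^sub>L W = W" "W o\<^sub>L P = W" "P o\<^sub>L P = P"
    using w by (simp_all add: P_def W_def \<phi>_mult[symmetric] closed mult_unit_left mult_unit_right)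
  have nP: "norm P \<le> 1"
    using norm_\<phi>_le_env[OF unit_closed] env_norm_unit by (simp add: P_def)
  have "\<phi> (pow (add A e w) (Suc n)) = (P + W) o\<^sub>L (E + P + real n *\<^sub>R W)"
    using w by (simp add: \<phi>_mult \<phi>_add closed pow_closed P_def W_def E_def)
  also have "\<dots> = ((P + W) o\<^sub>L E) + P + W + real n *\<^sub>R W + real n *\<^sub>R (W o\<^sub>L W)"
    by (simp add: bounded_bilinear.add_left[OF bounded_bilinear_blinfun_compose]
        bounded_bilinear.add_right[OF bounded_bilinear_blinfun_compose]
        bounded_bilinear.scaleR_right[OF bounded_bilinear_blinfun_compose] PW algebra_simps)
  finally have "\<phi> (pow (add A e w) (Suc n)) - P - real (Suc n) *\<^sub>R W =
      ((P + W) o\<^sub>L E) + real n *\<^sub>R (W o\<^sub>L W)"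
    by (simp add: algebra_simps)
  also have "norm \<dots> \<le> norm ((P + W) o\<^sub>L E) + norm (real n *\<^sub>R (W o\<^sub>L W))"
    by (rule norm_triangle_ineq)
  also have "\<dots> \<le> (1 + norm W) * ((1 + norm W) ^ n - 1 - real n * norm W) + real n * (norm W * norm W)"
  proof (intro add_mono)
    have "norm ((P + W) o\<^sub>L E) \<le> norm (P + W) * norm E" by (rule norm_blinfun_compose)
    also have "\<dots> \<le> (1 + norm W) * ((1 + norm W) ^ n - 1 - real n * norm W)"
      using Suc norm_triangle_ineq[of P W] nP unfolding E_def P_def W_def
      by (intro mult_mono) auto
    finally show "norm ((P + W) o\<^sub>L E) \<le> (1 + norm W) * ((1 + norm W) ^ n - 1 - real n * norm W)" .
    show "norm (real n *\<^sub>R (W o\<^sub>L W)) \<le> real n * (norm W * norm W)"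
      by (simp add: mult_left_mono norm_blinfun_compose)
  qed
  also have "\<dots> = (1 + norm W) ^ Suc n - 1 - real (Suc n) * norm W"
    by (simp add: algebra_simps)
  finally show ?case by (simp add: P_def W_def)
qed simp

text \<open>For hermitian \<open>h\<close> the elements \<open>(1 \<plusminus> i t h / n)\<^sup>n\<close> are almost unitary, so that their difference
  divided by \<open>2 i t\<close>, a polynomial version of \<open>sin (t h) / t\<close>, is bounded in every C*-seminorm
  independently of \<open>h\<close>, but its image is close to that of \<open>h\<close> when \<open>t \<phi>(h)\<close> is small.\<close>

lemma env_norm_unitary_approx:
  assumes h: "hermitian h" and n: "n > 0" "(t * env_norm A h)\<^sup>2 \<le> real n" and c: "c = \<i> * of_real (t / real n)"
  shows "env_norm A (pow (add A e (scale A c h)) n) \<le> 2"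
proof -
  have hA: "h \<in> elems A" and hs: "star A h = h" using h by (auto simp: hermitian_def)
  define x where "x = add A e (scale A c h)"
  define R where "R = env_norm A h"
  have x: "x \<in> elems A" using hA by (simp add: x_def closed)
  \<comment> \<open>As \<open>c\<close> is imaginary, the star of \<open>x\<close> carries
    \<open>- c\<close>; the terms linear in \<open>h\<close> cancel and only a quadratic term of
    size \<open>(t / n)^2\<close> remains.\<close>
  have "mult A (star A x) x = mult A (add A e (scale A (- c) h)) x"
    using hA by (simp add: x_def closed star_add star_scale star_unit hs c)
  also have "\<dots> = add A (add A e (scale A (- c) h)) (scale A c (add A h (scale A (- c) (mult A h h))))"
    using hA by (simp add: x_def closed mult_add_left mult_add_right mult_scale_left mult_scale_right
        mult_unit_left mult_unit_right)
  also have "\<dots> = add A (add A e (scale A (- (c * c)) (mult A h h))) (add A (scale A c h) (scale A (- c) h))"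
    using hA by (simp add: closed scale_add_right scale_scale ac)
  also have "\<dots> = add A e (scale A (- (c * c)) (mult A h h))"
    using hA by (simp add: closed scale_add_left[symmetric] add_scale_zero)
  finally have "(env_norm A x)\<^sup>2 = env_norm A (add A e (scale A (- (c * c)) (mult A h h)))"
    using x by (simp add: env_norm_simps(2)[symmetric])
  also have "\<dots> \<le> env_norm A e + cmod (c * c) * env_norm A (mult A h h)"
    using env_norm_add[of e "scale A (- (c * c)) (mult A h h)"] hA
    by (simp add: closed env_norm_simps(1))
  also have "\<dots> \<le> 1 + (t / real n)\<^sup>2 * (R * R)"
    using env_norm_mult[OF hA hA]
    by (intro add_mono mult_mono env_norm_unit env_norm_nonneg closed hA)
      (auto simp: c R_def norm_mult norm_divide power2_eq_square)
  also have "\<dots> = 1 + (t * R)\<^sup>2 / (real n)\<^sup>2"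
    by (simp add: power2_eq_square)
  \<comment> \<open>Here the size of \<open>n\<close> enters: the excess over \<open>1\<close> drops
    to \<open>1 / n\<close>, and the \<open>n\<close>-th power stays below \<open>exp 1\<close>,
    hence below \<open>4\<close>.\<close>
  also have "\<dots> \<le> 1 + real n / (real n)\<^sup>2"
    using n(2) by (intro add_left_mono divide_right_mono) (auto simp: R_def)
  also have "\<dots> = 1 + 1 / real n" by (simp add: power2_eq_square)
  also have "\<dots> \<le> exp (1 / real n)" by (rule exp_ge_add_one_self)
  finally have "((env_norm A x)\<^sup>2) ^ n \<le> exp (1 / real n) ^ n"
    by (intro power_mono) auto
  also have "\<dots> = exp 1"
    using n(1) by (simp add: exp_of_nat_mult[symmetric])
  also have "\<dots> \<le> 2\<^sup>2" using exp_le by simp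
  finally have "(env_norm A x ^ n)\<^sup>2 \<le> 2\<^sup>2"
    by (simp add: power_mult[symmetric] mult.commute)
  then have "env_norm A x ^ n \<le> 2" by (rule power2_le_imp_le) simp
  then show ?thesis using env_norm_pow[OF x, of n] by (simp add: x_def)
qed

lemma hermitian_approx_lift:
  assumes h: "hermitian h" and r: "r > 0" "norm (\<phi> h) \<le> r"
  shows "\<exists>s\<in>elems A. env_norm A s \<le> 16 * r \<and> norm (\<phi> h - \<phi> s) \<le> r / 8"
proof -
  have hA: "h \<in> elems A" using h by (auto simp: hermitian_def)
  \<comment> \<open>With this \<open>t\<close> the number \<open>u = t * norm (\<phi> h)\<close> is
    at most \<open>1/8\<close>. The lift then costs \<open>4 / (2 * t) = 16 * r\<close>, and the
    error \<open>u * norm (\<phi> h)\<close> is at most \<open>r / 8\<close>.\<close>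
  define t where "t = 1 / (8 * r)"
  have t: "t > 0" using r by (simp add: t_def)
  \<comment> \<open>\<open>n\<close> depends on the enveloping norm of \<open>h\<close>, over which
    there is no control; this is harmless because \<open>n\<close> disappears from all later
    bounds.\<close>
  obtain n :: nat where n: "n > 0" "(t * env_norm A h)\<^sup>2 \<le> real n"
    by (metis real_arch_simple le_max_iff_disj max.strict_coboundedI2 of_nat_max order.trans zero_less_one of_nat_le_iff)
  define c where "c = \<i> * of_real (t / real n)"
  define x y where "x = add A e (scale A c h)" and "y = add A e (scale A (- c) h)"
  have [simp]: "pow x k \<in> elems A" "pow y k \<in> elems A" for k
    using hA by (simp_all add: x_def y_def pow_closed closed)
  have nx: "env_norm A (pow x n) \<le> 2" and ny: "env_norm A (pow y n) \<le> 2"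
    unfolding x_def y_def
    using env_norm_unitary_approx[OF h n c_def] env_norm_unitary_approx[OF h n(1), of "- t" "- c"] n(2)
    by (auto simp: c_def)
  define s where "s = scale A (1 / (2 * \<i> * of_real t)) (sub (pow x n) (pow y n))"
  have s: "s \<in> elems A" by (simp add: s_def closed)
  have "env_norm A (sub (pow x n) (pow y n)) \<le> 4"
    using env_norm_add[of "pow x n" "scale A (-1) (pow y n)"] nx ny
    by (simp add: closed env_norm_simps)
  then have "env_norm A s \<le> 4 / (2 * t)"
    using t by (simp add: s_def env_norm_simps closed norm_divide norm_mult field_simps)
  then have 1: "env_norm A s \<le> 16 * r" using r by (simp add: t_def)
  define u where "u = t * norm (\<phi> h)"
  have u: "0 \<le> u" "u \<le> 1 / 8"
    using r t by (auto simp: u_def t_def field_simps)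
  have nc: "norm (\<phi> (scale A c' h)) = u / real n" if "cmod c' = t / real n" for c'
    using hA that by (simp add: \<phi>_scale norm_scale_op u_def)
  have cc: "cmod c = t / real n" "cmod (- c) = t / real n"
    using t by (auto simp: c_def norm_mult norm_divide)
  define Ex where "Ex = \<phi> (pow x n) - \<phi> e - real n *\<^sub>R \<phi> (scale A c h)"
  define Ey where "Ey = \<phi> (pow y n) - \<phi> e - real n *\<^sub>R \<phi> (scale A (- c) h)"
  have nEx: "norm Ex \<le> u\<^sup>2" and nEy: "norm Ey \<le> u\<^sup>2"
    using norm_\<phi>_pow_linear_approx[of "scale A c h" n] norm_\<phi>_pow_linear_approx[of "scale A (- c) h" n]
      exp_minus_linear_le_square[of u n] u n(1) hA
    unfolding nc[OF cc(1)] nc[OF cc(2)] Ex_def Ey_def x_def y_def by (simp_all add: closed)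
  have real_scale: "real n *\<^sub>R T = scale_op (of_nat n) T" for T :: "'h \<Rightarrow>\<^sub>L 'h"
    by (rule blinfun_eqI) (simp add: blinfun.bilinear_simps scaleR_scaleC)
  have "\<phi> (sub (pow x n) (pow y n)) = Ex - Ey + (scale_op (of_nat n * c) (\<phi> h) - scale_op (of_nat n * (- c)) (\<phi> h))"
    using hA by (subst \<phi>_sub) (auto simp: Ex_def Ey_def \<phi>_scale real_scale scale_op_simps)
  also have "scale_op (of_nat n * c) (\<phi> h) - scale_op (of_nat n * (- c)) (\<phi> h) = scale_op (2 * \<i> * of_real t) (\<phi> h)"
    using n(1) by (intro blinfun_eqI)
      (simp add: blinfun.bilinear_simps c_def scaleC_minus_left scaleC_add_left[symmetric] ac_simps)
  finally have "\<phi> s = scale_op (1 / (2 * \<i> * of_real t)) (Ex - Ey) + \<phi> h"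
    using t by (simp add: s_def \<phi>_scale closed scale_op_simps)
  then have "norm (\<phi> h - \<phi> s) = cmod (1 / (2 * \<i> * of_real t)) * norm (Ex - Ey)"
    by (metis add_diff_cancel_right' norm_minus_commute norm_scale_op)
  also have "\<dots> \<le> cmod (1 / (2 * \<i> * of_real t)) * (2 * u\<^sup>2)"
    using norm_triangle_ineq4[of Ex Ey] nEx nEy by (intro mult_left_mono) auto
  also have "\<dots> = u * norm (\<phi> h)"
    using t by (simp add: norm_divide norm_mult u_def power2_eq_square)
  also have "\<dots> \<le> 1 / 8 * r"
    using u r by (intro mult_mono) auto
  finally show ?thesis using 1 s by auto
qed

text \<open>Both hermitian parts have images of norm at most \<open>r\<close>, so cost and error of
  the hermitian case simply double.\<close>

lemma approx_lift:
  assumes a: "a \<in> elems A" and r: "r > 0" "norm (\<phi> a) \<le> r"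
  shows "\<exists>s\<in>elems A. env_norm A s \<le> 32 * r \<and> norm (\<phi> a - \<phi> s) \<le> r / 4"
proof -
  define h1 h2 where "h1 = scale A (1/2) (add A a (star A a))"
    and "h2 = scale A (1/(2*\<i>)) (sub a (star A a))"
  note h = hermitian_parts[OF a, folded h1_def h2_def]
  have hA: "h1 \<in> elems A" "h2 \<in> elems A" using h by (auto simp: hermitian_def)
  have "norm (\<phi> h1) \<le> r"
    using norm_triangle_ineq[of "\<phi> a" "adj (\<phi> a)"] r(2) a
    by (simp add: h1_def \<phi>_scale \<phi>_add \<phi>_star closed norm_scale_op norm_adj \<phi>_bounded)
  then obtain s1 where s1: "s1 \<in> elems A" "env_norm A s1 \<le> 16 * r" "norm (\<phi> h1 - \<phi> s1) \<le> r / 8"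
    using hermitian_approx_lift[OF h(1) r(1)] by blast
  have "norm (\<phi> h2) \<le> r"
    using norm_triangle_ineq4[of "\<phi> a" "adj (\<phi> a)"] r(2) a
    by (simp add: h2_def \<phi>_scale \<phi>_sub \<phi>_star closed norm_scale_op norm_adj \<phi>_bounded norm_divide norm_mult)
  then obtain s2 where s2: "s2 \<in> elems A" "env_norm A s2 \<le> 16 * r" "norm (\<phi> h2 - \<phi> s2) \<le> r / 8"
    using hermitian_approx_lift[OF h(2) r(1)] by blast
  have "env_norm A (add A s1 (scale A \<i> s2)) \<le> 32 * r"
    using env_norm_add[of s1 "scale A \<i> s2"] s1 s2 by (simp add: closed env_norm_simps)
  moreover have "\<phi> a - \<phi> (add A s1 (scale A \<i> s2)) = (\<phi> h1 - \<phi> s1) + scale_op \<i> (\<phi> h2 - \<phi> s2)"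
    using hA s1 s2 by (subst h(3)[symmetric]) (simp add: \<phi>_add \<phi>_scale closed scale_op_simps)
  then have "norm (\<phi> a - \<phi> (add A s1 (scale A \<i> s2))) \<le> r / 4"
    using norm_triangle_ineq[of "\<phi> h1 - \<phi> s1" "scale_op \<i> (\<phi> h2 - \<phi> s2)"] s1 s2
    by (simp add: norm_scale_op)
  ultimately show ?thesis
    using s1 s2 by (intro bexI[of _ "add A s1 (scale A \<i> s2)"]) (auto simp: closed)
qed

text \<open>Choosing \<open>\<phi> a\<close> within a quarter of \<open>norm T\<close> gives
  \<open>norm (\<phi> a) \<le> 5/4 * norm T\<close>. Lifting it costs \<open>32 * 5/4 = 40\<close>
  times \<open>norm T\<close>, and the errors add up to \<open>1/4 + 5/16\<close>, which is below
  \<open>3/4\<close>.\<close>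

lemma closure_approx_lift:
  assumes T: "T \<in> closure (\<phi> ` elems A)"
  shows "\<exists>s\<in>elems A. env_norm A s \<le> 40 * norm T \<and> norm (T - \<phi> s) \<le> 3/4 * norm T"
proof (cases "T = 0")
  case True
  have "scale_op 0 (\<phi> e) = 0" by (rule blinfun_eqI) simp
  then show ?thesis
    using True by (intro bexI[of _ "scale A 0 e"]) (auto simp: closed env_norm_simps \<phi>_scale)
next
  case False
  then obtain a where a: "a \<in> elems A" "dist (\<phi> a) T < norm T / 4"
    using T unfolding closure_approachable by (metis (no_types, lifting) divide_pos_pos
        imageE zero_less_norm_iff zero_less_numeral)
  then have aT: "norm (T - \<phi> a) \<le> norm T / 4" by (simp add: dist_norm norm_minus_commute)
  then have "norm (\<phi> a) \<le> 5/4 * norm T"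
    using norm_triangle_sub[of "\<phi> a" T] by (simp add: norm_minus_commute)
  then obtain s where s: "s \<in> elems A" "env_norm A s \<le> 32 * (5/4 * norm T)"
    "norm (\<phi> a - \<phi> s) \<le> (5/4 * norm T) / 4"
    using approx_lift[OF a(1), of "5/4 * norm T"] False by auto
  have "norm (T - \<phi> s) \<le> 3/4 * norm T"
  proof -
    have "norm (T - \<phi> s) \<le> norm (T - \<phi> a) + norm (\<phi> a - \<phi> s)"
      using norm_triangle_ineq[of "T - \<phi> a" "\<phi> a - \<phi> s"] by simp
    then show ?thesis using s(3) aT norm_ge_zero[of T] by linarith
  qed
  then show ?thesis using s by auto
qed

lemma closure_diff:
  assumes T: "T \<in> closure (\<phi> ` elems A)" and s: "s \<in> elems A"
  shows "T - \<phi> s \<in> closure (\<phi> ` elems A)"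
proof -
  obtain f where f: "\<And>n. f n \<in> \<phi> ` elems A" "f \<longlonglongrightarrow> T"
    using T by (auto simp: closure_sequential)
  have "f n - \<phi> s \<in> \<phi> ` elems A" for n
  proof -
    obtain a where "a \<in> elems A" "f n = \<phi> a" using f(1)[of n] by blast
    then show ?thesis using s by (metis \<phi>_sub closed(1,2) imageI)
  qed
  moreover have "(\<lambda>n. f n - \<phi> s) \<longlonglongrightarrow> T - \<phi> s" by (intro tendsto_intros f)
  ultimately show ?thesis
    unfolding closure_sequential by (intro exI[of _ "\<lambda>n. f n - \<phi> s"]) simp
qed

text \<open>Successive approximation: lift the current error, add the lift, and repeat. Errors decay
  like \<open>(3/4)^n\<close>, and with them the enveloping norms of the corrections, so the partial
  sums are Cauchy in the completion.\<close>

lemma extension_surj: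
  assumes T: "T \<in> closure (\<phi> ` elems A)"
  shows "\<exists>s\<in>env_Cauchy A. (\<lambda>n. \<phi> (s n)) \<longlonglongrightarrow> T"
proof -
  define L where "L T = (SOME s. s \<in> elems A \<and> env_norm A s \<le> 40 * norm T \<and>
    norm (T - \<phi> s) \<le> 3/4 * norm T)" for T
  have L: "L T \<in> elems A \<and> env_norm A (L T) \<le> 40 * norm T \<and> norm (T - \<phi> (L T)) \<le> 3/4 * norm T"
    if "T \<in> closure (\<phi> ` elems A)" for T
    unfolding L_def by (rule someI_ex[OF closure_approx_lift[OF that, unfolded Bex_def]])
  define s where "s = rec_nat (scale A 0 e) (\<lambda>_ a. add A a (L (T - \<phi> a)))"
  have s_Suc: "s (Suc n) = add A (s n) (L (T - \<phi> (s n)))" for n by (simp add: s_def)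
  have sA: "s n \<in> elems A" for n
  proof (induction n)
    case 0 show ?case by (simp add: s_def closed)
  next
    case (Suc n)
    then show ?case using L[OF closure_diff[OF T Suc]] by (simp add: s_Suc closed)
  qed
  note LA = L[OF closure_diff[OF T sA]]
  have decay: "norm (T - \<phi> (s n)) \<le> (3/4) ^ n * norm T" for n
  proof (induction n)
    case 0
    have "scale_op 0 (\<phi> e) = 0" by (rule blinfun_eqI) simp
    then show ?case by (simp add: s_def \<phi>_scale closed)
  next
    case (Suc n)
    have "T - \<phi> (s (Suc n)) = (T - \<phi> (s n)) - \<phi> (L (T - \<phi> (s n)))"
      using LA[of n] by (simp add: s_Suc \<phi>_add sA)
    then have "norm (T - \<phi> (s (Suc n))) \<le> 3/4 * norm (T - \<phi> (s n))"
      using LA[of n] by metis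
    also have "\<dots> \<le> 3/4 * ((3/4) ^ n * norm T)"
      by (intro mult_left_mono Suc) simp
    finally show ?case by simp
  qed
  have step: "env_dist A (s n) (s (Suc n)) \<le> 40 * norm T * (3/4) ^ n" for n
  proof -
    have "sub (s (Suc n)) (s n) = add A (L (T - \<phi> (s n))) (sub (s n) (s n))"
      using LA[of n] sA[of n] by (simp add: s_Suc closed ac)
    then have "sub (s (Suc n)) (s n) = L (T - \<phi> (s n))"
      using LA[of n] sA[of n] by (simp add: sub_self add_scale_zero)
    then have "env_dist A (s (Suc n)) (s n) \<le> 40 * norm (T - \<phi> (s n))"
      using LA[of n] by (simp add: env_dist_def)
    then show ?thesis
      using decay[of n] by (simp add: env_dist_commute[OF sA sA] mult.commute)
  qed
  \<comment> \<open>The bound is written as a difference so that it telescopes; \<open>160\<close>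
    is \<open>40\<close> divided by \<open>1 - 3/4\<close>.\<close>
  have dist: "env_dist A (s n) (s (n + k)) \<le> 160 * norm T * ((3/4) ^ n - (3/4) ^ (n + k))" for n k
  proof (induction k)
    case 0 show ?case by (simp add: env_dist_self sA)
  next
    case (Suc k)
    then show ?case
      using env_dist_triangle[of "s n" "s (n + k)" "s (Suc (n + k))", OF sA sA sA] step[of "n + k"]
      by (simp add: algebra_simps)
  qed
  have dist': "env_dist A (s m) (s n) \<le> 160 * norm T * (3/4) ^ M" if "m \<ge> M" "n \<ge> M" for m n M
  proof -
    have *: "env_dist A (s m) (s n) \<le> 160 * norm T * (3/4) ^ M" if "M \<le> m" "m \<le> n" for m n
    proof -
      have "env_dist A (s m) (s n) \<le> 160 * norm T * ((3/4) ^ m - (3/4) ^ n)"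
        using dist[of m "n - m"] that by simp
      also have "\<dots> \<le> 160 * norm T * (3/4) ^ M"
      proof (intro mult_left_mono)
        have "(3/4::real) ^ m \<le> (3/4) ^ M" using that by (intro power_decreasing) auto
        moreover have "(0::real) \<le> (3/4) ^ n" by simp
        ultimately show "(3/4::real) ^ m - (3/4) ^ n \<le> (3/4) ^ M" by linarith
      qed simp
      finally show ?thesis .
    qed
    show ?thesis
      using *[of m n] *[of n m] that env_dist_commute[OF sA sA, of m n] by (cases "m \<le> n") auto
  qed
  have geo: "(\<lambda>n. c * (3/4) ^ n) \<longlonglongrightarrow> 0" for c :: real
    using tendsto_mult_left[OF LIMSEQ_power_zero[of "3/4::real"], of c] by simp
  have "s \<in> env_Cauchy A"
    unfolding env_Cauchy_def
  proof (intro CollectI conjI allI impI)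
    show "range s \<subseteq> elems A" using sA by auto
    fix r :: real assume "r > 0"
    then obtain M where "160 * norm T * (3/4) ^ M < r"
      using order_tendstoD(2)[OF geo[of "160 * norm T"]] by (auto simp: eventually_sequentially)
    then show "\<exists>M. \<forall>m\<ge>M. \<forall>n\<ge>M. env_dist A (s m) (s n) < r"
      using dist' by (meson le_less_trans)
  qed
  moreover have "(\<lambda>n. \<phi> (s n)) \<longlonglongrightarrow> T"
  proof -
    have "(\<lambda>n. T - \<phi> (s n)) \<longlonglongrightarrow> 0"
      using decay by (intro Lim_null_comparison[OF _ geo[of "norm T"]] always_eventually)
        (simp add: mult.commute)
    then show ?thesis
      using tendsto_diff[OF tendsto_const[of T], of "\<lambda>n. T - \<phi> (s n)" 0] by simp
  qed
  ultimately show ?thesis by blast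
qed

theorem extension_epimorphism:
  "star_epimorphism (enveloping_cstar A) (op_algebra (closure (\<phi> ` elems A))) extension"
proof -
  have quot: "\<exists>s\<in>env_Cauchy A. S = env_rel A `` {s}" if "S \<in> env_Cauchy A // env_rel A" for S
    using that by (auto elim: quotientE)
  have mem: "extension (env_rel A `` {s}) \<in> closure (\<phi> ` elems A)" if "s \<in> env_Cauchy A" for s
    unfolding closure_sequential using extension_lim[OF that] env_CauchyD[OF that]
    by (intro exI[of _ "\<lambda>n. \<phi> (s n)"]) simp
  note lim = extension_lim
  have "star_hom (enveloping_cstar A) (op_algebra (closure (\<phi> ` elems A))) extension"
    unfolding star_hom_def enveloping_cstar_def op_algebra_def star_algebra.simps
  proof (intro conjI ballI allI)
    fix S assume "S \<in> env_Cauchy A // env_rel A"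
    then obtain s where s: "s \<in> env_Cauchy A" and S: "S = env_rel A `` {s}" using quot by blast
    show "extension S \<in> closure (\<phi> ` elems A)" using mem[OF s] by (simp add: S)
    have eq: "env_lift1 A (star A) S = env_rel A `` {\<lambda>n. star A (s n)}"
      unfolding S by (rule env_lift1_class[OF s]) (rule star_env_rel)
    show "extension (env_lift1 A (star A) S) = adj (extension S)"
      unfolding eq unfolding S
      by (rule extension_eqI[OF star_env_Cauchy[OF s]])
        (simp add: \<phi>_star env_CauchyD[OF s] tendsto_adj lim[OF s] \<phi>_bounded)
    have eq: "env_lift1 A (scale A c) S = env_rel A `` {\<lambda>n. scale A c (s n)}" for c
      unfolding S by (rule env_lift1_class[OF s]) (rule scale_env_rel)
    show "extension (env_lift1 A (scale A c) S) = scale_op c (extension S)" for c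
      unfolding eq unfolding S
      by (rule extension_eqI[OF scale_env_Cauchy[OF s]])
        (simp add: \<phi>_scale env_CauchyD[OF s] tendsto_scale_op lim[OF s])
    fix S' assume "S' \<in> env_Cauchy A // env_rel A"
    then obtain s' where s': "s' \<in> env_Cauchy A" and S': "S' = env_rel A `` {s'}" using quot by blast
    have eq: "env_lift2 A (add A) S S' = env_rel A `` {\<lambda>n. add A (s n) (s' n)}"
      unfolding S S' by (rule env_lift2_class[OF s s']) (rule add_env_rel)
    show "extension (env_lift2 A (add A) S S') = extension S + extension S'"
      unfolding eq unfolding S S'
      by (rule extension_eqI[OF add_env_Cauchy[OF s s']])
        (simp add: \<phi>_add env_CauchyD[OF s] env_CauchyD[OF s'] tendsto_add lim[OF s] lim[OF s'])
    have eq: "env_lift2 A (mult A) S S' = env_rel A `` {\<lambda>n. mult A (s n) (s' n)}"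
      unfolding S S' by (rule env_lift2_class[OF s s']) (rule mult_env_rel)
    show "extension (env_lift2 A (mult A) S S') = extension S o\<^sub>L extension S'"
      unfolding eq unfolding S S'
      by (rule extension_eqI[OF mult_env_Cauchy[OF s s']])
        (simp add: \<phi>_mult env_CauchyD[OF s] env_CauchyD[OF s'] lim[OF s] lim[OF s']
          bounded_bilinear.tendsto[OF bounded_bilinear_blinfun_compose])
  qed
  moreover have "extension ` (env_Cauchy A // env_rel A) = closure (\<phi> ` elems A)"
  proof
    show "extension ` (env_Cauchy A // env_rel A) \<subseteq> closure (\<phi> ` elems A)"
      using quot mem by blast
    show "closure (\<phi> ` elems A) \<subseteq> extension ` (env_Cauchy A // env_rel A)"
    proof
      fix T assume "T \<in> closure (\<phi> ` elems A)"
      then obtain s where s: "s \<in> env_Cauchy A" "(\<lambda>n. \<phi> (s n)) \<longlonglongrightarrow> T"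
        using extension_surj by blast
      then show "T \<in> extension ` (env_Cauchy A // env_rel A)"
        using extension_eqI[OF s] quotientI[OF s(1)] by (metis imageI)
    qed
  qed
  ultimately show ?thesis
    by (simp add: star_epimorphism_def enveloping_cstar_def op_algebra_def)
qed

end

section \<open>Function algebras on compact spaces\<close>

lemma continuous_map_tendsto_iff:
  "continuous_map Y euclidean f \<longleftrightarrow> (\<forall>y\<in>topspace Y. (f \<longlongrightarrow> f y) (atin Y y))"
  by (simp add: continuous_map_atin)

lemma continuous_map_if_clopen:
  fixes f :: "'y \<Rightarrow> complex"
  assumes K: "openin Y K" "closedin Y K"
    and f: "continuous_map (subtopology Y K) euclidean f"
  shows "continuous_map Y euclidean (\<lambda>y. if y \<in> K then f y else 0)"
  unfolding continuous_map_def
proof (intro conjI allI impI)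
  fix V :: "complex set" assume V: "openin euclidean V"
  have "openin (subtopology Y K) {y \<in> topspace (subtopology Y K). f y \<in> V}"
    using f V by (rule openin_continuous_map_preimage)
  then have 1: "openin Y {y \<in> topspace (subtopology Y K). f y \<in> V}"
    using K(1) by (simp add: openin_open_subtopology)
  have 2: "openin Y (if 0 \<in> V then topspace Y - K else {})"
    using K(2) by auto
  have "{y \<in> topspace Y. (if y \<in> K then f y else 0) \<in> V} =
      {y \<in> topspace (subtopology Y K). f y \<in> V} \<union> (if 0 \<in> V then topspace Y - K else {})"
    by auto
  then show "openin Y {y \<in> topspace Y. (if y \<in> K then f y else 0) \<in> V}"
    using openin_Un[OF 1 2] by simp
qed auto

lemma C_onD: "f \<in> C_on Y K \<Longrightarrow> continuous_map Y euclidean f"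
  "f \<in> C_on Y K \<Longrightarrow> y \<notin> K \<Longrightarrow> f y = 0"
  by (auto simp: C_on_def)

lemma C_on_mono: "f \<in> C_on Y K \<Longrightarrow> K \<subseteq> K' \<Longrightarrow> f \<in> C_on Y K'"
  by (auto simp: C_on_def)

lemma C_on_intros:
  "(\<lambda>_. 0) \<in> C_on Y K"
  "f \<in> C_on Y K \<Longrightarrow> g \<in> C_on Y K \<Longrightarrow> (\<lambda>y. f y + g y) \<in> C_on Y K"
  "f \<in> C_on Y K \<Longrightarrow> g \<in> C_on Y K \<Longrightarrow> (\<lambda>y. f y - g y) \<in> C_on Y K"
  "f \<in> C_on Y K \<Longrightarrow> (\<lambda>y. c * f y) \<in> C_on Y K"
  "f \<in> C_on Y K \<Longrightarrow> (\<lambda>y. cnj (f y)) \<in> C_on Y K"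
  "f \<in> C_on Y K \<Longrightarrow> g \<in> C_on Y K' \<Longrightarrow> (\<lambda>y. f y * g y) \<in> C_on Y K"
  "f \<in> C_on Y K' \<Longrightarrow> g \<in> C_on Y K \<Longrightarrow> (\<lambda>y. f y * g y) \<in> C_on Y K"
  by (auto simp: C_on_def continuous_map_tendsto_iff intro!: tendsto_intros)

lemma C_on_pullback:
  fixes b :: "'y \<Rightarrow> complex"
  assumes K: "openin Y K" "closedin Y K" and g: "continuous_map (subtopology Y K) Y g"
    and b: "b \<in> C_on Y K'"
  shows "pullback K g b \<in> C_on Y K"
  using continuous_map_if_clopen[OF K, of "\<lambda>y. b (g y)"] continuous_map_compose[OF g C_onD(1)[OF b]]
  by (simp add: C_on_def pullback_def comp_def)

lemma C_on_indicator:
  assumes K: "openin Y K" "closedin Y K"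
  shows "(\<lambda>y. if y \<in> K then 1 else 0) \<in> C_on Y K"
  using continuous_map_if_clopen[OF K, of "\<lambda>_. 1"] by (simp add: C_on_def)

text \<open>\<open>sup_norm\<close> is a supremum over the whole type, so it is the intended one
  only for functions known to be bounded; compactness covers the space, and off the space they
  vanish.\<close>

lemma C_on_bounded:
  assumes Y: "compact_space Y" and K: "K \<subseteq> topspace Y" and f: "f \<in> C_on Y K"
  shows "bdd_above (range (\<lambda>y. cmod (f y)))"
proof -
  have "compactin euclidean (f ` topspace Y)"
    using Y C_onD(1)[OF f] image_compactin by (metis compact_space_def)
  then have "bounded (f ` topspace Y)"
    by (simp add: compact_imp_bounded)
  then obtain B where B: "\<And>y. y \<in> topspace Y \<Longrightarrow> cmod (f y) \<le> B"
    by (auto simp: bounded_iff)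
  have "cmod (f y) \<le> max B 0" for y
    using B[of y] C_onD(2)[OF f, of y] K
    by (metis le_max_iff_disj norm_zero order_refl subsetD)
  then show ?thesis by (auto simp: bdd_above_def)
qed

lemma sup_norm_least: "(\<And>y. cmod (f y) \<le> B) \<Longrightarrow> sup_norm f \<le> B"
  unfolding sup_norm_def by (rule cSUP_least) auto

lemma sup_norm_upper: "bdd_above (range (\<lambda>y. cmod (f y))) \<Longrightarrow> cmod (f y) \<le> sup_norm f"
  unfolding sup_norm_def by (rule cSUP_upper) auto

lemma sup_norm_zero [simp]: "sup_norm (\<lambda>_. 0) = 0"
  by (simp add: sup_norm_def)

lemma sup_norm_cnj [simp]: "sup_norm (\<lambda>y. cnj (f y)) = sup_norm f"
  by (simp add: sup_norm_def)

lemma sup_norm_minus_commute: "sup_norm (\<lambda>y. f y - g y) = sup_norm (\<lambda>y. g y - f y)"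
  by (simp add: sup_norm_def norm_minus_commute)

locale compact_top =
  fixes Y :: "'y topology"
  assumes compact: "compact_space Y"
begin

lemma norm_le_sup: "f \<in> C_all Y \<Longrightarrow> cmod (f y) \<le> sup_norm f"
  by (rule sup_norm_upper[OF C_on_bounded[OF compact]]) auto

lemma sup_norm_nonneg: "f \<in> C_all Y \<Longrightarrow> 0 \<le> sup_norm f"
  using norm_le_sup[of f undefined] norm_ge_zero order_trans by blast

lemma sup_norm_triangle:
  "f \<in> C_all Y \<Longrightarrow> g \<in> C_all Y \<Longrightarrow> sup_norm (\<lambda>y. f y + g y) \<le> sup_norm f + sup_norm g"
  by (rule sup_norm_least) (meson add_mono norm_le_sup norm_triangle_ineq order_trans)

lemma sup_norm_mult:
  "f \<in> C_all Y \<Longrightarrow> g \<in> C_all Y \<Longrightarrow> sup_norm (\<lambda>y. f y * g y) \<le> sup_norm f * sup_norm g"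
  by (rule sup_norm_least) (simp add: norm_mult mult_mono norm_le_sup sup_norm_nonneg)

lemma sup_norm_scale_le: "f \<in> C_all Y \<Longrightarrow> sup_norm (\<lambda>y. c * f y) \<le> cmod c * sup_norm f"
  by (rule sup_norm_least) (simp add: norm_mult mult_left_mono norm_le_sup)

lemma sup_norm_pullback_le: "f \<in> C_all Y \<Longrightarrow> sup_norm (pullback K g f) \<le> sup_norm f"
  by (rule sup_norm_least) (simp add: pullback_def norm_le_sup sup_norm_nonneg)

end

text \<open>Puts function types into the class \<open>t2_space\<close>, in which
  \<open>function_ring_on\<close> places its points: two functions that differ at \<open>x\<close>
  are separated by sets defined by the coordinate \<open>x\<close> alone.\<close>

lemma fun_hausdorff:
  fixes f g :: "'a \<Rightarrow> 'b::t2_space"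
  assumes "f \<noteq> g"
  shows "\<exists>V W. open V \<and> open W \<and> f \<in> V \<and> g \<in> W \<and> V \<inter> W = {}"
proof -
  from assms obtain x where "f x \<noteq> g x" by blast
  then obtain V W where VW: "open V" "open W" "f x \<in> V" "g x \<in> W" "V \<inter> W = {}"
    by (meson hausdorff)
  have "open {h :: 'a \<Rightarrow> 'b. h x \<in> V'}" if "open V'" for V'
    using that open_vimage[OF that continuous_on_product_coordinates[of x]] by (simp add: vimage_def)
  then have "open {h. h x \<in> V}" "open {h. h x \<in> W}"
    using VW by auto
  then show "\<exists>V W. open V \<and> open W \<and> f \<in> V \<and> g \<in> W \<and> V \<inter> W = {}"
    using VW by (intro exI[of _ "{h. h x \<in> V}"] exI[of _ "{h. h x \<in> W}"]) auto
qed

instance "fun" :: (type, t2_space) t0_space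
proof
  show "\<exists>V. open V \<and> \<not> (f \<in> V \<longleftrightarrow> g \<in> V)" if "f \<noteq> g" for f g :: "'a \<Rightarrow> 'b"
    using fun_hausdorff[OF that] by blast
qed

instance "fun" :: (type, t2_space) t1_space
proof
  show "\<exists>V. open V \<and> f \<in> V \<and> g \<notin> V" if "f \<noteq> g" for f g :: "'a \<Rightarrow> 'b"
    using fun_hausdorff[OF that] by blast
qed

instance "fun" :: (type, t2_space) t2_space
  by standard (rule fun_hausdorff)

text \<open>Evaluation at the points of \<open>Y\<close> maps \<open>Y\<close> onto a compact subset of a product of lines, a space
  of type class \<open>t2_space\<close>.\<close>

lemma stone_weierstrass_topology:
  fixes Y :: "'y topology" and R :: "('y \<Rightarrow> real) set"
  assumes Y: "compact_space Y"
    and cont: "\<And>g. g \<in> R \<Longrightarrow> continuous_map Y euclidean g"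
    and add: "\<And>g h. g \<in> R \<Longrightarrow> h \<in> R \<Longrightarrow> (\<lambda>y. g y + h y) \<in> R"
    and mult: "\<And>g h. g \<in> R \<Longrightarrow> h \<in> R \<Longrightarrow> (\<lambda>y. g y * h y) \<in> R"
    and const: "\<And>c. \<exists>g\<in>R. \<forall>y\<in>topspace Y. g y = c"
    and sep: "\<And>y z. y \<in> topspace Y \<Longrightarrow> z \<in> topspace Y \<Longrightarrow> y \<noteq> z \<Longrightarrow> \<exists>g\<in>R. g y \<noteq> g z"
    and f: "continuous_map Y euclidean f" and e: "e > 0"
  shows "\<exists>g\<in>R. \<forall>y\<in>topspace Y. \<bar>f y - g y\<bar> < e"
proof -
  \<comment> \<open>Coordinates indexed by discontinuous functions are set to \<open>0\<close>; this
    makes \<open>ev\<close> continuous into the product.\<close>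
  define ev :: "'y \<Rightarrow> ('y \<Rightarrow> real) \<Rightarrow> real"
    where "ev y = (\<lambda>g. if continuous_map Y euclidean g then g y else 0)" for y
  define S where "S = ev ` topspace Y"
  define R' where "R' = {G :: (('y \<Rightarrow> real) \<Rightarrow> real) \<Rightarrow> real.
    continuous_on S G \<and> (\<exists>g\<in>R. \<forall>y\<in>topspace Y. G (ev y) = g y)}"
  have "continuous_map Y (product_topology (\<lambda>_. euclidean) UNIV) ev"
    by (auto simp: continuous_map_componentwise_UNIV ev_def)
  then have "continuous_map Y euclidean ev" by (simp add: euclidean_product_topology)
  then have "compact S"
    using Y image_compactin by (metis S_def compact_space_def compactin_euclidean_iff)
  have coord: "continuous_on S (\<lambda>G. G g)" for g :: "'y \<Rightarrow> real"
    by (rule continuous_on_subset[OF continuous_on_product_coordinates]) simp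
  interpret function_ring_on R' S
  proof
    show "compact S" by fact
    show "continuous_on S G" if "G \<in> R'" for G using that by (simp add: R'_def)
    show "(\<lambda>x. G x + H x) \<in> R'" if GH: "G \<in> R'" "H \<in> R'" for G H
    proof -
      obtain g h where "g \<in> R" "h \<in> R" "\<forall>y\<in>topspace Y. G (ev y) = g y" "\<forall>y\<in>topspace Y. H (ev y) = h y"
        using GH by (auto simp: R'_def)
      then show ?thesis
        using GH add[of g h] by (auto simp: R'_def intro!: continuous_on_add bexI[of _ "\<lambda>y. g y + h y"])
    qed
    show "(\<lambda>x. G x * H x) \<in> R'" if GH: "G \<in> R'" "H \<in> R'" for G H
    proof -
      obtain g h where "g \<in> R" "h \<in> R" "\<forall>y\<in>topspace Y. G (ev y) = g y" "\<forall>y\<in>topspace Y. H (ev y) = h y"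
        using GH by (auto simp: R'_def)
      then show ?thesis
        using GH mult[of g h] by (auto simp: R'_def intro!: continuous_on_mult bexI[of _ "\<lambda>y. g y * h y"])
    qed
    show "(\<lambda>_. c) \<in> R'" for c using const[of c] by (auto simp: R'_def)
    show "\<exists>G\<in>R'. G x \<noteq> G y" if xy: "x \<in> S" "y \<in> S" "x \<noteq> y" for x y
    proof -
      obtain x' y' where xy: "x = ev x'" "y = ev y'" "x' \<in> topspace Y" "y' \<in> topspace Y" "x' \<noteq> y'"
        using xy unfolding S_def by blast
      then obtain g where g: "g \<in> R" "g x' \<noteq> g y'" using sep by blast
      then have "(\<lambda>G. G g) \<in> R'" using coord cont by (auto simp: R'_def ev_def)
      then show ?thesis using g cont xy by (intro bexI[of _ "\<lambda>G. G g"]) (auto simp: ev_def)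
    qed
  qed
  obtain G where G: "G \<in> R'" "\<And>x. x \<in> S \<Longrightarrow> \<bar>x f - G x\<bar> < e"
    using Stone_Weierstrass_basic[OF coord[of f] e] by blast
  then obtain g where g: "g \<in> R" "\<forall>y\<in>topspace Y. G (ev y) = g y" by (auto simp: R'_def)
  have "\<bar>f y - g y\<bar> < e" if "y \<in> topspace Y" for y
    using G(2)[of "ev y"] g(2) that f by (simp add: S_def ev_def)
  then show ?thesis using g(1) by blast
qed

section \<open>The reversible extension\<close>

lemma closedin_adjoin_point:
  assumes "closedin X K"
  shows "closedin (adjoin_point X) (Some ` K)"
proof -
  have "Some -` (topspace (adjoin_point X) - Some ` K) = topspace X - K"
    by (auto simp: topspace_adjoin_point)
  then show ?thesis
    using assms closedin_subset[OF assms]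
    by (auto simp: closedin_def openin_adjoin_point topspace_adjoin_point)
qed

lemma openin_adjoin_point_Some: "openin X K \<Longrightarrow> openin (adjoin_point X) (Some ` K)"
  by (simp add: openin_adjoin_point inj_vimage_image_eq)

lemma openin_adjoin_point_None: "openin (adjoin_point X) {None}"
  by (simp add: openin_adjoin_point vimage_def)

lemma continuous_map_Some: "continuous_map X (adjoin_point X) Some"
  unfolding continuous_map_def
proof (intro conjI allI impI)
  fix V assume V: "openin (adjoin_point X) V"
  have "{x \<in> topspace X. Some x \<in> V} = Some -` V"
    using openin_subset[OF V] by (auto simp: topspace_adjoin_point)
  then show "openin X {x \<in> topspace X. Some x \<in> V}"
    using V by (simp add: openin_adjoin_point)
qed (auto simp: topspace_adjoin_point)

lemma continuous_map_the:
  "continuous_map (subtopology (adjoin_point X) (Some ` topspace X)) X the"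
  unfolding continuous_map_def
proof (intro conjI allI impI)
  fix V assume V: "openin X V"
  have "{x \<in> topspace (subtopology (adjoin_point X) (Some ` topspace X)). the x \<in> V} = Some ` V"
    using openin_subset[OF V] by (auto simp: topspace_adjoin_point)
  moreover have "openin (subtopology (adjoin_point X) (Some ` topspace X)) (Some ` V)"
    using openin_subset[OF V] V
    by (auto simp: openin_subtopology intro!: exI[of _ "Some ` V"] openin_adjoin_point_Some)
  ultimately show "openin (subtopology (adjoin_point X) (Some ` topspace X))
      {x \<in> topspace (subtopology (adjoin_point X) (Some ` topspace X)). the x \<in> V}"
    by simp
qed (auto simp: topspace_adjoin_point)

lemma continuous_map_case_option:
  fixes a :: "'x \<Rightarrow> complex"
  assumes a: "continuous_map X euclidean a"
  shows "continuous_map (adjoin_point X) euclidean (case_option 0 a)"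
  unfolding continuous_map_def
proof (intro conjI allI impI)
  fix V :: "complex set" assume V: "openin euclidean V"
  have "Some -` {x \<in> topspace (adjoin_point X). case_option 0 a x \<in> V} = {x \<in> topspace X. a x \<in> V}"
    by (auto simp: topspace_adjoin_point)
  then show "openin (adjoin_point X) {x \<in> topspace (adjoin_point X). case_option 0 a x \<in> V}"
    using openin_continuous_map_preimage[OF a V] by (simp add: openin_adjoin_point)
qed auto

lemma Hausdorff_adjoin_point:
  assumes "Hausdorff_space X"
  shows "Hausdorff_space (adjoin_point X)"
  unfolding Hausdorff_space_def
proof (intro allI impI, elim conjE)
  fix x y assume xy: "x \<in> topspace (adjoin_point X)" "y \<in> topspace (adjoin_point X)" "x \<noteq> y"
  have N: "\<exists>U V. openin (adjoin_point X) U \<and> openin (adjoin_point X) V \<and> None \<in> U \<and> Some z \<in> V \<and> disjnt U V"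
    if "z \<in> topspace X" for z
    using that
    by (intro exI[of _ "{None}"] exI[of _ "Some ` topspace X"])
      (auto simp: openin_adjoin_point_None openin_adjoin_point_Some disjnt_def)
  have S: "\<exists>U V. openin (adjoin_point X) U \<and> openin (adjoin_point X) V \<and> Some z \<in> U \<and> Some w \<in> V \<and> disjnt U V"
    if zw: "z \<in> topspace X" "w \<in> topspace X" "z \<noteq> w" for z w
  proof -
    obtain U V where "openin X U" "openin X V" "z \<in> U" "w \<in> V" "disjnt U V"
      using assms zw unfolding Hausdorff_space_def by meson
    then show ?thesis
      by (intro exI[of _ "Some ` U"] exI[of _ "Some ` V"])
        (auto simp: openin_adjoin_point_Some disjnt_def)
  qed
  show "\<exists>U V. openin (adjoin_point X) U \<and> openin (adjoin_point X) V \<and> x \<in> U \<and> y \<in> V \<and> disjnt U V"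
  proof (cases x)
    case None
    then show ?thesis using N xy by (auto simp: topspace_adjoin_point)
  next
    case (Some z)
    show ?thesis
    proof (cases y)
      case None
      then show ?thesis
        using N[of z] xy Some by (force simp: topspace_adjoin_point disjnt_sym)
    next
      case w: (Some w)
      then show ?thesis using S[of z w] xy Some by (auto simp: topspace_adjoin_point)
    qed
  qed
qed

lemma compact_adjoin_point:
  assumes "compact_space X"
  shows "compact_space (adjoin_point X)"
proof -
  have "compactin (adjoin_point X) (Some ` topspace X)"
    using assms continuous_map_Some by (auto simp: compact_space_def intro: image_compactin)
  moreover have "compactin (adjoin_point X) {None}"
    by (rule finite_imp_compactin) (auto simp: topspace_adjoin_point)
  ultimately have "compactin (adjoin_point X) (Some ` topspace X \<union> {None})"
    by (rule compactin_Un)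
  then show ?thesis
    by (simp add: compact_space_def topspace_adjoin_point)
qed

text \<open>Induction outwards from \<open>0\<close>: each step puts one more factor in front of a
  power, whereas a step towards \<open>0\<close> would leave a projection behind.\<close>

lemma int_cases_induct:
  assumes "P 0" "\<And>n. P (int n) \<Longrightarrow> P (int (Suc n))" "\<And>n. P (- int n) \<Longrightarrow> P (- int (Suc n))"
  shows "P (k::int)"
proof -
  have "P (int n)" "P (- int n)" for n
    by (induction n) (use assms in \<open>auto simp del: of_nat_Suc\<close>)
  then show ?thesis by (metis int_cases2)
qed

section \<open>Admissible sequences and compactness of the extension\<close>

locale partial_system =
  fixes X :: "'x topology" and D :: "'x set" and \<alpha> :: "'x \<Rightarrow> 'x"
  assumes compact_X: "compact_space X" and Hausdorff_X: "Hausdorff_space X"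
    and open_D: "openin X D" and closed_D: "closedin X D"
    and cont_\<alpha>: "continuous_map (subtopology X D) X \<alpha>" and open_image: "openin X (\<alpha> ` D)"
begin

lemma D_subset: "D \<subseteq> topspace X"
  using open_D openin_subset by blast

lemma \<alpha>_topspace: "z \<in> D \<Longrightarrow> \<alpha> z \<in> topspace X"
  using cont_\<alpha> D_subset by (auto simp: continuous_map_def)

lemma closed_image: "closedin X (\<alpha> ` D)"
proof -
  have "compactin (subtopology X D) D"
    using closedin_compact_space[OF compact_X closed_D] by (simp add: compactin_subtopology)
  then show ?thesis
    using image_compactin[OF _ cont_\<alpha>] compactin_imp_closedin[OF Hausdorff_X] by blast
qed

abbreviation XE :: "(nat \<Rightarrow> 'x option) topology" where
  "XE \<equiv> ext_space X D \<alpha>"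

abbreviation Y :: "(nat \<Rightarrow> 'x option) set" where
  "Y \<equiv> topspace XE"

text \<open>A condition on neighbouring coordinates that treats finite and infinite sequences alike.
  It exhibits the extension as an intersection of sets defined by two coordinates, which suits the
  product topology.\<close>

definition admissible :: "(nat \<Rightarrow> 'x option) \<Rightarrow> bool" where
  "admissible x \<longleftrightarrow> x 0 \<in> Some ` topspace X \<and>
    (\<forall>n. x (Suc n) = None \<and> x n \<notin> Some ` \<alpha> ` D \<or>
         x (Suc n) \<in> Some ` D \<and> x n = Some (\<alpha> (the (x (Suc n)))))"

lemma admissible_0: "admissible x \<Longrightarrow> \<exists>z\<in>topspace X. x 0 = Some z"
  by (auto simp: admissible_def)

lemma admissible_Suc_None: "admissible x \<Longrightarrow> x (Suc n) = None \<Longrightarrow> x n \<notin> Some ` \<alpha> ` D"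
  unfolding admissible_def by force

lemma admissible_Suc_Some: "admissible x \<Longrightarrow> x (Suc n) = Some z \<Longrightarrow> z \<in> D \<and> x n = Some (\<alpha> z)"
  unfolding admissible_def by (metis imageE option.distinct(1) option.sel)

lemma admissibleI:
  assumes "z \<in> topspace X" "x 0 = Some z"
    and "\<And>n. x (Suc n) = None \<Longrightarrow> x n \<notin> Some ` \<alpha> ` D"
    and "\<And>n z. x (Suc n) = Some z \<Longrightarrow> z \<in> D \<and> x n = Some (\<alpha> z)"
  shows "admissible x"
  unfolding admissible_def using assms by (metis imageI not_None_eq option.sel)

lemma admissible_power_dom:
  "admissible x \<Longrightarrow> x n = Some z \<Longrightarrow> z \<in> power_dom (topspace X) D \<alpha> n"
  by (induction n arbitrary: z) (use admissible_0 admissible_Suc_Some in fastforce)+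

lemma power_dom_subset: "power_dom (topspace X) D \<alpha> n \<subseteq> topspace X"
  using D_subset by (cases n) auto

lemma admissible_iff: "x \<in> (\<Union>N. ext_fin X D \<alpha> N) \<union> ext_inf X D \<alpha> \<longleftrightarrow> admissible x"
proof
  assume "x \<in> (\<Union>N. ext_fin X D \<alpha> N) \<union> ext_inf X D \<alpha>"
  then show "admissible x"
  proof
    assume "x \<in> (\<Union>N. ext_fin X D \<alpha> N)"
    then obtain N y where x: "x = (\<lambda>n. if n \<le> N then Some (y n) else None)"
      and y: "\<forall>n\<le>N. y n \<in> power_dom (topspace X) D \<alpha> n" "y N \<notin> \<alpha> ` D" "\<forall>n\<in>{1..N}. \<alpha> (y n) = y (n - 1)"
      by (auto simp: ext_fin_def)
    show ?thesis
    proof (rule admissibleI[of "y 0"])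
      fix n assume "x (Suc n) = None"
      then show "x n \<notin> Some ` \<alpha> ` D" using y(2) by (cases "n = N") (auto simp: x split: if_splits)
    next
      fix n z assume "x (Suc n) = Some z"
      then show "z \<in> D \<and> x n = Some (\<alpha> z)"
        using y(1)[rule_format, of "Suc n"] y(3) by (auto simp: x split: if_splits)
    qed (use y(1) in \<open>auto simp: x\<close>)
  next
    assume "x \<in> ext_inf X D \<alpha>"
    then obtain y where x: "x = (\<lambda>n. Some (y n))"
      and y: "\<forall>n. y n \<in> power_dom (topspace X) D \<alpha> n" "\<forall>n\<ge>1. \<alpha> (y n) = y (n - 1)"
      by (auto simp: ext_inf_def)
    show ?thesis
    proof (rule admissibleI[of "y 0"])
      fix n z assume "x (Suc n) = Some z"
      then show "z \<in> D \<and> x n = Some (\<alpha> z)"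
        using y(1)[rule_format, of "Suc n"] y(2) by (auto simp: x)
    qed (use y(1)[rule_format, of 0] in \<open>auto simp: x\<close>)
  qed
next
  assume x: "admissible x"
  define y where "y n = the (x n)" for n
  show "x \<in> (\<Union>N. ext_fin X D \<alpha> N) \<union> ext_inf X D \<alpha>"
  proof (cases "\<forall>n. x n \<noteq> None")
    case True
    then have xy: "x n = Some (y n)" for n by (simp add: y_def)
    have "\<forall>n\<ge>1. \<alpha> (y n) = y (n - 1)"
    proof (intro allI impI)
      fix n :: nat assume "n \<ge> 1"
      then obtain m where "n = Suc m" by (cases n) auto
      then show "\<alpha> (y n) = y (n - 1)"
        using admissible_Suc_Some[OF x xy[of "Suc m"]] xy[of m] by simp
    qed
    moreover have "x = (\<lambda>n. Some (y n))" using xy by auto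
    ultimately have "x \<in> ext_inf X D \<alpha>"
      unfolding ext_inf_def using admissible_power_dom[OF x xy] by blast
    then show ?thesis by simp
  next
    case False
    define M where "M = (LEAST n. x n = None)"
    have M: "x M = None" using False unfolding M_def by (metis (mono_tags, lifting) LeastI)
    have "M \<noteq> 0" using M admissible_0[OF x] by (metis option.distinct(1))
    then obtain N where N: "M = Suc N" by (cases M) auto
    have le: "x n = Some (y n)" if "n \<le> N" for n
      using that N not_less_Least[of n "\<lambda>n. x n = None"] by (auto simp: M_def y_def)
    have gt: "x n = None" if "n \<ge> M" for n
      using that
    proof (induction n rule: dec_induct)
      case (step n)
      then show ?case using admissible_Suc_Some[OF x, of n] by (cases "x (Suc n)") auto
    qed (rule M)
    have "x = (\<lambda>n. if n \<le> N then Some (y n) else None)"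
      using le gt N by auto
    moreover have "\<forall>n\<in>{1..N}. \<alpha> (y n) = y (n - 1)"
    proof
      fix n assume n: "n \<in> {1..N}"
      then obtain m where m: "n = Suc m" by (cases n) auto
      then show "\<alpha> (y n) = y (n - 1)"
        using admissible_Suc_Some[OF x, of m "y n"] le[of "Suc m"] le[of m] n by simp
    qed
    moreover have "y N \<notin> \<alpha> ` D"
      using admissible_Suc_None[OF x, of N] M N le[of N] by auto
    moreover have "\<forall>n\<le>N. y n \<in> power_dom (topspace X) D \<alpha> n"
      using le admissible_power_dom[OF x] by blast
    ultimately have "x \<in> ext_fin X D \<alpha> N" unfolding ext_fin_def by blast
    then show ?thesis by blast
  qed
qed

abbreviation PX :: "(nat \<Rightarrow> 'x option) topology" where
  "PX \<equiv> product_topology (\<lambda>_. adjoin_point X) UNIV"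

lemma XE_eq: "XE = subtopology PX {x. admissible x}"
proof -
  have "(\<Union>N. ext_fin X D \<alpha> N) \<union> ext_inf X D \<alpha> = {x. admissible x}"
    using admissible_iff by blast
  then show ?thesis by (simp add: ext_space_def)
qed

lemma admissible_PX: "admissible x \<Longrightarrow> x \<in> topspace PX"
proof -
  assume x: "admissible x"
  have "x n \<in> insert None (Some ` topspace X)" for n
    using admissible_power_dom[OF x, of n] power_dom_subset by (cases "x n") auto
  then show "x \<in> topspace PX" by (auto simp: topspace_adjoin_point)
qed

lemma Y_iff: "x \<in> Y \<longleftrightarrow> admissible x"
  using admissible_PX by (auto simp: XE_eq)

lemma continuous_map_coordinate_PX: "continuous_map PX (adjoin_point X) (\<lambda>x. x n)"
  using continuous_map_product_projection[of n UNIV "\<lambda>_. adjoin_point X"] by simp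

lemma continuous_map_the_coordinate:
  assumes Z: "continuous_map Z (adjoin_point X) h" and K: "h ` topspace Z \<subseteq> Some ` topspace X"
  shows "continuous_map Z X (\<lambda>x. the (h x))"
proof -
  have "continuous_map Z (subtopology (adjoin_point X) (Some ` topspace X)) h"
    using Z K by (simp add: continuous_map_in_subtopology image_subset_iff_funcset)
  from continuous_map_compose[OF this continuous_map_the] show ?thesis by (simp add: comp_def)
qed

text \<open>Each topological assumption closes one piece: openness of the image of
  \<open>\<alpha>\<close> makes \<open>B n\<close> closed, closedness of \<open>D\<close> makes
  \<open>S n\<close> closed, and continuity with the Hausdorff property makes the equaliser
  \<open>C n\<close> closed in \<open>S n\<close>.\<close>

lemma closedin_admissible: "closedin PX {x. admissible x}"
proof -
  define A0 where "A0 = {x \<in> topspace PX. x 0 \<in> Some ` topspace X}"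
  define B where "B n = {x \<in> topspace PX. x (Suc n) = None \<and> x n \<notin> Some ` \<alpha> ` D}" for n
  define S where "S n = {x \<in> topspace PX. x (Suc n) \<in> Some ` D}" for n
  define C where "C n = {x \<in> topspace (subtopology PX (S n)). x n = Some (\<alpha> (the (x (Suc n))))}" for n
  note pre = closedin_continuous_map_preimage[OF continuous_map_coordinate_PX]
  have A0: "closedin PX A0"
    unfolding A0_def by (rule pre) (simp add: closedin_adjoin_point)
  have S: "closedin PX (S n)" for n
    unfolding S_def by (rule pre) (simp add: closedin_adjoin_point closed_D)
  have B: "closedin PX (B n)" for n
  proof -
    have "closedin (adjoin_point X) {None}"
      using openin_adjoin_point_Some[of X "topspace X"]
      by (auto simp: closedin_def topspace_adjoin_point insert_Diff_if image_iff)
    then have 1: "closedin PX {x \<in> topspace PX. x (Suc n) \<in> {None}}" by (rule pre)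
    have "closedin (adjoin_point X) (topspace (adjoin_point X) - Some ` \<alpha> ` D)"
      using openin_adjoin_point_Some[OF open_image] by (simp add: closedin_diff)
    then have 2: "closedin PX {x \<in> topspace PX. x n \<in> topspace (adjoin_point X) - Some ` \<alpha> ` D}"
      by (rule pre)
    have "B n = {x \<in> topspace PX. x (Suc n) \<in> {None}} \<inter>
        {x \<in> topspace PX. x n \<in> topspace (adjoin_point X) - Some ` \<alpha> ` D}"
      by (auto simp: B_def)
    then show ?thesis using closedin_Int[OF 1 2] by simp
  qed
  have C: "closedin PX (C n)" for n
  proof -
    have coord: "continuous_map (subtopology PX (S n)) (adjoin_point X) (\<lambda>x. x m)" for m
      by (rule continuous_map_from_subtopology[OF continuous_map_coordinate_PX])
    have "continuous_map (subtopology PX (S n)) X (\<lambda>x. the (x (Suc n)))"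
      by (rule continuous_map_the_coordinate[OF coord]) (use D_subset in \<open>auto simp: S_def\<close>)
    then have "continuous_map (subtopology PX (S n)) (subtopology X D) (\<lambda>x. the (x (Suc n)))"
      by (auto simp: continuous_map_in_subtopology S_def)
    from continuous_map_compose[OF continuous_map_compose[OF this cont_\<alpha>] continuous_map_Some]
    have "continuous_map (subtopology PX (S n)) (adjoin_point X) (\<lambda>x. Some (\<alpha> (the (x (Suc n)))))"
      by (simp add: comp_def)
    then have "closedin (subtopology PX (S n)) (C n)"
      unfolding C_def by (rule closedin_continuous_maps_eq[OF Hausdorff_adjoin_point[OF Hausdorff_X] coord])
    then show ?thesis using S closedin_trans_full by blast
  qed
  define P where "P n x \<longleftrightarrow> x (Suc n) = None \<and> x n \<notin> Some ` \<alpha> ` D \<or>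
    x (Suc n) \<in> Some ` D \<and> x n = Some (\<alpha> (the (x (Suc n))))" for n and x :: "nat \<Rightarrow> 'x option"
  have "B n \<union> C n = {x \<in> topspace PX. P n x}" for n
    unfolding B_def C_def S_def P_def topspace_subtopology by blast
  moreover have "admissible x \<longleftrightarrow> x \<in> topspace PX \<and> x 0 \<in> Some ` topspace X \<and> (\<forall>n. P n x)" for x
    using admissible_PX[of x] unfolding admissible_def P_def by blast
  ultimately have "{x. admissible x} = A0 \<inter> (\<Inter>n. B n \<union> C n)"
    by (simp only: A0_def) blast
  moreover have "closedin PX (\<Inter>n. B n \<union> C n)"
    using B C by (intro closedin_INT) auto
  ultimately show ?thesis using closedin_Int[OF A0] by simp
qed

lemma compact_XE: "compact_space XE"
proof -
  have "compact_space PX"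
    by (simp add: compact_space_product_topology compact_adjoin_point compact_X)
  then show ?thesis
    unfolding XE_eq using closedin_compact_space closedin_admissible compact_space_subtopology by blast
qed

sublocale E: compact_top XE by unfold_locales (rule compact_XE)

sublocale B: compact_top X by unfold_locales (rule compact_X)

lemma continuous_map_coordinate: "continuous_map XE (adjoin_point X) (\<lambda>x. x n)"
  unfolding XE_eq by (rule continuous_map_from_subtopology[OF continuous_map_coordinate_PX])

lemma continuous_map_into_XE:
  assumes "\<And>n. continuous_map Z (adjoin_point X) (\<lambda>x. h x n)" "\<And>x. x \<in> topspace Z \<Longrightarrow> h x \<in> Y"
  shows "continuous_map Z XE h"
  unfolding XE_eq continuous_map_in_subtopology
  using assms by (auto simp: continuous_map_componentwise_UNIV Y_iff)

lemma ext_proj_Y: "x \<in> Y \<Longrightarrow> x 0 = Some (ext_proj x) \<and> ext_proj x \<in> topspace X"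
  using admissible_0 by (force simp: Y_iff ext_proj_def)

lemma continuous_map_ext_proj: "continuous_map XE X ext_proj"
  unfolding ext_proj_def
  by (rule continuous_map_the_coordinate[OF continuous_map_coordinate])
    (use ext_proj_Y in auto)

section \<open>The extended map, its inverse and the powers of the partial automorphism\<close>

abbreviation D1 :: "(nat \<Rightarrow> 'x option) set" where
  "D1 \<equiv> ext_preimage X D \<alpha> D"

abbreviation D2 :: "(nat \<Rightarrow> 'x option) set" where
  "D2 \<equiv> ext_preimage X D \<alpha> (\<alpha> ` D)"

abbreviation shift :: "(nat \<Rightarrow> 'x option) \<Rightarrow> nat \<Rightarrow> 'x option" where
  "shift x \<equiv> \<lambda>n. x (Suc n)"

lemma clopen_preimages:
  "openin XE D1" "closedin XE D1" "openin XE D2" "closedin XE D2"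
  unfolding ext_preimage_def
  using open_D closed_D open_image closed_image continuous_map_ext_proj
  by (auto intro: openin_continuous_map_preimage closedin_continuous_map_preimage)

lemma D1_Y: "x \<in> D1 \<Longrightarrow> x \<in> Y" and D2_Y: "x \<in> D2 \<Longrightarrow> x \<in> Y"
  by (auto simp: ext_preimage_def)

text \<open>Together with \<open>shift_D2\<close> this shows that the extended map is a bijection
  whose inverse is the left shift.\<close>

lemma ext_map_D1:
  assumes x: "x \<in> D1"
  shows "ext_map \<alpha> x \<in> D2" "shift (ext_map \<alpha> x) = x"
proof -
  have p: "ext_proj x \<in> D" "x 0 = Some (ext_proj x)" "admissible x"
    using x ext_proj_Y by (auto simp: ext_preimage_def Y_iff)
  have "admissible (ext_map \<alpha> x)"
  proof (rule admissibleI)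
    show "ext_map \<alpha> x 0 = Some (\<alpha> (ext_proj x))" by (simp add: ext_map_def)
    show "\<alpha> (ext_proj x) \<in> topspace X" using p \<alpha>_topspace by blast
  next
    fix n assume "ext_map \<alpha> x (Suc n) = None"
    then show "ext_map \<alpha> x n \<notin> Some ` \<alpha> ` D"
      using p admissible_Suc_None[OF p(3)] by (cases n) (auto simp: ext_map_def)
  next
    fix n z assume "ext_map \<alpha> x (Suc n) = Some z"
    then show "z \<in> D \<and> ext_map \<alpha> x n = Some (\<alpha> z)"
      using p admissible_Suc_Some[OF p(3)] by (cases n) (auto simp: ext_map_def)
  qed
  moreover have "ext_proj (ext_map \<alpha> x) = \<alpha> (ext_proj x)"
    unfolding ext_proj_def[of "ext_map \<alpha> x"] by (simp add: ext_map_def)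
  ultimately show "ext_map \<alpha> x \<in> D2"
    using p(1) by (simp add: ext_preimage_def Y_iff)
  show "shift (ext_map \<alpha> x) = x" by (simp add: ext_map_def)
qed

lemma shift_D2:
  assumes x: "x \<in> D2"
  shows "shift x \<in> D1" "ext_map \<alpha> (shift x) = x"
proof -
  have p: "ext_proj x \<in> \<alpha> ` D" "x 0 = Some (ext_proj x)" "admissible x"
    using x ext_proj_Y by (auto simp: ext_preimage_def Y_iff)
  then obtain z where z: "x (Suc 0) = Some z"
    using admissible_Suc_None[OF p(3), of 0] by (cases "x (Suc 0)") auto
  then have z': "z \<in> D" "x 0 = Some (\<alpha> z)"
    using admissible_Suc_Some[OF p(3)] by auto
  have "admissible (shift x)"
    using z z' D_subset p(3) admissible_Suc_Some admissible_Suc_None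
    by (intro admissibleI[of z]) auto
  then show "shift x \<in> D1"
    using z z' by (simp add: ext_preimage_def Y_iff ext_proj_def)
  show "ext_map \<alpha> (shift x) = x"
    using z z' by (auto simp: ext_map_def ext_proj_def fun_eq_iff split: nat.split)
qed

lemma continuous_map_ext_map: "continuous_map (subtopology XE D1) XE (ext_map \<alpha>)"
proof (rule continuous_map_into_XE)
  show "ext_map \<alpha> x \<in> Y" if "x \<in> topspace (subtopology XE D1)" for x
    using that ext_map_D1 D2_Y by auto
  fix n
  show "continuous_map (subtopology XE D1) (adjoin_point X) (\<lambda>x. ext_map \<alpha> x n)"
  proof (cases n)
    case 0
    have "continuous_map (subtopology XE D1) (subtopology X D) ext_proj"
      using continuous_map_from_subtopology[OF continuous_map_ext_proj]
      by (auto simp: continuous_map_in_subtopology ext_preimage_def)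
    from continuous_map_compose[OF continuous_map_compose[OF this cont_\<alpha>] continuous_map_Some]
    show ?thesis using 0 by (simp add: ext_map_def comp_def)
  next
    case (Suc m)
    then show ?thesis
      using continuous_map_from_subtopology[OF continuous_map_coordinate]
      by (simp add: ext_map_def)
  qed
qed

lemma continuous_map_shift: "continuous_map (subtopology XE D2) XE shift"
  by (rule continuous_map_into_XE)
    (use continuous_map_from_subtopology[OF continuous_map_coordinate] shift_D2 D1_Y in auto)

abbreviation dE :: "((nat \<Rightarrow> 'x option) \<Rightarrow> complex) \<Rightarrow> (nat \<Rightarrow> 'x option) \<Rightarrow> complex" where
  "dE \<equiv> pullback D1 (ext_map \<alpha>)"

abbreviation gE :: "((nat \<Rightarrow> 'x option) \<Rightarrow> complex) \<Rightarrow> (nat \<Rightarrow> 'x option) \<Rightarrow> complex" where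
  "gE \<equiv> pullback D2 shift"

lemma dE_closed: "f \<in> C_all XE \<Longrightarrow> dE f \<in> C_all XE"
  and gE_closed: "f \<in> C_all XE \<Longrightarrow> gE f \<in> C_all XE"
  using C_on_pullback[OF clopen_preimages(1,2) continuous_map_ext_map]
    C_on_pullback[OF clopen_preimages(3,4) continuous_map_shift]
    D1_Y D2_Y by (meson C_on_mono subsetI)+

lemma dE_gE: "dE (gE f) x = (if x \<in> D1 then f x else 0)"
  and gE_dE: "gE (dE f) x = (if x \<in> D2 then f x else 0)"
  using ext_map_D1 shift_D2 by (auto simp: pullback_def)

text \<open>The \<open>n\<close>-th power of the partial automorphism, extended by \<open>0\<close> to all functions.\<close>

definition dEpow :: "int \<Rightarrow> ((nat \<Rightarrow> 'x option) \<Rightarrow> complex) \<Rightarrow> (nat \<Rightarrow> 'x option) \<Rightarrow> complex" where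
  "dEpow n = (if 0 \<le> n then dE ^^ nat n else gE ^^ nat (- n))"

text \<open>The cut-off by which the composition of powers fails; by \<open>chi_dEpow\<close> it is
  the image of the unit under the \<open>n\<close>-th power.\<close>

definition chi :: "int \<Rightarrow> (nat \<Rightarrow> 'x option) \<Rightarrow> complex" where
  "chi n x = (if x \<in> ext_dom X D \<alpha> n then 1 else 0)"

lemma dEpow_0 [simp]: "dEpow 0 f = f"
  by (simp add: dEpow_def)

lemma dEpow_Suc: "dEpow (int (Suc n)) f = dE (dEpow (int n) f)"
  and dEpow_minus_Suc: "dEpow (- int (Suc n)) f = gE (dEpow (- int n) f)"
  by (auto simp: dEpow_def nat_add_distrib simp del: of_nat_Suc)

lemma dEpow_pointwise:
  "dEpow k (\<lambda>x. f x * h x) = (\<lambda>x. dEpow k f x * dEpow k h x)"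
  "dEpow k (\<lambda>x. f x + h x) = (\<lambda>x. dEpow k f x + dEpow k h x)"
  "dEpow k (\<lambda>x. c * f x) = (\<lambda>x. c * dEpow k f x)"
  "dEpow k (\<lambda>x. cnj (f x)) = (\<lambda>x. cnj (dEpow k f x))"
  by (induction k rule: int_cases_induct; simp add: dEpow_Suc dEpow_minus_Suc del: of_nat_Suc;
      auto simp: pullback_def fun_eq_iff)+

lemma dEpow_zero [simp]: "dEpow k (\<lambda>_. 0) = (\<lambda>_. 0)"
  by (induction k rule: int_cases_induct)
    (simp_all add: dEpow_Suc dEpow_minus_Suc pullback_def del: of_nat_Suc)

lemma dEpow_closed: "f \<in> C_all XE \<Longrightarrow> dEpow k f \<in> C_all XE"
  by (induction k rule: int_cases_induct)
    (simp_all add: dEpow_Suc dEpow_minus_Suc dE_closed gE_closed del: of_nat_Suc)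

lemma sup_norm_dEpow_le: "f \<in> C_all XE \<Longrightarrow> sup_norm (dEpow k f) \<le> sup_norm f"
proof (induction k rule: int_cases_induct)
  case (2 n)
  then show ?case
    using E.sup_norm_pullback_le[OF dEpow_closed[OF 2(2)], of D1 "ext_map \<alpha>" "int n"]
    by (simp add: dEpow_Suc del: of_nat_Suc)
next
  case (3 n)
  then show ?case
    using E.sup_norm_pullback_le[OF dEpow_closed[OF 3(2)], of D2 shift "- int n"]
    by (simp add: dEpow_minus_Suc del: of_nat_Suc)
qed simp

lemma inv_ext_map: "x \<in> D2 \<Longrightarrow> inv_into D1 (ext_map \<alpha>) x = shift x"
  by (rule inv_into_f_eq) (auto simp: shift_D2 intro!: inj_on_inverseI[of _ shift] ext_map_D1(2))

lemma ext_dom_0: "ext_dom X D \<alpha> 0 = Y"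
  by (simp add: ext_dom_def)

lemma ext_dom_Suc: "x \<in> ext_dom X D \<alpha> (int (Suc n)) \<longleftrightarrow> x \<in> D1 \<and> ext_map \<alpha> x \<in> ext_dom X D \<alpha> (int n)"
  by (simp add: ext_dom_def nat_add_distrib)

lemma ext_dom_minus_Suc:
  "x \<in> ext_dom X D \<alpha> (- int (Suc n)) \<longleftrightarrow> x \<in> D2 \<and> shift x \<in> ext_dom X D \<alpha> (- int n)"
  by (cases n) (auto simp: ext_dom_def nat_add_distrib inv_ext_map)

lemma ext_dom_1: "ext_dom X D \<alpha> 1 = D1"
  using ext_dom_Suc[of _ 0] ext_map_D1 D2_Y by (auto simp: ext_dom_0)

lemma ext_dom_minus_1: "ext_dom X D \<alpha> (-1) = D2"
  using ext_dom_minus_Suc[of _ 0] shift_D2 D1_Y by (auto simp: ext_dom_0)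

lemma ext_dom_Y: "ext_dom X D \<alpha> n \<subseteq> Y"
proof (induction n rule: int_cases_induct)
  case (2 n)
  show ?case using D1_Y by (auto simp del: of_nat_Suc simp: ext_dom_Suc)
next
  case (3 n)
  show ?case using D2_Y by (auto simp del: of_nat_Suc simp: ext_dom_minus_Suc)
qed (simp add: ext_dom_0)

lemma chi_Suc: "chi (int (Suc n)) = dE (chi (int n))"
  and chi_minus_Suc: "chi (- int (Suc n)) = gE (chi (- int n))"
  by (auto simp: chi_def pullback_def ext_dom_Suc ext_dom_minus_Suc fun_eq_iff simp del: of_nat_Suc)

lemma chi_dEpow: "chi n = dEpow n (chi 0)"
  by (induction n rule: int_cases_induct)
    (simp_all add: chi_Suc chi_minus_Suc dEpow_Suc dEpow_minus_Suc del: of_nat_Suc)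

lemma chi_0: "chi 0 = (\<lambda>x. if x \<in> Y then 1 else 0)"
  by (simp add: chi_def ext_dom_0 fun_eq_iff)

lemma chi_closed: "chi n \<in> C_all XE"
proof -
  have "chi 0 \<in> C_all XE" using C_on_indicator[of XE Y] by (simp add: chi_0)
  then show ?thesis using dEpow_closed by (subst chi_dEpow) blast
qed

lemma dEpow_vanish: "(\<And>x. x \<notin> Y \<Longrightarrow> f x = 0) \<Longrightarrow> x \<notin> Y \<Longrightarrow> dEpow k f x = 0"
  by (induction k rule: int_cases_induct)
    (use D1_Y D2_Y in \<open>auto simp: dEpow_Suc dEpow_minus_Suc pullback_def simp del: of_nat_Suc\<close>)

text \<open>For \<open>m \<ge> 0\<close> the factor is automatic. For \<open>m < 0\<close> the new
  step undoes the last inverse step, and what remains of the pair is the cut-off to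
  \<open>D1\<close>.\<close>

lemma dE_dEpow:
  assumes f: "\<And>x. x \<notin> Y \<Longrightarrow> f x = 0"
  shows "dE (dEpow m f) x = chi 1 x * dEpow (m + 1) f x"
proof (cases "m \<ge> 0")
  case True
  then have "dEpow (m + 1) f = dE (dEpow m f)"
    using dEpow_Suc[of "nat m" f] by (simp add: add.commute)
  then show ?thesis by (simp add: chi_def ext_dom_1 pullback_def)
next
  case False
  then obtain n where "m = - int (Suc n)" by (metis int_cases not_le of_nat_0_le_iff)
  then show ?thesis
    using dEpow_minus_Suc[of n f] dE_gE by (simp add: chi_def ext_dom_1)
qed

lemma gE_dEpow:
  assumes f: "\<And>x. x \<notin> Y \<Longrightarrow> f x = 0"
  shows "gE (dEpow m f) x = chi (-1) x * dEpow (m - 1) f x"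
proof (cases "m \<le> 0")
  case True
  then have "dEpow (m - 1) f = gE (dEpow m f)"
    using dEpow_minus_Suc[of "nat (- m)" f] by (simp add: add.commute)
  then show ?thesis by (simp add: chi_def ext_dom_minus_1 pullback_def)
next
  case False
  then obtain n where "m = int (Suc n)" by (metis gr0_implies_Suc int_one_le_iff_zero_less not_le zero_less_imp_eq_int)
  then show ?thesis
    using dEpow_Suc[of n f] gE_dE by (simp add: chi_def ext_dom_minus_1)
qed

text \<open>Each step outwards moves the accumulated cut-off along, turning \<open>chi\<close> into
  the next one, and contributes one further cut-off that the next \<open>chi\<close> already
  contains.\<close>

lemma dEpow_dEpow:
  assumes f: "\<And>x. x \<notin> Y \<Longrightarrow> f x = 0"
  shows "dEpow k (dEpow m f) = (\<lambda>x. chi k x * dEpow (k + m) f x)"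
proof (induction k rule: int_cases_induct)
  case 1
  then show ?case using dEpow_vanish[OF f] by (auto simp: chi_0 fun_eq_iff)
next
  case (2 n)
  have "dE (\<lambda>x. chi (int n) x * dEpow (int n + m) f x) =
      (\<lambda>x. dE (chi (int n)) x * dE (dEpow (int n + m) f) x)"
    by (auto simp: pullback_def)
  also have "\<dots> = (\<lambda>x. chi (int (Suc n)) x * dEpow (int (Suc n) + m) f x)"
    by (auto simp: dE_dEpow[OF f] chi_Suc[symmetric] add_ac simp del: of_nat_Suc)
      (auto simp: chi_def ext_dom_1 ext_dom_Suc add_ac fun_eq_iff simp del: of_nat_Suc,
        simp add: add_ac)
  finally show ?case using 2 by (simp add: dEpow_Suc del: of_nat_Suc)
next
  case (3 n)
  have "gE (\<lambda>x. chi (- int n) x * dEpow (- int n + m) f x) =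
      (\<lambda>x. gE (chi (- int n)) x * gE (dEpow (- int n + m) f) x)"
    by (auto simp: pullback_def)
  also have "\<dots> = (\<lambda>x. chi (- int (Suc n)) x * dEpow (- int (Suc n) + m) f x)"
    by (auto simp: gE_dEpow[OF f] chi_minus_Suc[symmetric] simp del: of_nat_Suc)
      (auto simp: chi_def ext_dom_minus_1 ext_dom_minus_Suc fun_eq_iff simp del: of_nat_Suc,
        simp add: algebra_simps)
  finally show ?case using 3 by (simp add: dEpow_minus_Suc del: of_nat_Suc)
qed

lemma ext_delta_eq: "ext_delta X D \<alpha> = dE"
  by (simp add: ext_delta_def ext_dom_1)

lemma inv_ext_delta:
  assumes f: "f \<in> C_on XE D1"
  shows "inv_into (C_on XE D2) dE f = gE f"
proof (rule inv_into_f_eq)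
  show "inj_on dE (C_on XE D2)"
  proof (rule inj_onI, rule ext)
    fix h h' x assume h: "h \<in> C_on XE D2" "h' \<in> C_on XE D2" "dE h = dE h'"
    show "h x = h' x"
    proof (cases "x \<in> D2")
      case True
      then show ?thesis
        using fun_cong[OF h(3), of "shift x"] shift_D2 by (simp add: pullback_def)
    qed (use h C_onD(2) in metis)
  qed
  show "gE f \<in> C_on XE D2"
    by (rule C_on_pullback[OF clopen_preimages(3,4) continuous_map_shift f])
  show "dE (gE f) = f"
    using C_onD(2)[OF f] by (auto simp: dE_gE fun_eq_iff)
qed

text \<open>The negative powers in the definition are made from \<open>inv_into\<close>, whose
  values are controlled only on the range of the automorphism. On the proper domain they agree with
  the total operation \<open>dEpow\<close>, with which all later computations are done.\<close>

lemma ext_delta_power_eq: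
  assumes f: "f \<in> C_on XE (ext_dom X D \<alpha> (- n))"
  shows "ext_delta_power X D \<alpha> n f = dEpow n f"
proof (cases "n \<ge> 0")
  case True
  then show ?thesis by (simp add: ext_delta_power_def dEpow_def ext_delta_eq)
next
  case False
  have "(inv_into (C_on XE D2) dE ^^ m) f = (gE ^^ m) f" if "f \<in> C_on XE (ext_dom X D \<alpha> (int m))" for m f
    using that
  proof (induction m arbitrary: f)
    case (Suc m)
    have f: "f \<in> C_on XE D1"
      using Suc.prems by (rule C_on_mono) (auto simp: ext_dom_Suc simp del: of_nat_Suc)
    have "gE f \<in> C_on XE D2"
      by (rule C_on_pullback[OF clopen_preimages(3,4) continuous_map_shift f])
    moreover have "gE f x = 0" if "x \<notin> ext_dom X D \<alpha> (int m)" for x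
      using C_onD(2)[OF Suc.prems, of "shift x"] shift_D2 that
      by (auto simp: pullback_def ext_dom_Suc simp del: of_nat_Suc)
    ultimately have "gE f \<in> C_on XE (ext_dom X D \<alpha> (int m))" by (simp add: C_on_def)
    then show ?case
      using Suc.IH[of "gE f"] by (simp only: funpow_Suc_right comp_def inv_ext_delta[OF f])
  qed simp
  from this[of f "nat (- n)"] show ?thesis
    using False f by (simp add: ext_delta_power_def dEpow_def ext_delta_eq ext_dom_minus_1)
qed

end

section \<open>Covariant representations\<close>

lemma comp_simps:
  "(S + T) o\<^sub>L V = (S o\<^sub>L V) + (T o\<^sub>L V)" "V o\<^sub>L (S + T) = (V o\<^sub>L S) + (V o\<^sub>L T)"
  "(S - T) o\<^sub>L V = (S o\<^sub>L V) - (T o\<^sub>L V)" "V o\<^sub>L (S - T) = (V o\<^sub>L S) - (V o\<^sub>L T)"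
  "0 o\<^sub>L V = 0" "V o\<^sub>L 0 = 0"
  by (auto intro!: blinfun_eqI simp: blinfun.bilinear_simps)

lemma blinfun_compose_assoc: "(S o\<^sub>L T) o\<^sub>L V = S o\<^sub>L (T o\<^sub>L V)"
  by (rule blinfun_eqI) simp

lemma op_power_0 [simp]: "op_power T 0 = id_blinfun"
  and op_power_Suc: "op_power T (Suc n) = T o\<^sub>L op_power T n"
  by (simp_all add: op_power_def)

lemma id_comp [simp]: "id_blinfun o\<^sub>L T = T" "T o\<^sub>L id_blinfun = T"
  by (auto intro: blinfun_eqI)

lemma op_power_Suc_right: "op_power T (Suc n) = op_power T n o\<^sub>L T"
proof (induction n)
  case (Suc n)
  have "op_power T (Suc (Suc n)) = T o\<^sub>L (op_power T n o\<^sub>L T)"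
    by (simp only: op_power_Suc[of T "Suc n"] Suc)
  then show ?case by (simp add: op_power_Suc blinfun_compose_assoc)
qed (simp add: op_power_Suc)

lemma op_power_bounded_ops [simp, intro]: "T \<in> bounded_ops \<Longrightarrow> op_power T n \<in> bounded_ops"
  by (induction n) (auto simp: op_power_Suc)

lemma adj_op_power: "T \<in> bounded_ops \<Longrightarrow> adj (op_power T n) = op_power (adj T) n"
proof (induction n)
  case (Suc n)
  then have "adj (op_power T (Suc n)) = op_power (adj T) n o\<^sub>L adj T"
    by (simp add: op_power_Suc adj_comp)
  then show ?case by (simp add: op_power_Suc_right)
qed simp

lemma norm_op_power_le_one:
  fixes T :: "'h::complex_hilbert_space \<Rightarrow>\<^sub>L 'h"
  assumes "norm T \<le> 1"
  shows "norm (op_power T n) \<le> 1"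
proof (induction n)
  case 0
  show ?case by (simp, rule norm_blinfun_bound) auto
next
  case (Suc n)
  have "norm (op_power T (Suc n)) \<le> norm T * norm (op_power T n)"
    by (simp add: op_power_Suc norm_blinfun_compose)
  also have "\<dots> \<le> 1 * 1" using assms Suc by (intro mult_mono) auto
  finally show ?case by simp
qed

lemma projection_cinner:
  fixes P :: "'h::complex_hilbert_space \<Rightarrow>\<^sub>L 'h"
  assumes "P \<in> bounded_ops" "adj P = P" "P o\<^sub>L P = P"
  shows "cinner h (P h) = of_real ((norm (P h))\<^sup>2)" and "norm (P h) \<le> norm h"
proof -
  have "cinner h (P h) = cinner h (adj P (P h))"
    using assms by (metis blinfun_apply_blinfun_compose)
  also have "\<dots> = cinner (P h) (P h)" using assms(1) by (rule cinner_adj_right)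
  finally show 1: "cinner h (P h) = of_real ((norm (P h))\<^sup>2)" by (simp add: cinner_self)
  show "norm (P h) \<le> norm h"
  proof (cases "P h = 0")
    case False
    have "(norm (P h))\<^sup>2 \<le> norm h * norm (P h)"
      using Re_cinner_le[of h "P h"] 1 by simp
    then show ?thesis using False by (simp add: power2_eq_square)
  qed simp
qed

text \<open>If \<open>x\<close> exceeded \<open>y\<close>, the powers of the ratio
  \<open>x / y\<close> would outgrow every constant \<open>C\<close>; the exponents
  \<open>2 ^ n\<close> are those produced by repeated squaring.\<close>

lemma le_if_power_le_const_mult:
  fixes x y :: real
  assumes xy: "0 \<le> x" "0 \<le> y" and le: "\<And>n. x ^ (2 ^ n) \<le> C * y ^ (2 ^ n)"
  shows "x \<le> y"
proof (rule ccontr)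
  assume "\<not> x \<le> y"
  then have lt: "y < x" by simp
  show False
  proof (cases "y = 0")
    case True
    then show False using le[of 0] lt by simp
  next
    case False
    define r where "r = x / y"
    have "r > 1" using lt False xy by (simp add: r_def)
    then obtain n where n: "C < r ^ n" using real_arch_pow by blast
    have "r ^ n \<le> r ^ (2 ^ n)"
      using \<open>r > 1\<close> by (intro power_increasing) auto
    also have "\<dots> \<le> C"
      using le[of n] False xy by (simp add: r_def power_divide divide_le_eq)
    finally show False using n by simp
  qed
qed

section \<open>The projections and commutation relations of a covariant representation\<close>

locale covariant_system = partial_system X D \<alpha>
  for X :: "'x topology" and D :: "'x set" and \<alpha> :: "'x \<Rightarrow> 'x" +
  fixes \<pi> :: "('x \<Rightarrow> complex) \<Rightarrow> 'h::complex_hilbert_space \<Rightarrow>\<^sub>L 'h" and U :: "'h \<Rightarrow>\<^sub>L 'h"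
  assumes cov: "cov_rep X D \<alpha> \<pi> U"
begin

lemma \<pi>_bounded [simp, intro]: "a \<in> C_all X \<Longrightarrow> \<pi> a \<in> bounded_ops"
  and \<pi>_add: "a \<in> C_all X \<Longrightarrow> b \<in> C_all X \<Longrightarrow> \<pi> (\<lambda>x. a x + b x) = \<pi> a + \<pi> b"
  and \<pi>_scale: "a \<in> C_all X \<Longrightarrow> \<pi> (\<lambda>x. c * a x) = scale_op c (\<pi> a)"
  and \<pi>_mult: "a \<in> C_all X \<Longrightarrow> b \<in> C_all X \<Longrightarrow> \<pi> (\<lambda>x. a x * b x) = \<pi> a o\<^sub>L \<pi> b"
  and \<pi>_star: "a \<in> C_all X \<Longrightarrow> \<pi> (\<lambda>x. cnj (a x)) = adj (\<pi> a)"
  using cov by (auto simp: cov_rep_def star_hom_def op_algebra_def C_algebra_def)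

abbreviation dX :: "('x \<Rightarrow> complex) \<Rightarrow> 'x \<Rightarrow> complex" where
  "dX \<equiv> pullback D \<alpha>"

definition ind :: "'x set \<Rightarrow> 'x \<Rightarrow> complex" where
  "ind K = (\<lambda>x. if x \<in> K then 1 else 0)"

lemma ind_closed: "openin X K \<Longrightarrow> closedin X K \<Longrightarrow> ind K \<in> C_all X"
  unfolding ind_def by (rule C_on_mono[OF C_on_indicator openin_subset])

lemma ind_mem [simp, intro]: "ind D \<in> C_all X" "ind (\<alpha> ` D) \<in> C_all X" "ind (topspace X) \<in> C_all X"
  using ind_closed open_D closed_D open_image closed_image by auto

lemma ind_mult_same: "(\<lambda>x. ind K x * ind K x) = ind K"
  by (auto simp: ind_def)

lemma ind_mult: "a \<in> C_on X K \<Longrightarrow> (\<lambda>x. ind K x * a x) = a"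
  by (auto simp: ind_def C_on_def)

lemma dX_closed [simp, intro]: "a \<in> C_all X \<Longrightarrow> dX a \<in> C_all X"
  using C_on_pullback[OF open_D closed_D cont_\<alpha>] C_on_mono[OF _ D_subset] by blast

lemma dXn_closed [simp, intro]: "a \<in> C_all X \<Longrightarrow> (dX ^^ n) a \<in> C_all X"
  by (induction n) auto

lemma dX_cnj: "dX (\<lambda>x. cnj (a x)) = (\<lambda>x. cnj (dX a x))"
  by (auto simp: pullback_def)

lemma dXn_cnj: "(dX ^^ n) (\<lambda>x. cnj (a x)) = (\<lambda>x. cnj ((dX ^^ n) a x))"
  by (induction n) (simp_all add: dX_cnj)

lemma dXn_one: "(dX ^^ n) (ind (topspace X)) = ind (power_dom (topspace X) D \<alpha> n)"
  by (induction n) (auto simp: pullback_def ind_def)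

lemma dX_one: "dX (ind (topspace X)) = ind D"
  using \<alpha>_topspace by (auto simp: pullback_def ind_def)

lemma \<pi>_projection:
  assumes "ind K \<in> C_all X"
  shows "adj (\<pi> (ind K)) = \<pi> (ind K)" "\<pi> (ind K) o\<^sub>L \<pi> (ind K) = \<pi> (ind K)"
proof -
  have "(\<lambda>x. cnj (ind K x)) = ind K" by (auto simp: ind_def)
  then show "adj (\<pi> (ind K)) = \<pi> (ind K)"
    using \<pi>_star[OF assms] by simp
  show "\<pi> (ind K) o\<^sub>L \<pi> (ind K) = \<pi> (ind K)"
    using \<pi>_mult[OF assms assms] by (simp add: ind_mult_same)
qed

text \<open>With \<open>c = sqrt (M\<^sup>2 - \<bar>a\<bar>\<^sup>2)\<close> one has \<open>\<pi>(a)*\<pi>(a) + \<pi>(c)*\<pi>(c) = M\<^sup>2 \<pi>(1)\<close>.\<close>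

lemma norm_\<pi>_le:
  assumes a: "a \<in> C_all X"
  shows "norm (\<pi> a) \<le> sup_norm a"
proof (rule norm_blinfun_bound)
  define M where "M = sup_norm a"
  show "0 \<le> sup_norm a" using a by (rule B.sup_norm_nonneg)
  define c where "c x = complex_of_real (sqrt (M\<^sup>2 - (cmod (a x))\<^sup>2)) * ind (topspace X) x" for x
  have c: "c \<in> C_all X"
    using C_onD(1)[OF a] C_onD[OF ind_mem(3)] unfolding c_def
    by (auto simp: C_on_def continuous_map_tendsto_iff intro!: tendsto_intros)
  have le: "(cmod (a x))\<^sup>2 \<le> M\<^sup>2" for x
    using B.norm_le_sup[OF a] by (simp add: M_def power_mono)
  have "cnj (a x) * a x + cnj (c x) * c x = of_real (M\<^sup>2) * ind (topspace X) x" for x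
  proof (cases "x \<in> topspace X")
    case True
    have "cnj (c x) * c x = of_real (M\<^sup>2 - (cmod (a x))\<^sup>2)"
      using True le[of x] by (simp add: c_def ind_def of_real_mult[symmetric] del: of_real_mult)
    moreover have "cnj (a x) * a x = of_real ((cmod (a x))\<^sup>2)"
      by (metis complex_norm_square mult.commute)
    ultimately show ?thesis using True by (simp add: ind_def)
  next
    case False
    then show ?thesis using C_onD(2)[OF a] by (simp add: ind_def c_def)
  qed
  then have "\<pi> (\<lambda>x. cnj (a x) * a x + cnj (c x) * c x) = scale_op (of_real (M\<^sup>2)) (\<pi> (ind (topspace X)))"
    using \<pi>_scale[OF ind_mem(3), of "of_real (M\<^sup>2)"] by simp
  then have sum: "(adj (\<pi> a) o\<^sub>L \<pi> a) + (adj (\<pi> c) o\<^sub>L \<pi> c) = scale_op (of_real (M\<^sup>2)) (\<pi> (ind (topspace X)))"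
    using a c by (simp add: \<pi>_add \<pi>_mult \<pi>_star C_on_intros)
  fix h
  note P = projection_cinner[OF \<pi>_bounded[OF ind_mem(3)] \<pi>_projection[OF ind_mem(3)], of h]
  have "of_real ((norm (\<pi> a h))\<^sup>2) + complex_of_real ((norm (\<pi> c h))\<^sup>2) =
      cinner h (((adj (\<pi> a) o\<^sub>L \<pi> a) + (adj (\<pi> c) o\<^sub>L \<pi> c)) h)"
    using a c by (simp add: blinfun.bilinear_simps cinner_add_right cinner_adj_right cinner_self)
  also have "\<dots> = of_real (M\<^sup>2 * (norm (\<pi> (ind (topspace X)) h))\<^sup>2)"
    unfolding sum using P(1) by (simp add: cinner_scaleC_right)
  finally have "(norm (\<pi> a h))\<^sup>2 + (norm (\<pi> c h))\<^sup>2 = M\<^sup>2 * (norm (\<pi> (ind (topspace X)) h))\<^sup>2"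
    by (metis of_real_add of_real_eq_iff)
  then have "(norm (\<pi> a h))\<^sup>2 \<le> M\<^sup>2 * (norm (\<pi> (ind (topspace X)) h))\<^sup>2"
    by (metis add_increasing2 order_refl zero_le_power2)
  also have "\<dots> \<le> M\<^sup>2 * (norm h)\<^sup>2"
    using P(2) by (intro mult_left_mono power_mono) auto
  finally have "(norm (\<pi> a h))\<^sup>2 \<le> (M * norm h)\<^sup>2" by (simp add: power_mult_distrib)
  then show "norm (\<pi> a h) \<le> sup_norm a * norm h"
    unfolding M_def[symmetric]
    by (rule power2_le_imp_le) (simp add: M_def B.sup_norm_nonneg[OF a])
qed

lemma U_bounded [simp, intro]: "U \<in> bounded_ops"
  using cov by (auto simp: cov_rep_def partial_isometry_def)

lemma UaUs: "a \<in> C_all X \<Longrightarrow> U o\<^sub>L \<pi> a o\<^sub>L adj U = \<pi> (dX a)"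
  using cov by (auto simp: cov_rep_def)

text \<open>The projection \<open>p\<close> maps into the initial space and fixes it pointwise, so
  it is the initial projection of \<open>U\<close>; comparing quadratic forms then identifies it
  with \<open>adj U o\<^sub>L U\<close>.\<close>

lemma U_initial: "U o\<^sub>L \<pi> (ind (\<alpha> ` D)) = U" and UsU: "adj U o\<^sub>L U = \<pi> (ind (\<alpha> ` D))"
proof -
  define p where "p = \<pi> (ind (\<alpha> ` D))"
  have p: "p \<in> bounded_ops" "adj p = p" "p o\<^sub>L p = p"
    using \<pi>_projection[OF ind_mem(2)] by (auto simp: p_def)
  have init: "initial_space U = {\<pi> a h | a h. a \<in> C_on X (\<alpha> ` D)}"
    and iso: "\<And>h. h \<in> initial_space U \<Longrightarrow> norm (U h) = norm h"
    using cov by (auto simp: cov_rep_def partial_isometry_def)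
  have p_init: "p h \<in> initial_space U" for h
    unfolding init p_def using C_on_indicator[OF open_image closed_image] by (auto simp: ind_def)
  have p_fix: "p w = w" if w: "w \<in> initial_space U" for w
  proof -
    obtain a h where "w = \<pi> a h" "a \<in> C_on X (\<alpha> ` D)" using w unfolding init by blast
    moreover have "a \<in> C_all X"
      using \<open>a \<in> C_on X (\<alpha> ` D)\<close> by (rule C_on_mono) (use open_image openin_subset in blast)
    ultimately have "p w = \<pi> (\<lambda>x. ind (\<alpha> ` D) x * a x) h" by (simp add: \<pi>_mult p_def)
    then show ?thesis using \<open>w = \<pi> a h\<close> \<open>a \<in> C_on X (\<alpha> ` D)\<close> by (simp add: ind_mult)
  qed
  have Up: "U (p h) = U h" for h
  proof -
    define v where "v = h - p h"
    \<comment> \<open>\<open>w\<close> lies in the initial space, so \<open>p\<close> fixes it,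
      while \<open>p v = 0\<close>. Hence \<open>w\<close> is orthogonal to \<open>v\<close>, and
      that inner product is the squared norm of \<open>U v\<close>.\<close>
    define w where "w = adj U (U v)"
    have "w \<in> initial_space U"
      unfolding initial_space_def w_def by (simp add: cinner_adj_right)
    then have "cinner v w = cinner v (p w)" using p_fix by simp
    also have "\<dots> = cinner (p v) w" using p cinner_adj_right[of p v w] by simp
    also have "p v = 0"
      using p(3) by (simp add: v_def blinfun.bilinear_simps) (metis blinfun_apply_blinfun_compose)
    finally have "cinner (U v) (U v) = 0" by (simp add: w_def cinner_adj_right)
    then have "U v = 0" by (simp add: cinner_self)
    then show ?thesis by (simp add: v_def blinfun.bilinear_simps)
  qed
  then show "U o\<^sub>L \<pi> (ind (\<alpha> ` D)) = U"
    by (intro blinfun_eqI) (simp add: p_def)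
  have "adj U o\<^sub>L U = p"
  proof (rule cinner_diagonal_eqI)
    fix h
    have "cinner h ((adj U o\<^sub>L U) h) = of_real ((norm (U (p h)))\<^sup>2)"
      by (simp add: cinner_adj_right cinner_self Up)
    also have "\<dots> = cinner h (p h)"
      using iso[OF p_init, of h] projection_cinner(1)[OF p, of h] by simp
    finally show "cinner h ((adj U o\<^sub>L U) h) = cinner h (p h)" .
  qed (use p in auto)
  then show "adj U o\<^sub>L U = \<pi> (ind (\<alpha> ` D))" by (simp add: p_def)
qed

text \<open>Covariance at the unit, which \<open>dX\<close> sends to the indicator of
  \<open>D\<close>. Since \<open>\<pi>\<close> may send the unit to a proper projection, one checks
  that \<open>U\<close> absorbs it by way of the initial projection.\<close>

lemma UUs: "U o\<^sub>L adj U = \<pi> (ind D)"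
proof -
  have "U o\<^sub>L \<pi> (ind (topspace X)) = U o\<^sub>L (\<pi> (ind (\<alpha> ` D)) o\<^sub>L \<pi> (ind (topspace X)))"
    by (simp add: blinfun_compose_assoc[symmetric] U_initial)
  also have "\<dots> = U o\<^sub>L \<pi> (\<lambda>x. ind (\<alpha> ` D) x * ind (topspace X) x)"
    by (simp add: \<pi>_mult)
  also have "(\<lambda>x. ind (\<alpha> ` D) x * ind (topspace X) x) = ind (\<alpha> ` D)"
    using open_image openin_subset by (fastforce simp: ind_def)
  finally have "U o\<^sub>L \<pi> (ind (topspace X)) = U" by (simp add: U_initial)
  then show ?thesis using UaUs[OF ind_mem(3)] by (simp add: dX_one)
qed

lemma Us_initial: "\<pi> (ind (\<alpha> ` D)) o\<^sub>L adj U = adj U"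
  using adj_comp[of U "\<pi> (ind (\<alpha> ` D))"] \<pi>_projection[OF ind_mem(2)] by (simp add: U_initial)

lemma U_final: "\<pi> (ind D) o\<^sub>L U = U"
  by (metis UUs UsU U_initial blinfun_compose_assoc)

lemma Us_final: "adj U o\<^sub>L \<pi> (ind D) = adj U"
  using adj_comp[of "\<pi> (ind D)" U] \<pi>_projection[OF ind_mem(1)] by (simp add: U_final)

lemma norm_U: "norm U \<le> 1"
proof -
  have "(norm U)\<^sup>2 = norm (\<pi> (ind (\<alpha> ` D)))"
    using norm_adj_comp_self[OF U_bounded] by (simp add: UsU)
  also have "\<dots> \<le> sup_norm (ind (\<alpha> ` D))" by (rule norm_\<pi>_le) simp
  also have "\<dots> \<le> 1" by (rule sup_norm_least) (simp add: ind_def)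
  finally show ?thesis by (simp add: abs_square_le_1)
qed

text \<open>Covariance multiplied by \<open>adj U\<close> from the left: the initial projection that
  appears commutes with \<open>\<pi> a\<close> and is absorbed by \<open>adj U\<close>.\<close>

lemma \<pi>_Us:
  assumes a: "a \<in> C_all X"
  shows "\<pi> a o\<^sub>L adj U = adj U o\<^sub>L \<pi> (dX a)"
proof -
  have "adj U o\<^sub>L \<pi> (dX a) = \<pi> (ind (\<alpha> ` D)) o\<^sub>L \<pi> a o\<^sub>L adj U"
    using a by (simp add: UaUs[symmetric] blinfun_compose_assoc[symmetric] UsU)
  also have "\<pi> (ind (\<alpha> ` D)) o\<^sub>L \<pi> a = \<pi> a o\<^sub>L \<pi> (ind (\<alpha> ` D))"
    using a by (simp add: \<pi>_mult[symmetric] mult.commute)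
  finally show ?thesis by (simp add: blinfun_compose_assoc Us_initial)
qed

section \<open>The operators \<open>T k a\<close> and their products\<close>

definition T :: "nat \<Rightarrow> ('x \<Rightarrow> complex) \<Rightarrow> 'h \<Rightarrow>\<^sub>L 'h" where
  "T k a = op_power (adj U) k o\<^sub>L \<pi> a o\<^sub>L op_power U k"

lemma T_0 [simp]: "T 0 a = \<pi> a"
  by (simp add: T_def)

lemma T_Suc: "T (Suc k) a = adj U o\<^sub>L T k a o\<^sub>L U"
  by (simp add: T_def op_power_Suc_right[of U] op_power_Suc[of "adj U"] blinfun_compose_assoc)

lemma T_bounded [simp, intro]: "a \<in> C_all X \<Longrightarrow> T k a \<in> bounded_ops"
  by (auto simp: T_def)

lemma T_add: "a \<in> C_all X \<Longrightarrow> b \<in> C_all X \<Longrightarrow> T k (\<lambda>x. a x + b x) = T k a + T k b"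
  by (simp add: T_def \<pi>_add comp_simps)

lemma T_scale: "a \<in> C_all X \<Longrightarrow> T k (\<lambda>x. c * a x) = scale_op c (T k a)"
  by (simp add: T_def \<pi>_scale scale_op_simps comp_scale_op)

lemma T_zero: "T k (\<lambda>_. 0) = 0"
proof -
  have "T k (\<lambda>_. 0) = scale_op 0 (T k (\<lambda>_. 0))"
    using T_scale[of "\<lambda>_. 0" k 0] by (simp add: C_on_intros)
  also have "\<dots> = 0" by (rule blinfun_eqI) simp
  finally show ?thesis .
qed

lemma T_star: "a \<in> C_all X \<Longrightarrow> adj (T k a) = T k (\<lambda>x. cnj (a x))"
  by (induction k) (simp_all add: \<pi>_star T_Suc adj_comp blinfun_compose_assoc)

lemma norm_T_le:
  assumes a: "a \<in> C_all X"
  shows "norm (T k a) \<le> sup_norm a"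
proof (induction k)
  case 0 show ?case by (simp add: norm_\<pi>_le a)
next
  case (Suc k)
  have "norm (T (Suc k) a) \<le> norm (adj U) * norm (T k a) * norm U"
    unfolding T_Suc by (meson norm_blinfun_compose mult_right_mono norm_ge_zero order_trans)
  also have "\<dots> \<le> 1 * sup_norm a * 1"
    using norm_U Suc by (intro mult_mono) (auto simp: norm_adj B.sup_norm_nonneg a)
  finally show ?case by simp
qed

lemma \<pi>_T:
  "a \<in> C_all X \<Longrightarrow> c \<in> C_all X \<Longrightarrow> \<pi> a o\<^sub>L T d c = T d (\<lambda>x. (dX ^^ d) a x * c x)"
proof (induction d arbitrary: a)
  case (Suc d)
  have "\<pi> a o\<^sub>L T (Suc d) c = adj U o\<^sub>L (\<pi> (dX a) o\<^sub>L T d c) o\<^sub>L U"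
    using \<pi>_Us[OF Suc.prems(1)] by (simp add: T_Suc blinfun_compose_assoc[symmetric])
  also have "\<dots> = T (Suc d) (\<lambda>x. (dX ^^ d) (dX a) x * c x)"
    using Suc by (simp add: T_Suc)
  finally show ?case by (simp add: funpow_swap1)
qed (simp add: \<pi>_mult)

text \<open>In the induction step a factor \<open>U o\<^sub>L adj U = \<pi> (ind D)\<close> stands
  between the two operators. It is moved into the coefficient on the right by
  \<open>\<pi>_T\<close>, passes the contribution of \<open>a\<close> there, is moved out again and
  is absorbed by the outer \<open>adj U\<close>.\<close>

lemma T_mult:
  "a \<in> C_all X \<Longrightarrow> c \<in> C_all X \<Longrightarrow> T k a o\<^sub>L T (k + d) c = T (k + d) (\<lambda>x. (dX ^^ d) a x * c x)"
proof (induction k arbitrary: c)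
  case 0
  then show ?case by (simp add: \<pi>_T)
next
  case (Suc k)
  define f where "f = (\<lambda>x. (dX ^^ d) a x * c x)"
  have f: "f \<in> C_all X" using Suc.prems by (auto simp: f_def intro: C_on_intros)
  have "T (Suc k) a o\<^sub>L T (Suc k + d) c = adj U o\<^sub>L (T k a o\<^sub>L (\<pi> (ind D) o\<^sub>L T (k + d) c)) o\<^sub>L U"
    by (simp add: T_Suc blinfun_compose_assoc UUs[symmetric])
  also have "\<pi> (ind D) o\<^sub>L T (k + d) c = T (k + d) (\<lambda>x. (dX ^^ (k + d)) (ind D) x * c x)"
    using Suc.prems by (simp add: \<pi>_T)
  also have "T k a o\<^sub>L \<dots> = T (k + d) (\<lambda>x. (dX ^^ d) a x * ((dX ^^ (k + d)) (ind D) x * c x))"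
    using Suc.prems by (intro Suc.IH) (auto intro!: C_on_intros)
  also have "(\<lambda>x. (dX ^^ d) a x * ((dX ^^ (k + d)) (ind D) x * c x)) =
      (\<lambda>x. (dX ^^ (k + d)) (ind D) x * f x)"
    by (simp add: f_def mult.left_commute)
  also have "T (k + d) \<dots> = \<pi> (ind D) o\<^sub>L T (k + d) f"
    using f by (simp add: \<pi>_T)
  also have "adj U o\<^sub>L (\<pi> (ind D) o\<^sub>L T (k + d) f) o\<^sub>L U = T (Suc k + d) f"
    by (simp add: T_Suc blinfun_compose_assoc[symmetric] Us_final)
  finally show ?case by (simp add: f_def)
qed

lemma T_mult':
  assumes a: "a \<in> C_all X" and c: "c \<in> C_all X"
  shows "T (k + d) c o\<^sub>L T k a = T (k + d) (\<lambda>x. (dX ^^ d) a x * c x)"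
proof -
  have a': "(\<lambda>x. cnj (a x)) \<in> C_all X" and c': "(\<lambda>x. cnj (c x)) \<in> C_all X"
    using a c by (auto intro: C_on_intros)
  have "T (k + d) c o\<^sub>L T k a = adj (T k (\<lambda>x. cnj (a x)) o\<^sub>L T (k + d) (\<lambda>x. cnj (c x)))"
    using a c a' c' by (simp add: adj_comp T_star)
  also have "T k (\<lambda>x. cnj (a x)) o\<^sub>L T (k + d) (\<lambda>x. cnj (c x)) =
      T (k + d) (\<lambda>x. cnj ((dX ^^ d) a x * c x))"
    using a' c' by (simp add: T_mult dXn_cnj)
  also have "\<dots> = adj (T (k + d) (\<lambda>x. (dX ^^ d) a x * c x))"
    using a c by (intro T_star[symmetric] C_on_intros) auto
  finally show ?thesis
    using a c by (simp add: C_on_intros)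
qed

text \<open>Multiplying by \<open>\<pi>\<close> of the unit does not change \<open>T k a\<close>,
  but multiplies the coefficient by the \<open>k\<close>-fold image of the unit, which is the
  indicator of the \<open>k\<close>-th domain.\<close>

lemma T_restrict:
  assumes a: "a \<in> C_all X"
  shows "T k (\<lambda>x. ind (power_dom (topspace X) D \<alpha> k) x * a x) = T k a"
proof -
  have 1: "\<pi> (ind (topspace X)) o\<^sub>L \<pi> b = \<pi> b" if "b \<in> C_all X" for b
    using that by (simp add: \<pi>_mult[symmetric] ind_mult)
  then have 2: "\<pi> (ind (topspace X)) o\<^sub>L adj U = adj U"
    by (metis Us_initial blinfun_compose_assoc ind_mem(2))
  have "\<pi> (ind (topspace X)) o\<^sub>L T k a = T k a"
    by (cases k) (simp_all add: 1 a T_Suc blinfun_compose_assoc[symmetric] 2)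
  then show ?thesis
    using \<pi>_T[OF ind_mem(3) a, of k] by (simp add: dXn_one)
qed

text \<open>Between two initial projections \<open>\<pi> a\<close> is
  \<open>adj U o\<^sub>L \<pi> (dX a) o\<^sub>L U\<close>, so the part of the coefficient over the
  image of \<open>\<alpha>\<close> can be moved one place up.\<close>

lemma T_split:
  assumes a: "a \<in> C_all X"
  shows "T k (\<lambda>x. ind (topspace X - \<alpha> ` D) x * a x) + T (Suc k) (dX a) = T k a"
proof -
  define b where "b = (\<lambda>x. ind (\<alpha> ` D) x * a x)"
  have b: "b \<in> C_all X" using a by (auto simp: b_def intro: C_on_intros)
  have "ind (topspace X - \<alpha> ` D) \<in> C_all X"
    using closed_image open_image by (intro ind_closed) auto
  then have o: "(\<lambda>x. ind (topspace X - \<alpha> ` D) x * a x) \<in> C_all X"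
    using a by (intro C_on_intros)
  have "b = (\<lambda>x. ind (\<alpha> ` D) x * (a x * ind (\<alpha> ` D) x))"
    by (auto simp: b_def ind_def)
  then have "\<pi> b = adj U o\<^sub>L \<pi> (dX a) o\<^sub>L U"
    using a by (simp add: \<pi>_mult C_on_intros UaUs[symmetric] UsU[symmetric] blinfun_compose_assoc)
  then have "T (Suc k) (dX a) = T k b"
    unfolding T_def[of k] T_def[of "Suc k"]
    by (simp add: op_power_Suc_right[of "adj U"] op_power_Suc[of U] blinfun_compose_assoc)
  then have "T k (\<lambda>x. ind (topspace X - \<alpha> ` D) x * a x) + T (Suc k) (dX a) =
      T k (\<lambda>x. ind (topspace X - \<alpha> ` D) x * a x + b x)"
    using b o by (simp add: T_add)
  also have "(\<lambda>x. ind (topspace X - \<alpha> ` D) x * a x + b x) = a"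
    using C_onD(2)[OF a] open_image openin_subset by (fastforce simp: b_def ind_def)
  finally show ?thesis .
qed

text \<open>The function \<open>[0, \<dots>, 0, a, 0, \<dots>]\<close> with \<open>a\<close> in position \<open>k\<close>; \<open>a\<close> need not vanish off \<open>\<Delta>\<^sub>k\<close>.\<close>

definition ecoord :: "nat \<Rightarrow> ('x \<Rightarrow> complex) \<Rightarrow> (nat \<Rightarrow> 'x option) \<Rightarrow> complex" where
  "ecoord k a x = (if x \<in> Y then case_option 0 a (x k) else 0)"

lemma ecoord_closed [simp, intro]:
  assumes "a \<in> C_all X"
  shows "ecoord k a \<in> C_all XE"
proof -
  have "continuous_map XE euclidean (\<lambda>x. case_option 0 a (x k))"
    using continuous_map_compose[OF continuous_map_coordinate continuous_map_case_option[OF C_onD(1)[OF assms]]]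
    by (simp add: comp_def)
  then have "continuous_map XE euclidean (ecoord k a)"
    by (rule continuous_map_eq) (simp add: ecoord_def)
  then show ?thesis by (simp add: C_on_def ecoord_def)
qed

lemma ecoord_add: "ecoord k (\<lambda>x. a x + b x) = (\<lambda>x. ecoord k a x + ecoord k b x)"
  and ecoord_scale: "ecoord k (\<lambda>x. c * a x) = (\<lambda>x. c * ecoord k a x)"
  and ecoord_cnj: "ecoord k (\<lambda>x. cnj (a x)) = (\<lambda>x. cnj (ecoord k a x))"
  and ecoord_zero: "ecoord k (\<lambda>_. 0) = (\<lambda>_. 0)"
  by (auto simp: ecoord_def fun_eq_iff split: option.split)

lemma admissible_dXn:
  assumes "admissible x"
  shows "x (k + d) = Some z \<Longrightarrow> \<exists>w. x k = Some w \<and> (dX ^^ d) a z = a w"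
proof (induction d arbitrary: z)
  case (Suc d)
  then have "z \<in> D" "x (k + d) = Some (\<alpha> z)"
    using admissible_Suc_Some[OF assms, of "k + d"] by auto
  then show ?case using Suc.IH by (auto simp: pullback_def)
qed simp

text \<open>The counterpart of \<open>T_mult\<close>: coordinate \<open>k\<close> is the
  \<open>d\<close>-fold image under \<open>\<alpha>\<close> of coordinate \<open>k + d\<close>, and
  both sides vanish where the latter is \<open>None\<close>.\<close>

lemma ecoord_mult:
  "(\<lambda>x. ecoord k a x * ecoord (k + d) c x) = ecoord (k + d) (\<lambda>x. (dX ^^ d) a x * c x)"
proof
  fix x
  show "ecoord k a x * ecoord (k + d) c x = ecoord (k + d) (\<lambda>x. (dX ^^ d) a x * c x) x"
  proof (cases "x \<in> Y \<and> x (k + d) \<noteq> None")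
    case True
    then obtain z where "x (k + d) = Some z" by auto
    then show ?thesis
      using True admissible_dXn[of x k d z a] by (auto simp: ecoord_def Y_iff)
  qed (auto simp: ecoord_def)
qed

lemma ecoord_restrict:
  "ecoord k (\<lambda>x. ind (power_dom (topspace X) D \<alpha> k) x * a x) = ecoord k a"
  using admissible_power_dom by (fastforce simp: ecoord_def Y_iff ind_def split: option.split)

text \<open>The counterpart of \<open>T_split\<close>: at each point at most one summand survives,
  depending on whether \<open>x (Suc k)\<close> is \<open>None\<close>.\<close>

lemma ecoord_split:
  "(\<lambda>x. ecoord k (\<lambda>x. ind (topspace X - \<alpha> ` D) x * a x) x + ecoord (Suc k) (dX a) x) = ecoord k a"
proof
  fix x
  show "ecoord k (\<lambda>x. ind (topspace X - \<alpha> ` D) x * a x) x + ecoord (Suc k) (dX a) x = ecoord k a x"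
  proof (cases "x \<in> Y")
    case True
    then have x: "admissible x" by (simp add: Y_iff)
    show ?thesis
    proof (cases "x (Suc k)")
      case None
      have "z \<in> topspace X - \<alpha> ` D" if "x k = Some z" for z
        using admissible_Suc_None[OF x None] admissible_power_dom[OF x that] power_dom_subset that
        by auto
      then show ?thesis using True None by (auto simp: ecoord_def ind_def split: option.split)
    next
      case (Some z)
      then show ?thesis
        using True admissible_Suc_Some[OF x Some] by (simp add: ecoord_def ind_def pullback_def)
    qed
  qed (simp add: ecoord_def)
qed

lemma dE_ecoord_0: "dE (ecoord 0 a) = ecoord 0 (dX a)"
proof
  fix x
  show "dE (ecoord 0 a) x = ecoord 0 (dX a) x"
    using ext_proj_Y[of x] ext_map_D1[of x] D2_Y[of "ext_map \<alpha> x"]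
    by (auto simp: pullback_def ecoord_def ext_preimage_def) (auto simp: ext_map_def)
qed

lemma dE_ecoord_Suc: "dE (ecoord (Suc k) a) = (\<lambda>x. ecoord 0 (ind D) x * ecoord k a x)"
proof
  fix x
  show "dE (ecoord (Suc k) a) x = ecoord 0 (ind D) x * ecoord k a x"
    using ext_proj_Y[of x] ext_map_D1[of x] D2_Y[of "ext_map \<alpha> x"]
    by (auto simp: pullback_def ecoord_def ext_preimage_def ind_def) (auto simp: ext_map_def)
qed

lemma admissible_None_mono: "admissible x \<Longrightarrow> x n = None \<Longrightarrow> n \<le> m \<Longrightarrow> x m = None"
proof (induction m)
  case (Suc m)
  then show ?case
    using admissible_Suc_Some[OF Suc.prems(1), of m] by (cases "x (Suc m)") (auto simp: le_Suc_eq)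
qed simp

lemma gE_ecoord: "gE (ecoord k a) = ecoord (Suc k) a"
proof
  fix x
  show "gE (ecoord k a) x = ecoord (Suc k) a x"
  proof (cases "x \<in> D2")
    case True
    then show ?thesis using shift_D2[OF True] D1_Y D2_Y by (auto simp: pullback_def ecoord_def)
  next
    case False
    have "x (Suc k) = None" if "x \<in> Y"
    proof -
      have x: "admissible x" using that by (simp add: Y_iff)
      have "x 0 \<notin> Some ` \<alpha> ` D"
        using False that ext_proj_Y[OF that] by (auto simp: ext_preimage_def)
      then have "x (Suc 0) = None"
        using admissible_Suc_Some[OF x, of 0] by (cases "x (Suc 0)") auto
      then show ?thesis using admissible_None_mono[OF x, of "Suc 0" "Suc k"] by simp
    qed
    then show ?thesis using False by (auto simp: pullback_def ecoord_def)
  qed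
qed

text \<open>The graph of the representation of the *-algebra of functions \<open>[a\<^sub>0, \<dots>, a\<^sub>N]\<close>. Working with
  pairs avoids having to show beforehand that the operator depends on the function only.\<close>

inductive_set R :: "nat \<Rightarrow> (((nat \<Rightarrow> 'x option) \<Rightarrow> complex) \<times> ('h \<Rightarrow>\<^sub>L 'h)) set" for N :: nat where
  gen: "k \<le> N \<Longrightarrow> a \<in> C_all X \<Longrightarrow> (ecoord k a, T k a) \<in> R N"
| plus: "(b, S) \<in> R N \<Longrightarrow> (c, V) \<in> R N \<Longrightarrow> (\<lambda>x. b x + c x, S + V) \<in> R N"

lemma R_closed: "(b, S) \<in> R N \<Longrightarrow> b \<in> C_all XE \<and> S \<in> bounded_ops"
  by (induction rule: R.induct) (auto intro: C_on_intros)

lemma R_mono: "(b, S) \<in> R N \<Longrightarrow> N \<le> M \<Longrightarrow> (b, S) \<in> R M"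
  by (induction rule: R.induct) (auto intro: R.intros)

lemma R_scale: "(b, S) \<in> R N \<Longrightarrow> (\<lambda>x. c * b x, scale_op c S) \<in> R N"
proof (induction rule: R.induct)
  case (gen k a)
  then show ?case
    using R.gen[of k N "\<lambda>x. c * a x"] by (simp add: C_on_intros ecoord_scale T_scale)
next
  case (plus b S d V)
  then show ?case using R.plus[OF plus.IH] by (simp add: distrib_left scale_op_simps)
qed

lemma R_star: "(b, S) \<in> R N \<Longrightarrow> (\<lambda>x. cnj (b x), adj S) \<in> R N"
proof (induction rule: R.induct)
  case (gen k a)
  then show ?case
    using R.gen[of k N "\<lambda>x. cnj (a x)"] by (simp add: C_on_intros ecoord_cnj T_star)
next
  case (plus b S d V)
  then show ?case using R.plus[OF plus.IH] R_closed by (simp add: adj_add)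
qed

text \<open>The product of generators at \<open>k\<close> and \<open>m\<close> is a generator at the
  larger position, so the bound \<open>N\<close> is preserved.\<close>

lemma R_mult: "(b, S) \<in> R N \<Longrightarrow> (c, V) \<in> R N \<Longrightarrow> (\<lambda>x. b x * c x, S o\<^sub>L V) \<in> R N"
proof (induction rule: R.induct)
  case (gen k a)
  note ka = gen
  show ?case
    using gen(3)
  proof (induction rule: R.induct)
    case (gen m d)
    show ?case
    proof (cases "k \<le> m")
      case True
      then obtain j where m: "m = k + j" using le_Suc_ex by blast
      show ?thesis
        unfolding m ecoord_mult using ka gen m
        by (subst T_mult) (auto intro!: R.gen C_on_intros)
    next
      case False
      then obtain j where k: "k = m + j" by (metis le_Suc_ex nle_le)
      show ?thesis
        unfolding k using ka gen k
        by (subst mult.commute, subst ecoord_mult, subst T_mult') (auto intro!: R.gen C_on_intros)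
    qed
  next
    case (plus d S e V)
    then show ?case using R.plus[OF plus.IH] by (simp add: distrib_left comp_simps)
  qed
next
  case (plus b S d V)
  then show ?case using R.plus[OF plus.IH] by (simp add: distrib_right comp_simps)
qed

lemma R_dE: "(b, S) \<in> R N \<Longrightarrow> (dE b, U o\<^sub>L S o\<^sub>L adj U) \<in> R N"
proof (induction rule: R.induct)
  case (gen k a)
  show ?case
  proof (cases k)
    case 0
    then show ?thesis using gen R.gen[of 0 N "dX a"] by (simp add: dE_ecoord_0 UaUs)
  next
    case (Suc j)
    have "U o\<^sub>L T k a o\<^sub>L adj U = T 0 (ind D) o\<^sub>L (T j a o\<^sub>L T 0 (ind D))"
      using Suc by (simp add: T_Suc blinfun_compose_assoc UUs[symmetric])
    also have "T j a o\<^sub>L T 0 (ind D) = T 0 (ind D) o\<^sub>L T j a"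
      using gen T_mult'[of "ind D" a 0 j] T_mult[of "ind D" a 0 j] by simp
    also have "T 0 (ind D) o\<^sub>L \<dots> = T 0 (ind D) o\<^sub>L T j a"
      using \<pi>_projection[OF ind_mem(1)] by (simp add: blinfun_compose_assoc[symmetric])
    finally show ?thesis
      using Suc gen R_mult[OF R.gen[of 0 N "ind D"] R.gen[of j N a]] by (simp add: dE_ecoord_Suc)
  qed
next
  case (plus b S d V)
  have "dE (\<lambda>x. b x + d x) = (\<lambda>x. dE b x + dE d x)" by (auto simp: pullback_def)
  then show ?case using R.plus[OF plus.IH] by (simp add: comp_simps)
qed

lemma R_gE: "(b, S) \<in> R N \<Longrightarrow> (gE b, adj U o\<^sub>L S o\<^sub>L U) \<in> R (Suc N)"
proof (induction rule: R.induct)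
  case (gen k a)
  then show ?case using R.gen[of "Suc k" "Suc N" a] by (simp add: gE_ecoord T_Suc)
next
  case (plus b S d V)
  have "gE (\<lambda>x. b x + d x) = (\<lambda>x. gE b x + gE d x)" by (auto simp: pullback_def)
  then show ?case using R.plus[OF plus.IH] by (simp add: comp_simps)
qed

section \<open>Normal form of the coefficients and the norm bound\<close>

definition normal :: "nat \<Rightarrow> (nat \<Rightarrow> 'x \<Rightarrow> complex) \<Rightarrow> bool" where
  "normal N a \<longleftrightarrow> (\<forall>k\<le>N. a k \<in> C_on X (power_dom (topspace X) D \<alpha> k)) \<and>
    (\<forall>k<N. \<forall>z\<in>\<alpha> ` D. a k z = 0)"

lemma normal_C_all: "normal N a \<Longrightarrow> k \<le> N \<Longrightarrow> a k \<in> C_all X"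
  unfolding normal_def using C_on_mono[OF _ power_dom_subset] by blast

text \<open>Only the last coefficient of a normal sequence may be nonzero over the image of
  \<open>\<alpha>\<close>. That part is moved to the new last place, by \<open>ecoord_split\<close>
  for the function and \<open>T_split\<close> for the operator.\<close>

lemma normal_lift:
  assumes a: "normal N a"
  shows "\<exists>a'. normal (Suc N) a' \<and>
    (\<lambda>x. \<Sum>k\<le>Suc N. ecoord k (a' k) x) = (\<lambda>x. \<Sum>k\<le>N. ecoord k (a k) x) \<and>
    (\<Sum>k\<le>Suc N. T k (a' k)) = (\<Sum>k\<le>N. T k (a k))"
proof -
  define f where "f = (\<lambda>x. ind (topspace X - \<alpha> ` D) x * a N x)"
  define a' where "a' = a(N := f, Suc N := dX (a N))"
  have aN: "a N \<in> C_all X" using normal_C_all[OF a] by simp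
  have "ind (topspace X - \<alpha> ` D) \<in> C_all X"
    using closed_image open_image by (intro ind_closed) auto
  then have "f \<in> C_on X (power_dom (topspace X) D \<alpha> N)"
    using a by (auto simp: f_def normal_def intro: C_on_intros)
  moreover have "dX (a N) \<in> C_on X (power_dom (topspace X) D \<alpha> (Suc N))"
  proof -
    have "dX (a N) x = 0" if "x \<notin> power_dom (topspace X) D \<alpha> (Suc N)" for x
      using that a by (auto simp: pullback_def normal_def C_on_def)
    then show ?thesis using C_onD(1)[OF dX_closed[OF aN]] by (auto simp: C_on_def)
  qed
  moreover have "f z = 0" if "z \<in> \<alpha> ` D" for z using that by (simp add: f_def ind_def)
  ultimately have "normal (Suc N) a'"
    using a by (auto simp: normal_def a'_def le_Suc_eq less_Suc_eq)
  moreover have "(\<Sum>k\<le>Suc N. ecoord k (a' k) x) = (\<Sum>k\<le>N. ecoord k (a k) x)" for x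
  proof -
    have "(\<Sum>k\<le>Suc N. ecoord k (a' k) x) =
        (\<Sum>k<N. ecoord k (a k) x) + (ecoord N f x + ecoord (Suc N) (dX (a N)) x)"
      by (simp add: a'_def lessThan_Suc_atMost[symmetric])
    then show ?thesis
      using fun_cong[OF ecoord_split[of N "a N"], of x]
      by (simp add: f_def lessThan_Suc_atMost[symmetric])
  qed
  moreover have "(\<Sum>k\<le>Suc N. T k (a' k)) = (\<Sum>k\<le>N. T k (a k))"
  proof -
    have "(\<Sum>k\<le>Suc N. T k (a' k)) = (\<Sum>k<N. T k (a k)) + (T N f + T (Suc N) (dX (a N)))"
      by (simp add: a'_def lessThan_Suc_atMost[symmetric] add.assoc)
    then show ?thesis
      using T_split[OF aN, of N] by (simp add: f_def lessThan_Suc_atMost[symmetric])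
  qed
  ultimately show ?thesis by (intro exI[of _ a']) auto
qed

lemma normal_gen:
  "k \<le> N \<Longrightarrow> a \<in> C_all X \<Longrightarrow> \<exists>a'. normal N a' \<and>
    ecoord k a = (\<lambda>x. \<Sum>k\<le>N. ecoord k (a' k) x) \<and> T k a = (\<Sum>k\<le>N. T k (a' k))"
proof (induction N)
  case 0
  then show ?case by (intro exI[of _ "\<lambda>_. a"]) (auto simp: normal_def)
next
  case (Suc N)
  show ?case
  proof (cases "k \<le> N")
    case True
    then obtain a' where a': "normal N a'" "ecoord k a = (\<lambda>x. \<Sum>k\<le>N. ecoord k (a' k) x)"
      "T k a = (\<Sum>k\<le>N. T k (a' k))"
      using Suc by blast
    from normal_lift[OF a'(1)] obtain a'' where "normal (Suc N) a''"
      "(\<lambda>x. \<Sum>k\<le>Suc N. ecoord k (a'' k) x) = (\<lambda>x. \<Sum>k\<le>N. ecoord k (a' k) x)"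
      "(\<Sum>k\<le>Suc N. T k (a'' k)) = (\<Sum>k\<le>N. T k (a' k))"
      by blast
    then show ?thesis using a'(2,3) by (intro exI[of _ a'']) (simp only: simp_thms)
  next
    case False
    then have k: "k = Suc N" using Suc by simp
    define f where "f = (\<lambda>x. ind (power_dom (topspace X) D \<alpha> k) x * a x)"
    have "f \<in> C_all X"
      using Suc dXn_closed[OF ind_mem(3), of k] by (auto simp: f_def dXn_one intro: C_on_intros)
    then have "f \<in> C_on X (power_dom (topspace X) D \<alpha> k)"
      by (auto simp: C_on_def f_def ind_def)
    then have "normal (Suc N) ((\<lambda>_ _. 0)(Suc N := f))"
      using k by (auto simp: normal_def intro: C_on_intros)
    moreover have "ecoord k a = ecoord k f" "T k a = T k f"
      using ecoord_restrict T_restrict Suc.prems by (auto simp: f_def)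
    moreover have "(\<lambda>x. \<Sum>j\<le>Suc N. ecoord j (((\<lambda>_ _. 0)(Suc N := f)) j) x) = ecoord k f"
      "(\<Sum>j\<le>Suc N. T j (((\<lambda>_ _. 0)(Suc N := f)) j)) = T k f"
      using k by (simp_all add: ecoord_zero T_zero)
    ultimately show ?thesis
      by (intro exI[of _ "(\<lambda>_ _. 0)(Suc N := f)"]) (simp only: simp_thms)
  qed
qed

lemma normal_form:
  "(b, S) \<in> R N \<Longrightarrow> \<exists>a. normal N a \<and> b = (\<lambda>x. \<Sum>k\<le>N. ecoord k (a k) x) \<and> S = (\<Sum>k\<le>N. T k (a k))"
proof (induction rule: R.induct)
  case (gen k a)
  then show ?case using normal_gen by blast
next
  case (plus b S c V)
  then obtain a1 a2 where a: "normal N a1" "normal N a2"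
    and eq: "b = (\<lambda>x. \<Sum>k\<le>N. ecoord k (a1 k) x)" "S = (\<Sum>k\<le>N. T k (a1 k))"
      "c = (\<lambda>x. \<Sum>k\<le>N. ecoord k (a2 k) x)" "V = (\<Sum>k\<le>N. T k (a2 k))"
    by blast
  have "normal N (\<lambda>k x. a1 k x + a2 k x)"
    using a by (auto simp: normal_def intro: C_on_intros)
  then show ?case
    using normal_C_all[OF a(1)] normal_C_all[OF a(2)]
    by (intro exI[of _ "\<lambda>k x. a1 k x + a2 k x"]) (simp add: eq ecoord_add T_add sum.distrib)
qed

lemma forward_point:
  "u \<in> Y \<Longrightarrow> u 0 = Some z \<Longrightarrow> z \<in> power_dom (topspace X) D \<alpha> k \<Longrightarrow> \<exists>x\<in>Y. \<forall>n. x (n + k) = u n"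
proof (induction k arbitrary: u z)
  case (Suc k)
  have "u \<in> D1" using Suc.prems by (auto simp: ext_preimage_def ext_proj_def)
  then have "ext_map \<alpha> u \<in> Y" using ext_map_D1 D2_Y by blast
  moreover have "ext_map \<alpha> u 0 = Some (\<alpha> z)" using Suc.prems by (simp add: ext_map_def ext_proj_def)
  ultimately obtain x where x: "x \<in> Y" "\<And>n. x (n + k) = ext_map \<alpha> u n"
    using Suc.IH[of "ext_map \<alpha> u" "\<alpha> z"] Suc.prems by auto
  have "x (n + Suc k) = u n" for n
    using x(2)[of "Suc n"] by (simp add: ext_map_def)
  then show ?case using x(1) by blast
qed auto

text \<open>Below position \<open>k\<close> the point consists of the forward orbit of
  \<open>z\<close>. Beyond it preimages are chosen by \<open>inv_into\<close> as long as there are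
  any, and \<open>None\<close> follows.\<close>

lemma exists_point:
  assumes z: "z \<in> power_dom (topspace X) D \<alpha> k"
  shows "\<exists>x\<in>Y. x k = Some z \<and> (z \<notin> \<alpha> ` D \<longrightarrow> x (Suc k) = None)"
proof -
  define step where "step v = (case v of None \<Rightarrow> None | Some w \<Rightarrow>
    if w \<in> \<alpha> ` D then Some (inv_into D \<alpha> w) else None)" for v
  define u where "u = rec_nat (Some z) (\<lambda>_. step)"
  have u: "u 0 = Some z" "u (Suc n) = step (u n)" for n by (simp_all add: u_def)
  have "admissible u"
  proof (rule admissibleI)
    show "z \<in> topspace X" using z power_dom_subset by blast
    show "u n \<notin> Some ` \<alpha> ` D" if "u (Suc n) = None" for n
      using that by (auto simp: u(2) step_def)
    show "w \<in> D \<and> u n = Some (\<alpha> w)" if "u (Suc n) = Some w" for n w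
      using that unfolding u(2) step_def
      by (cases "u n") (auto simp: inv_into_into f_inv_into_f split: if_splits)
  qed (rule u)
  then obtain x where "x \<in> Y" and x: "\<And>n. x (n + k) = u n"
    using forward_point[of u z k] u(1) z Y_iff by blast
  then show ?thesis
    using x[of 0] x[of 1] u(2)[of 0] by (intro bexI[of _ x]) (auto simp: u(1) step_def)
qed

text \<open>At a suitable point \<open>x\<close> with \<open>x k = Some z\<close> all other summands
  vanish. Earlier coordinates lie in the image of \<open>\<alpha>\<close>, where the earlier
  coefficients are zero; for \<open>k < N\<close> the later ones are \<open>None\<close> because
  \<open>z\<close> has no preimage.\<close>

lemma normal_le:
  assumes a: "normal N a" and b: "b = (\<lambda>x. \<Sum>k\<le>N. ecoord k (a k) x)" and k: "k \<le> N"
  shows "cmod (a k z) \<le> sup_norm b"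
proof -
  have bC: "b \<in> C_all XE"
  proof -
    have "(\<lambda>x. \<Sum>k\<in>I. ecoord k (a k) x) \<in> C_all XE" if "finite I" "I \<subseteq> {..N}" for I
      using that
      by (induction I) (use normal_C_all[OF a] in \<open>auto intro!: C_on_intros\<close>)
    then show ?thesis by (simp add: b)
  qed
  show ?thesis
  proof (cases "z \<in> power_dom (topspace X) D \<alpha> k \<and> (k < N \<longrightarrow> z \<notin> \<alpha> ` D)")
    case False
    then have "a k z = 0" using a k by (auto simp: normal_def C_on_def)
    then show ?thesis using E.sup_norm_nonneg[OF bC] by simp
  next
    case True
    then obtain x where x: "x \<in> Y" "x k = Some z" "z \<notin> \<alpha> ` D \<Longrightarrow> x (Suc k) = None"
      using exists_point by blast
    have adm: "admissible x" using x Y_iff by simp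
    have "ecoord j (a j) x = 0" if j: "j \<le> N" "j \<noteq> k" for j
    proof (cases "j < k")
      case True
      then have "x (Suc j) \<noteq> None"
        using admissible_None_mono[OF adm, of "Suc j" k] x(2) by auto
      then obtain w where "w \<in> D" "x j = Some (\<alpha> w)"
        using admissible_Suc_Some[OF adm] by blast
      then show ?thesis using a True k by (auto simp: ecoord_def normal_def)
    next
      case False
      then have "x j = None"
        using admissible_None_mono[OF adm, of "Suc k" j] x(3) True j k by auto
      then show ?thesis by (simp add: ecoord_def)
    qed
    then have "b x = (\<Sum>j\<in>{k}. ecoord j (a j) x)"
      unfolding b using k by (intro sum.mono_neutral_right) auto
    then have "b x = a k z" using x by (simp add: ecoord_def)
    then show ?thesis using E.norm_le_sup[OF bC, of x] by simp
  qed
qed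

lemma norm_R_crude:
  assumes "(b, S) \<in> R N"
  shows "norm S \<le> real (Suc N) * sup_norm b"
proof -
  obtain a where a: "normal N a" and b: "b = (\<lambda>x. \<Sum>k\<le>N. ecoord k (a k) x)"
    and S: "S = (\<Sum>k\<le>N. T k (a k))"
    using normal_form[OF assms] by blast
  have "norm (T k (a k)) \<le> sup_norm b" if "k \<le> N" for k
    using norm_T_le[OF normal_C_all[OF a that], of k]
      sup_norm_least[of "a k" "sup_norm b", OF normal_le[OF a b that]] by linarith
  then have "norm S \<le> (\<Sum>k\<le>N. sup_norm b)"
    unfolding S by (intro sum_norm_le) auto
  then show ?thesis by simp
qed

lemma norm_R_le:
  assumes bS: "(b, S) \<in> R N"
  shows "norm S \<le> sup_norm b"
proof -
  have b: "b \<in> C_all XE" "S \<in> bounded_ops" using R_closed[OF bS] by auto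
  \<comment> \<open>Repeated squaring of \<open>adj S o\<^sub>L S\<close>, which remains
    selfadjoint: the operator norm is squared exactly by the C*-identity, the supremum norm at most,
    and the pair does not leave \<open>R N\<close>.\<close>
  have iter: "\<exists>f V. (f, V) \<in> R N \<and> adj V = V \<and> norm V = ((norm S)\<^sup>2) ^ (2 ^ n) \<and>
      sup_norm f \<le> ((sup_norm b)\<^sup>2) ^ (2 ^ n)" for n
  proof (induction n)
    case 0
    have "sup_norm (\<lambda>x. cnj (b x) * b x) \<le> (sup_norm b)\<^sup>2"
      using E.sup_norm_mult[of "\<lambda>x. cnj (b x)" b] b by (simp add: C_on_intros power2_eq_square)
    then show ?case
      using R_mult[OF R_star[OF bS] bS] b
      by (intro exI[of _ "\<lambda>x. cnj (b x) * b x"] exI[of _ "adj S o\<^sub>L S"])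
        (simp add: adj_comp norm_adj_comp_self)
  next
    case (Suc n)
    then obtain f V where f: "(f, V) \<in> R N" "adj V = V" "norm V = ((norm S)\<^sup>2) ^ (2 ^ n)"
      "sup_norm f \<le> ((sup_norm b)\<^sup>2) ^ (2 ^ n)" by blast
    have fC: "f \<in> C_all XE" "V \<in> bounded_ops" using R_closed[OF f(1)] by auto
    have "sup_norm (\<lambda>x. f x * f x) \<le> sup_norm f * sup_norm f"
      by (rule E.sup_norm_mult[OF fC(1) fC(1)])
    also have "\<dots> \<le> ((sup_norm b)\<^sup>2) ^ (2 ^ n) * ((sup_norm b)\<^sup>2) ^ (2 ^ n)"
      using f(4) E.sup_norm_nonneg[OF fC(1)] by (intro mult_mono) auto
    also have "\<dots> = ((sup_norm b)\<^sup>2) ^ (2 ^ Suc n)"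
      by (simp add: power_add[symmetric] mult_2)
    finally have "sup_norm (\<lambda>x. f x * f x) \<le> ((sup_norm b)\<^sup>2) ^ (2 ^ Suc n)" .
    moreover have "norm (V o\<^sub>L V) = ((norm S)\<^sup>2) ^ (2 ^ Suc n)"
    proof -
      have "norm (V o\<^sub>L V) = (norm V)\<^sup>2" using norm_adj_comp_self[OF fC(2)] f(2) by simp
      then show ?thesis by (simp add: f(3) power_mult[symmetric] mult.commute)
    qed
    moreover have "adj (V o\<^sub>L V) = V o\<^sub>L V" using fC f by (simp add: adj_comp)
    ultimately show ?case using R_mult[OF f(1) f(1)] by blast
  qed
  have "((norm S)\<^sup>2) ^ (2 ^ n) \<le> real (Suc N) * ((sup_norm b)\<^sup>2) ^ (2 ^ n)" for n
  proof -
    obtain f V where f: "(f, V) \<in> R N" "norm V = ((norm S)\<^sup>2) ^ (2 ^ n)"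
      "sup_norm f \<le> ((sup_norm b)\<^sup>2) ^ (2 ^ n)"
      using iter[of n] by blast
    have "norm V \<le> real (Suc N) * sup_norm f" by (rule norm_R_crude[OF f(1)])
    also have "\<dots> \<le> real (Suc N) * ((sup_norm b)\<^sup>2) ^ (2 ^ n)"
      using f(3) by (intro mult_left_mono) auto
    finally show ?thesis by (simp only: f(2))
  qed
  then have "(norm S)\<^sup>2 \<le> (sup_norm b)\<^sup>2"
    by (rule le_if_power_le_const_mult[rotated 2]) (rule zero_le_power2)+
  then show ?thesis
    by (rule power2_le_imp_le) (simp add: E.sup_norm_nonneg b)
qed

section \<open>Extension to all continuous functions on the extension\<close>

definition RU :: "(((nat \<Rightarrow> 'x option) \<Rightarrow> complex) \<times> ('h \<Rightarrow>\<^sub>L 'h)) set" where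
  "RU = (\<Union>N. R N)"

lemma RU_closed: "(b, S) \<in> RU \<Longrightarrow> b \<in> C_all XE" "(b, S) \<in> RU \<Longrightarrow> S \<in> bounded_ops"
  using R_closed by (auto simp: RU_def)

lemma RU_gen: "a \<in> C_all X \<Longrightarrow> (ecoord k a, T k a) \<in> RU"
  using R.gen[of k k] by (auto simp: RU_def)

lemma RUI: "(b, S) \<in> R N \<Longrightarrow> (b, S) \<in> RU"
  by (auto simp: RU_def)

lemma RU_common:
  assumes "(b, S) \<in> RU" "(c, V) \<in> RU"
  obtains N where "(b, S) \<in> R N" "(c, V) \<in> R N"
proof -
  obtain N M where "(b, S) \<in> R N" "(c, V) \<in> R M" using assms by (auto simp: RU_def)
  then show ?thesis using that[of "max N M"] R_mono by (meson max.cobounded1 max.cobounded2)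
qed

lemma RU_plus:
  assumes "(b, S) \<in> RU" "(c, V) \<in> RU"
  shows "(\<lambda>x. b x + c x, S + V) \<in> RU"
proof -
  obtain N where "(b, S) \<in> R N" "(c, V) \<in> R N" by (rule RU_common[OF assms])
  then show ?thesis by (rule RUI[OF R.plus])
qed

lemma RU_mult:
  assumes "(b, S) \<in> RU" "(c, V) \<in> RU"
  shows "(\<lambda>x. b x * c x, S o\<^sub>L V) \<in> RU"
proof -
  obtain N where "(b, S) \<in> R N" "(c, V) \<in> R N" by (rule RU_common[OF assms])
  then show ?thesis by (rule RUI[OF R_mult])
qed

lemma RU_scale: "(b, S) \<in> RU \<Longrightarrow> (\<lambda>x. c * b x, scale_op c S) \<in> RU"
  and RU_star: "(b, S) \<in> RU \<Longrightarrow> (\<lambda>x. cnj (b x), adj S) \<in> RU"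
  and RU_dE: "(b, S) \<in> RU \<Longrightarrow> (dE b, U o\<^sub>L S o\<^sub>L adj U) \<in> RU"
  and RU_gE: "(b, S) \<in> RU \<Longrightarrow> (gE b, adj U o\<^sub>L S o\<^sub>L U) \<in> RU"
  unfolding RU_def UN_iff by (blast intro: R_scale, blast intro: R_star, blast intro: R_dE, blast intro: R_gE)

lemma RU_diff: "(b, S) \<in> RU \<Longrightarrow> (c, V) \<in> RU \<Longrightarrow> (\<lambda>x. b x - c x, S - V) \<in> RU"
  using RU_plus[of b S "\<lambda>x. (-1) * c x" "scale_op (-1) V"] RU_scale[of c V "-1"]
  by (simp add: scale_op_simps)

lemma norm_RU_le: "(b, S) \<in> RU \<Longrightarrow> norm S \<le> sup_norm b"
  using norm_R_le by (auto simp: RU_def)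

lemma separate_points:
  assumes "z \<in> topspace X" "w \<in> topspace X" "z \<noteq> w"
  shows "\<exists>f::'x \<Rightarrow> real. continuous_map X euclidean f \<and> f z \<noteq> f w"
proof -
  have "normal_space X"
    using compact_X Hausdorff_X compact_Hausdorff_or_regular_imp_normal_space by blast
  moreover have "closedin X {z}" "closedin X {w}"
    using Hausdorff_X assms by (auto intro: closedin_Hausdorff_singleton)
  ultimately obtain f :: "'x \<Rightarrow> real" where
    "continuous_map X (top_of_set {0..1}) f" "f ` {z} \<subseteq> {0}" "f ` {w} \<subseteq> {1}"
    using Urysohn_lemma[of X "{z}" "{w}" 0 1] assms by (auto simp: disjnt_def)
  then show ?thesis by (intro exI[of _ f]) (auto simp: continuous_map_in_subtopology)
qed

lemma RU_dense_real:
  fixes f :: "(nat \<Rightarrow> 'x option) \<Rightarrow> real"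
  assumes f: "continuous_map XE euclidean f" and e: "e > 0"
  shows "\<exists>g S. (\<lambda>x. complex_of_real (g x), S) \<in> RU \<and> (\<forall>x\<in>Y. \<bar>f x - g x\<bar> < e)"
proof -
  define Q where "Q = {g :: (nat \<Rightarrow> 'x option) \<Rightarrow> real. \<exists>S. (\<lambda>x. complex_of_real (g x), S) \<in> RU}"
  \<comment> \<open>The indicator cuts \<open>h\<close> down to the space, as \<open>C_all X\<close>
    demands; the values are real, so \<open>Re\<close> only changes the type.\<close>
  have coord: "(\<lambda>x. Re (ecoord n (\<lambda>z. of_real (h z) * ind (topspace X) z) x)) \<in> Q"
    if h: "continuous_map X euclidean h" for h n
  proof -
    define a where "a z = complex_of_real (h z) * ind (topspace X) z" for z
    have "a \<in> C_all X"
      using h C_onD[OF ind_mem(3)] unfolding a_def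
      by (auto simp: C_on_def continuous_map_tendsto_iff intro!: tendsto_intros)
    moreover have "(\<lambda>x. complex_of_real (Re (ecoord n a x))) = ecoord n a"
      by (auto simp: ecoord_def a_def ind_def split: option.split)
    ultimately show ?thesis
      using RU_gen[of a n] unfolding Q_def a_def[symmetric] by auto
  qed
  have "\<exists>g\<in>Q. \<forall>x\<in>Y. \<bar>f x - g x\<bar> < e"
  proof (rule stone_weierstrass_topology[OF compact_XE])
    fix g assume "g \<in> Q"
    then have "continuous_map XE euclidean (\<lambda>x. complex_of_real (g x))"
      using RU_closed(1)[THEN C_onD(1)] by (auto simp: Q_def)
    then show "continuous_map XE euclidean g"
      by (auto simp: continuous_map_tendsto_iff tendsto_of_real_iff)
  next
    fix g h assume "g \<in> Q" "h \<in> Q"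
    then obtain S V where "(\<lambda>x. complex_of_real (g x), S) \<in> RU" "(\<lambda>x. complex_of_real (h x), V) \<in> RU"
      by (auto simp: Q_def)
    from RU_plus[OF this] RU_mult[OF this]
    show "(\<lambda>x. g x + h x) \<in> Q" "(\<lambda>x. g x * h x) \<in> Q"
      by (auto simp: Q_def)
  next
    fix c :: real
    have "continuous_map X euclidean (\<lambda>_. c)" by simp
    from coord[OF this, of 0] show "\<exists>g\<in>Q. \<forall>x\<in>Y. g x = c"
      by (rule bexI[rotated]) (use ext_proj_Y in \<open>fastforce simp: ecoord_def ind_def\<close>)
  next
    fix x y assume xy: "x \<in> Y" "y \<in> Y" "x \<noteq> y"
    then obtain n where n: "x n \<noteq> y n" by auto
    have top: "z \<in> topspace X" if "x n = Some z \<or> y n = Some z" for z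
      using that xy admissible_power_dom power_dom_subset unfolding Y_iff by blast
    have 1: "\<exists>h. continuous_map X euclidean h \<and> Re (ecoord n (\<lambda>z. of_real (h z) * ind (topspace X) z) x)
      \<noteq> Re (ecoord n (\<lambda>z. of_real (h z) * ind (topspace X) z) y)"
    proof (cases "x n = None \<or> y n = None")
      \<comment> \<open>The constant \<open>1\<close> in position \<open>n\<close> is nonzero
        exactly where that coordinate is not \<open>None\<close>, which separates the two
        points.\<close>
      case True
      then show ?thesis
        using n xy top
        by (intro exI[of _ "\<lambda>_. 1"], cases "x n"; cases "y n") (auto simp: ecoord_def ind_def)
    next
      case False
      then obtain z w where zw: "x n = Some z" "y n = Some w" by auto
      then obtain h :: "'x \<Rightarrow> real" where "continuous_map X euclidean h" "h z \<noteq> h w"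
        using separate_points[of z w] top n by auto
      then show ?thesis using zw top xy by (intro exI[of _ h]) (auto simp: ecoord_def ind_def)
    qed
    from 1 obtain h where "continuous_map X euclidean h"
      "Re (ecoord n (\<lambda>z. of_real (h z) * ind (topspace X) z) x)
        \<noteq> Re (ecoord n (\<lambda>z. of_real (h z) * ind (topspace X) z) y)" by (elim exE conjE)
    then show "\<exists>g\<in>Q. g x \<noteq> g y" by (intro bexI[OF _ coord[of h n]])
  qed (use f e in auto)
  then show ?thesis by (auto simp: Q_def)
qed

lemma RU_dense:
  assumes b: "b \<in> C_all XE" and e: "e > 0"
  shows "\<exists>b' S. (b', S) \<in> RU \<and> sup_norm (\<lambda>x. b' x - b x) \<le> e"
proof -
  have Re_Im: "continuous_map XE euclidean (\<lambda>x. Re (b x))" "continuous_map XE euclidean (\<lambda>x. Im (b x))"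
    using C_onD(1)[OF b] by (auto simp: continuous_map_tendsto_iff intro!: tendsto_intros)
  obtain g S where g: "(\<lambda>x. complex_of_real (g x), S) \<in> RU" "\<And>x. x \<in> Y \<Longrightarrow> \<bar>Re (b x) - g x\<bar> < e / 2"
    using RU_dense_real[OF Re_Im(1), of "e / 2"] e by auto
  obtain h V where h: "(\<lambda>x. complex_of_real (h x), V) \<in> RU" "\<And>x. x \<in> Y \<Longrightarrow> \<bar>Im (b x) - h x\<bar> < e / 2"
    using RU_dense_real[OF Re_Im(2), of "e / 2"] e by auto
  define b' where "b' x = complex_of_real (g x) + \<i> * of_real (h x)" for x
  have b': "(b', S + scale_op \<i> V) \<in> RU"
    unfolding b'_def by (rule RU_plus[OF g(1) RU_scale[OF h(1)]])
  have "cmod (b' x - b x) \<le> e" for x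
  proof (cases "x \<in> Y")
    case True
    have "cmod (b' x - b x) \<le> \<bar>Re (b' x - b x)\<bar> + \<bar>Im (b' x - b x)\<bar>" by (rule cmod_le)
    then show ?thesis
      using g(2)[OF True] h(2)[OF True] by (simp add: b'_def abs_minus_commute)
  next
    case False
    then show ?thesis using C_onD(2)[OF b] C_onD(2)[OF RU_closed(1)[OF b']] e by simp
  qed
  then have "sup_norm (\<lambda>x. b' x - b x) \<le> e" by (rule sup_norm_least)
  then show ?thesis using b' by blast
qed

definition approx where
  "approx b S s t \<longleftrightarrow> b \<in> C_all XE \<and> (\<forall>n. (s n, t n) \<in> RU) \<and>
    (\<lambda>n. sup_norm (\<lambda>x. s n x - b x)) \<longlonglongrightarrow> 0 \<and> t \<longlonglongrightarrow> S"

lemma approxD: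
  assumes "approx b S s t"
  shows "b \<in> C_all XE" "(s n, t n) \<in> RU" "s n \<in> C_all XE" "(\<lambda>x. s n x - b x) \<in> C_all XE"
    "t n \<in> bounded_ops" "(\<lambda>n. sup_norm (\<lambda>x. s n x - b x)) \<longlonglongrightarrow> 0" "t \<longlonglongrightarrow> S"
proof -
  show 1: "b \<in> C_all XE" "(s n, t n) \<in> RU" "(\<lambda>n. sup_norm (\<lambda>x. s n x - b x)) \<longlonglongrightarrow> 0" "t \<longlonglongrightarrow> S"
    using assms by (auto simp: approx_def)
  show 2: "s n \<in> C_all XE" "t n \<in> bounded_ops" using RU_closed[OF 1(2)] by auto
  show "(\<lambda>x. s n x - b x) \<in> C_all XE" by (rule C_on_intros(3)[OF 2(1) 1(1)])
qed

text \<open>The closure of the graph \<open>RU\<close>, in the supremum norm and the operator norm.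
  Operations are carried over to it before it is known to be the graph of a function.\<close>

definition ext_rel :: "((nat \<Rightarrow> 'x option) \<Rightarrow> complex) \<Rightarrow> ('h \<Rightarrow>\<^sub>L 'h) \<Rightarrow> bool" where
  "ext_rel b S \<longleftrightarrow> (\<exists>s t. approx b S s t)"

lemma ext_relI:
  assumes b: "b \<in> C_all XE" and st: "\<And>n. (s n, t n) \<in> RU"
    and le: "\<And>n. sup_norm (\<lambda>x. s n x - b x) \<le> r n" and r: "r \<longlonglongrightarrow> 0" and t: "t \<longlonglongrightarrow> S"
  shows "ext_rel b S"
proof -
  have "(\<lambda>n. sup_norm (\<lambda>x. s n x - b x)) \<longlonglongrightarrow> 0"
  proof (rule real_tendsto_sandwich[OF _ _ tendsto_const r])
    show "\<forall>\<^sub>F n in sequentially. 0 \<le> sup_norm (\<lambda>x. s n x - b x)"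
      using RU_closed(1)[OF st] b by (intro always_eventually allI E.sup_norm_nonneg C_on_intros)
  qed (simp add: le)
  then show ?thesis using b st t by (auto simp: ext_rel_def approx_def)
qed

lemma ext_rel_C_all: "ext_rel b S \<Longrightarrow> b \<in> C_all XE"
  by (auto simp: ext_rel_def approx_def)

lemma RU_ext_rel: "(b, S) \<in> RU \<Longrightarrow> ext_rel b S"
  by (rule ext_relI[of _ "\<lambda>_. b" "\<lambda>_. S" "\<lambda>_. 0"]) (auto simp: RU_closed)

lemma ext_rel_bounded:
  assumes "ext_rel b S" shows "S \<in> bounded_ops"
proof -
  from assms obtain s t where "approx b S s t" by (auto simp: ext_rel_def)
  note s = approxD[OF this]
  show ?thesis by (rule closed_sequentially[OF closed_bounded_ops s(5,7)])
qed

lemma ext_rel_plus: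
  assumes "ext_rel b S" "ext_rel c V"
  shows "ext_rel (\<lambda>x. b x + c x) (S + V)"
proof -
  from assms(1) obtain s t where "approx b S s t" by (auto simp: ext_rel_def)
  note s = approxD[OF this]
  from assms(2) obtain s' t' where "approx c V s' t'" by (auto simp: ext_rel_def)
  note s' = approxD[OF this]
  show ?thesis
  proof (rule ext_relI)
    show "(\<lambda>x. s n x + s' n x, t n + t' n) \<in> RU" for n by (rule RU_plus[OF s(2) s'(2)])
    show "sup_norm (\<lambda>x. s n x + s' n x - (b x + c x)) \<le>
        sup_norm (\<lambda>x. s n x - b x) + sup_norm (\<lambda>x. s' n x - c x)" for n
      using E.sup_norm_triangle[OF s(4) s'(4), of n n] by (simp add: algebra_simps)
    show "(\<lambda>n. sup_norm (\<lambda>x. s n x - b x) + sup_norm (\<lambda>x. s' n x - c x)) \<longlonglongrightarrow> 0"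
      using tendsto_add[OF s(6) s'(6)] by simp
    show "(\<lambda>n. t n + t' n) \<longlonglongrightarrow> S + V" by (intro tendsto_add s s')
  qed (intro C_on_intros s s')
qed

lemma ext_rel_mult:
  assumes "ext_rel b S" "ext_rel c V"
  shows "ext_rel (\<lambda>x. b x * c x) (S o\<^sub>L V)"
proof -
  from assms(1) obtain s t where "approx b S s t" by (auto simp: ext_rel_def)
  note s = approxD[OF this]
  from assms(2) obtain s' t' where "approx c V s' t'" by (auto simp: ext_rel_def)
  note s' = approxD[OF this]
  show ?thesis
  proof (rule ext_relI)
    show "(\<lambda>x. s n x * s' n x, t n o\<^sub>L t' n) \<in> RU" for n by (rule RU_mult[OF s(2) s'(2)])
    show "sup_norm (\<lambda>x. s n x * s' n x - b x * c x) \<le>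
        (sup_norm (\<lambda>x. s n x - b x) + sup_norm b) * sup_norm (\<lambda>x. s' n x - c x) +
        sup_norm (\<lambda>x. s n x - b x) * sup_norm c" (is "_ \<le> ?r n") for n
    proof -
      have "sup_norm (\<lambda>x. s n x * (s' n x - c x) + (s n x - b x) * c x) \<le>
          sup_norm (\<lambda>x. s n x * (s' n x - c x)) + sup_norm (\<lambda>x. (s n x - b x) * c x)"
        by (intro E.sup_norm_triangle C_on_intros(6)[OF s(3) s'(4)] C_on_intros(6)[OF s(4) s'(1)])
      also have "\<dots> \<le> sup_norm (s n) * sup_norm (\<lambda>x. s' n x - c x) + sup_norm (\<lambda>x. s n x - b x) * sup_norm c"
        by (intro add_mono E.sup_norm_mult s s')
      also have "sup_norm (s n) * sup_norm (\<lambda>x. s' n x - c x) \<le>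
          (sup_norm (\<lambda>x. s n x - b x) + sup_norm b) * sup_norm (\<lambda>x. s' n x - c x)"
        using E.sup_norm_triangle[OF s(4)[of n] s(1)] E.sup_norm_nonneg[OF s'(4)]
        by (intro mult_right_mono) auto
      finally show ?thesis by (simp add: algebra_simps)
    qed
    have "(\<lambda>n. (sup_norm (\<lambda>x. s n x - b x) + sup_norm b) * sup_norm (\<lambda>x. s' n x - c x) +
        sup_norm (\<lambda>x. s n x - b x) * sup_norm c) \<longlonglongrightarrow> (0 + sup_norm b) * 0 + 0 * sup_norm c"
      by (intro tendsto_intros s(6) s'(6))
    then show "(\<lambda>n. (sup_norm (\<lambda>x. s n x - b x) + sup_norm b) * sup_norm (\<lambda>x. s' n x - c x) +
        sup_norm (\<lambda>x. s n x - b x) * sup_norm c) \<longlonglongrightarrow> 0" by simp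
    show "(\<lambda>n. t n o\<^sub>L t' n) \<longlonglongrightarrow> (S o\<^sub>L V)"
      by (intro bounded_bilinear.tendsto[OF bounded_bilinear_blinfun_compose] s s')
  qed (rule C_on_intros(6)[OF s(1) s'(1)])
qed

text \<open>A common argument for the unary operations. In \<open>lim\<close> the operators are
  confined to \<open>bounded_ops\<close> because that is where \<open>adj\<close> is known to be
  continuous.\<close>

lemma ext_rel_map:
  assumes "ext_rel b S"
    and RU: "\<And>b S. (b, S) \<in> RU \<Longrightarrow> (f b, g S) \<in> RU"
    and closed: "f b \<in> C_all XE"
    and Lip: "\<And>s. s \<in> C_all XE \<Longrightarrow> sup_norm (\<lambda>x. f s x - f b x) \<le> K * sup_norm (\<lambda>x. s x - b x)"
    and lim: "\<And>t. t \<longlonglongrightarrow> S \<Longrightarrow> (\<And>n. t n \<in> bounded_ops) \<Longrightarrow> (\<lambda>n. g (t n)) \<longlonglongrightarrow> g S"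
  shows "ext_rel (f b) (g S)"
proof -
  from assms(1) obtain s t where "approx b S s t" by (auto simp: ext_rel_def)
  note s = approxD[OF this]
  show ?thesis
  proof (rule ext_relI[OF closed RU[OF s(2)] Lip[OF s(3)]])
    show "(\<lambda>n. K * sup_norm (\<lambda>x. s n x - b x)) \<longlonglongrightarrow> 0"
      using tendsto_mult_left[OF s(6), of K] by simp
  qed (rule lim[OF s(7,5)])
qed

lemma ext_rel_scale:
  assumes b: "ext_rel b S"
  shows "ext_rel (\<lambda>x. c * b x) (scale_op c S)"
proof (rule ext_rel_map[OF b, where f = "\<lambda>b x. c * b x" and g = "scale_op c" and K = "cmod c"])
  have bC: "b \<in> C_all XE" using b by (rule ext_rel_C_all)
  show "(\<lambda>x. c * b x) \<in> C_all XE" using bC by (rule C_on_intros)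
  show "sup_norm (\<lambda>x. c * s x - c * b x) \<le> cmod c * sup_norm (\<lambda>x. s x - b x)" if "s \<in> C_all XE" for s
    using E.sup_norm_scale_le[OF C_on_intros(3)[OF that bC], of c] by (simp add: algebra_simps)
qed (auto intro: RU_scale tendsto_scale_op)

lemma ext_rel_star:
  assumes b: "ext_rel b S"
  shows "ext_rel (\<lambda>x. cnj (b x)) (adj S)"
proof (rule ext_rel_map[OF b, where f = "\<lambda>b x. cnj (b x)" and g = adj and K = 1])
  have bC: "b \<in> C_all XE" using b by (rule ext_rel_C_all)
  show "(\<lambda>x. cnj (b x)) \<in> C_all XE" using bC by (rule C_on_intros)
  show "sup_norm (\<lambda>x. cnj (s x) - cnj (b x)) \<le> 1 * sup_norm (\<lambda>x. s x - b x)" for s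
    using sup_norm_cnj[of "\<lambda>x. s x - b x"] by simp
qed (auto intro: RU_star tendsto_adj)

lemma ext_rel_dE:
  assumes b: "ext_rel b S"
  shows "ext_rel (dE b) (U o\<^sub>L S o\<^sub>L adj U)"
proof (rule ext_rel_map[OF b, where f = dE and g = "\<lambda>S. U o\<^sub>L S o\<^sub>L adj U" and K = 1])
  have bC: "b \<in> C_all XE" using b by (rule ext_rel_C_all)
  show "dE b \<in> C_all XE" using bC by (rule dE_closed)
  show "sup_norm (\<lambda>x. dE s x - dE b x) \<le> 1 * sup_norm (\<lambda>x. s x - b x)" if "s \<in> C_all XE" for s
  proof -
    have "(\<lambda>x. dE s x - dE b x) = dE (\<lambda>x. s x - b x)" by (auto simp: pullback_def)
    then show ?thesis using E.sup_norm_pullback_le[OF C_on_intros(3)[OF that bC]] by simp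
  qed
qed (auto intro!: RU_dE bounded_bilinear.tendsto[OF bounded_bilinear_blinfun_compose])

lemma ext_rel_gE:
  assumes b: "ext_rel b S"
  shows "ext_rel (gE b) (adj U o\<^sub>L S o\<^sub>L U)"
proof (rule ext_rel_map[OF b, where f = gE and g = "\<lambda>S. adj U o\<^sub>L S o\<^sub>L U" and K = 1])
  have bC: "b \<in> C_all XE" using b by (rule ext_rel_C_all)
  show "gE b \<in> C_all XE" using bC by (rule gE_closed)
  show "sup_norm (\<lambda>x. gE s x - gE b x) \<le> 1 * sup_norm (\<lambda>x. s x - b x)" if "s \<in> C_all XE" for s
  proof -
    have "(\<lambda>x. gE s x - gE b x) = gE (\<lambda>x. s x - b x)" by (auto simp: pullback_def)
    then show ?thesis using E.sup_norm_pullback_le[OF C_on_intros(3)[OF that bC]] by simp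
  qed
qed (auto intro!: RU_gE bounded_bilinear.tendsto[OF bounded_bilinear_blinfun_compose])

lemma ext_rel_norm:
  assumes "ext_rel b S"
  shows "norm S \<le> sup_norm b"
proof -
  from assms obtain s t where "approx b S s t" by (auto simp: ext_rel_def)
  note s = approxD[OF this]
  have "norm (t n) \<le> sup_norm (\<lambda>x. s n x - b x) + sup_norm b" for n
    using norm_RU_le[OF s(2), of n] E.sup_norm_triangle[OF s(4)[of n] s(1)] by simp
  moreover have "(\<lambda>n. sup_norm (\<lambda>x. s n x - b x) + sup_norm b) \<longlonglongrightarrow> 0 + sup_norm b"
    by (intro tendsto_intros s)
  ultimately have "norm S \<le> 0 + sup_norm b"
    by (intro LIMSEQ_le[OF tendsto_norm[OF s(7)]]) auto
  then show ?thesis by simp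
qed

text \<open>The difference of the two pairs lies over the zero function, so the norm estimate makes
  it vanish.\<close>

lemma ext_rel_unique:
  assumes "ext_rel b S" "ext_rel b S'"
  shows "S = S'"
proof -
  have "ext_rel (\<lambda>x. b x + (-1) * b x) (S + scale_op (-1) S')"
    by (intro ext_rel_plus ext_rel_scale assms)
  from ext_rel_norm[OF this] show ?thesis by (simp add: scale_op_simps)
qed

lemma ext_rel_exists:
  assumes b: "b \<in> C_all XE"
  shows "\<exists>S. ext_rel b S"
proof -
  have "\<forall>n. \<exists>p. p \<in> RU \<and> sup_norm (\<lambda>x. fst p x - b x) \<le> inverse (real (Suc n))"
    using RU_dense[OF b] by (metis fst_conv inverse_positive_iff_positive of_nat_0_less_iff zero_less_Suc)
  then obtain p where p: "\<And>n. p n \<in> RU" "\<And>n. sup_norm (\<lambda>x. fst (p n) x - b x) \<le> inverse (real (Suc n))"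
    by metis
  define s t where "s n = fst (p n)" and "t n = snd (p n)" for n
  have st: "(s n, t n) \<in> RU" for n using p by (simp add: s_def t_def)
  note sC = RU_closed(1)[OF st]
  have "Cauchy t"
  proof (rule metric_CauchyI)
    fix e :: real assume "e > 0"
    then obtain M where M: "inverse (real (Suc M)) < e / 2"
      using reals_Archimedean[of "e / 2"] by auto
    have "dist (t m) (t n) < e" if "m \<ge> M" "n \<ge> M" for m n
    proof -
      have "norm (t m - t n) \<le> sup_norm (\<lambda>x. s m x - s n x)"
        by (rule norm_RU_le[OF RU_diff[OF st st]])
      also have "\<dots> = sup_norm (\<lambda>x. (s m x - b x) + (b x - s n x))" by simp
      also have "\<dots> \<le> sup_norm (\<lambda>x. s m x - b x) + sup_norm (\<lambda>x. b x - s n x)"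
        by (intro E.sup_norm_triangle C_on_intros sC b)
      also have "sup_norm (\<lambda>x. b x - s n x) = sup_norm (\<lambda>x. s n x - b x)"
        by (rule sup_norm_minus_commute)
      also have "sup_norm (\<lambda>x. s m x - b x) + sup_norm (\<lambda>x. s n x - b x) \<le>
          inverse (real (Suc m)) + inverse (real (Suc n))"
        using p(2) by (intro add_mono) (auto simp: s_def)
      also have "\<dots> \<le> inverse (real (Suc M)) + inverse (real (Suc M))"
        using that by (intro add_mono le_imp_inverse_le) auto
      also have "\<dots> < e" using M by simp
      finally show ?thesis by (simp add: dist_norm)
    qed
    then show "\<exists>M. \<forall>m\<ge>M. \<forall>n\<ge>M. dist (t m) (t n) < e" by blast
  qed
  then obtain S where "t \<longlonglongrightarrow> S" by (meson Cauchy_convergent_iff convergent_def)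
  then have "ext_rel b S"
    using p(2) LIMSEQ_inverse_real_of_nat
    by (intro ext_relI[OF b st, where r = "\<lambda>n. inverse (real (Suc n))"]) (auto simp: s_def)
  then show ?thesis by blast
qed

definition piB :: "((nat \<Rightarrow> 'x option) \<Rightarrow> complex) \<Rightarrow> 'h \<Rightarrow>\<^sub>L 'h" where
  "piB b = (THE S. ext_rel b S)"

lemma piB_eqI: "ext_rel b S \<Longrightarrow> piB b = S"
  unfolding piB_def using ext_rel_unique by blast

lemma piB_rel: "b \<in> C_all XE \<Longrightarrow> ext_rel b (piB b)"
  using ext_rel_exists piB_eqI by metis

lemma piB_bounded [simp, intro]: "b \<in> C_all XE \<Longrightarrow> piB b \<in> bounded_ops"
  by (rule ext_rel_bounded[OF piB_rel])

lemma norm_piB_le: "b \<in> C_all XE \<Longrightarrow> norm (piB b) \<le> sup_norm b"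
  by (rule ext_rel_norm[OF piB_rel])

lemma piB_add: "b \<in> C_all XE \<Longrightarrow> c \<in> C_all XE \<Longrightarrow> piB (\<lambda>x. b x + c x) = piB b + piB c"
  and piB_mult: "b \<in> C_all XE \<Longrightarrow> c \<in> C_all XE \<Longrightarrow> piB (\<lambda>x. b x * c x) = piB b o\<^sub>L piB c"
  and piB_scale: "b \<in> C_all XE \<Longrightarrow> piB (\<lambda>x. z * b x) = scale_op z (piB b)"
  and piB_star: "b \<in> C_all XE \<Longrightarrow> piB (\<lambda>x. cnj (b x)) = adj (piB b)"
  and piB_dE: "b \<in> C_all XE \<Longrightarrow> piB (dE b) = U o\<^sub>L piB b o\<^sub>L adj U"
  and piB_gE: "b \<in> C_all XE \<Longrightarrow> piB (gE b) = adj U o\<^sub>L piB b o\<^sub>L U"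
  by (intro piB_eqI ext_rel_plus ext_rel_mult ext_rel_scale ext_rel_star ext_rel_dE ext_rel_gE piB_rel;
      assumption)+

lemma piB_RU: "(b, S) \<in> RU \<Longrightarrow> piB b = S"
  by (rule piB_eqI[OF RU_ext_rel])

lemma piB_ecoord: "a \<in> C_all X \<Longrightarrow> piB (ecoord k a) = T k a"
  by (rule piB_RU[OF RU_gen])

lemma piB_zero: "piB (\<lambda>_. 0) = 0"
  using piB_ecoord[of "\<lambda>_. 0" 0] T_zero[of 0] by (simp add: ecoord_zero C_on_intros)

lemma piB_commute: "b \<in> C_all XE \<Longrightarrow> c \<in> C_all XE \<Longrightarrow> piB b o\<^sub>L piB c = piB c o\<^sub>L piB b"
  by (simp add: piB_mult[symmetric] mult.commute)

text \<open>Replacing \<open>U\<close> by \<open>U\<close> times its initial projection and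
  commuting that projection past \<open>piB b\<close> produces the full conjugate
  \<open>U o\<^sub>L piB b o\<^sub>L adj U\<close>, followed by one more \<open>U\<close>.\<close>

lemma U_piB:
  assumes b: "b \<in> C_all XE"
  shows "U o\<^sub>L piB b = piB (dE b) o\<^sub>L U"
proof -
  have "U o\<^sub>L piB b = U o\<^sub>L (piB (ecoord 0 (ind (\<alpha> ` D))) o\<^sub>L piB b)"
    by (simp add: piB_ecoord blinfun_compose_assoc[symmetric] U_initial)
  also have "piB (ecoord 0 (ind (\<alpha> ` D))) o\<^sub>L piB b = piB b o\<^sub>L (adj U o\<^sub>L U)"
    using b by (subst piB_commute) (auto simp: piB_ecoord UsU)
  also have "U o\<^sub>L (piB b o\<^sub>L (adj U o\<^sub>L U)) = piB (dE b) o\<^sub>L U"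
    by (simp only: piB_dE[OF b] blinfun_compose_assoc)
  finally show ?thesis .
qed

lemma Us_piB:
  assumes b: "b \<in> C_all XE"
  shows "adj U o\<^sub>L piB b = piB (gE b) o\<^sub>L adj U"
proof -
  have "adj U o\<^sub>L piB b = adj U o\<^sub>L (piB (ecoord 0 (ind D)) o\<^sub>L piB b)"
    by (simp add: piB_ecoord blinfun_compose_assoc[symmetric] Us_final)
  also have "piB (ecoord 0 (ind D)) o\<^sub>L piB b = piB b o\<^sub>L (U o\<^sub>L adj U)"
    using b by (subst piB_commute) (auto simp: piB_ecoord UUs)
  also have "adj U o\<^sub>L (piB b o\<^sub>L (U o\<^sub>L adj U)) = piB (gE b) o\<^sub>L adj U"
    by (simp only: piB_gE[OF b] blinfun_compose_assoc)
  finally show ?thesis .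
qed

section \<open>Commutation with integer powers\<close>

abbreviation Uint :: "int \<Rightarrow> 'h \<Rightarrow>\<^sub>L 'h" where
  "Uint \<equiv> op_power_int U"

lemma Uint_Suc: "Uint (int (Suc n)) = U o\<^sub>L Uint (int n)"
  and Uint_minus_Suc: "Uint (- int (Suc n)) = adj U o\<^sub>L Uint (- int n)"
  by (auto simp: op_power_int_def nat_add_distrib op_power_Suc)

lemma Uint_0 [simp]: "Uint 0 = id_blinfun"
  by (simp add: op_power_int_def)

lemma Uint_bounded [simp, intro]: "Uint n \<in> bounded_ops"
  by (auto simp: op_power_int_def)

lemma norm_Uint: "norm (Uint n) \<le> 1"
  using norm_U by (auto simp: op_power_int_def norm_op_power_le_one norm_adj)

lemma adj_Uint: "adj (Uint n) = Uint (- n)"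
  by (auto simp: op_power_int_def adj_op_power)

text \<open>For \<open>m < 0\<close> the power begins with \<open>adj U\<close>, which completes the
  conjugation of \<open>piB b\<close>; the exponent rises because this factor is used up.\<close>

lemma U_piB_Uint:
  assumes b: "b \<in> C_all XE"
  shows "U o\<^sub>L (piB b o\<^sub>L Uint m) = piB (dE b) o\<^sub>L Uint (m + 1)"
proof (cases "m \<ge> 0")
  case True
  then have "Uint (m + 1) = U o\<^sub>L Uint m"
    using Uint_Suc[of "nat m"] by (simp add: add.commute)
  then show ?thesis using U_piB[OF b] by (simp add: blinfun_compose_assoc[symmetric])
next
  case False
  then obtain n where "m = - int (Suc n)" by (metis int_cases not_le of_nat_0_le_iff)
  then show ?thesis
    using piB_dE[OF b] by (simp add: Uint_minus_Suc blinfun_compose_assoc del: of_nat_Suc) simp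
qed

lemma Us_piB_Uint:
  assumes b: "b \<in> C_all XE"
  shows "adj U o\<^sub>L (piB b o\<^sub>L Uint m) = piB (gE b) o\<^sub>L Uint (m - 1)"
proof (cases "m \<le> 0")
  case True
  then have "Uint (m - 1) = adj U o\<^sub>L Uint m"
    using Uint_minus_Suc[of "nat (- m)"] by (simp add: add.commute)
  then show ?thesis using Us_piB[OF b] by (simp add: blinfun_compose_assoc[symmetric])
next
  case False
  then obtain n where "m = int (Suc n)" by (metis gr0_implies_Suc not_le zero_less_imp_eq_int)
  then show ?thesis
    using piB_gE[OF b] by (simp add: Uint_Suc blinfun_compose_assoc del: of_nat_Suc) simp
qed

text \<open>One rule for both operations of the convolution algebra: the star uses it with
  \<open>m = 0\<close>, the product with \<open>m = n - k\<close>.\<close>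

lemma Uint_piB_Uint:
  assumes b: "b \<in> C_all XE"
  shows "Uint k o\<^sub>L (piB b o\<^sub>L Uint m) = piB (dEpow k b) o\<^sub>L Uint (k + m)"
proof (induction k rule: int_cases_induct)
  case (2 n)
  then show ?case
    using U_piB_Uint[OF dEpow_closed[OF b], of "int n" "int n + m"]
    by (simp add: Uint_Suc dEpow_Suc blinfun_compose_assoc del: of_nat_Suc) (simp add: add_ac)
next
  case (3 n)
  then show ?case
    using Us_piB_Uint[OF dEpow_closed[OF b], of "- int n" "- int n + m"]
    by (simp add: Uint_minus_Suc dEpow_minus_Suc blinfun_compose_assoc del: of_nat_Suc)
      (simp add: algebra_simps)
qed simp

end

section \<open>The covariance algebra\<close>

lemma summable_on_M_test:
  fixes f :: "'a \<Rightarrow> 'b::banach"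
  assumes "w summable_on A" "\<And>x. x \<in> A \<Longrightarrow> norm (f x) \<le> w x"
  shows "f summable_on A" and "norm (infsum f A) \<le> infsum w A"
proof -
  have abs: "(\<lambda>x. norm (f x)) summable_on A"
    by (rule Infinite_Sum.abs_summable_on_comparison_test'[OF assms])
  then show "f summable_on A" by (rule Infinite_Sum.abs_summable_summable)
  have "norm (infsum f A) \<le> infsum (\<lambda>x. norm (f x)) A" by (rule norm_infsum_bound[OF abs])
  also have "\<dots> \<le> infsum w A" using abs assms by (intro infsum_mono)
  finally show "norm (infsum f A) \<le> infsum w A" .
qed

text \<open>The right-hand side depends on \<open>w\<close> alone, so for a family of series with a
  common majorant the partial sums converge uniformly.\<close>

lemma infsum_tail_le:
  fixes f :: "'a \<Rightarrow> 'b::banach"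
  assumes w: "w summable_on UNIV" and le: "\<And>x. norm (f x) \<le> w x" and F: "finite F"
  shows "norm (infsum f UNIV - sum f F) \<le> infsum w UNIV - sum w F"
proof -
  have f: "f summable_on UNIV" by (rule summable_on_M_test(1)[OF w le])
  have "infsum f UNIV - sum f F = infsum f (UNIV - F)"
    using infsum_Un_disjoint[of f F "UNIV - F"] F f by (simp add: summable_on_subset_banach)
  moreover have "infsum w UNIV - sum w F = infsum w (UNIV - F)"
    using infsum_Un_disjoint[of w F "UNIV - F"] F w by (simp add: summable_on_subset_banach)
  ultimately show ?thesis
    using summable_on_M_test(2)[of w "UNIV - F" f] w le by (simp add: summable_on_subset_banach)
qed

lemma eventually_infsum_tail:
  fixes w :: "'a \<Rightarrow> real"
  assumes "w summable_on UNIV" "r > 0"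
  shows "\<forall>\<^sub>F F in finite_subsets_at_top UNIV. finite F \<and> infsum w UNIV - sum w F < r"
proof (rule eventually_conj)
  show "\<forall>\<^sub>F F in finite_subsets_at_top UNIV. finite (F::'a set)"
    by (rule eventually_finite_subsets_at_top_weakI)
  have "\<forall>\<^sub>F F in finite_subsets_at_top UNIV. infsum w UNIV - r < sum w F"
    using infsum_tendsto[OF assms(1)] assms(2) by (intro order_tendstoD(1)) auto
  then show "\<forall>\<^sub>F F in finite_subsets_at_top UNIV. infsum w UNIV - sum w F < r"
    by (rule eventually_mono) simp
qed

lemma C_on_sum: "finite F \<Longrightarrow> (\<And>k. k \<in> F \<Longrightarrow> f k \<in> C_on Y K) \<Longrightarrow> (\<lambda>x. \<Sum>k\<in>F. f k x) \<in> C_on Y K"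
  by (induction F rule: finite_induct) (auto intro: C_on_intros)

lemma C_on_infsum:
  fixes f :: "'k \<Rightarrow> 'y \<Rightarrow> complex"
  assumes f: "\<And>k. f k \<in> C_on Y K" and w: "w summable_on UNIV" and le: "\<And>k y. cmod (f k y) \<le> w k"
  shows "(\<lambda>y. \<Sum>\<^sub>\<infinity>k. f k y) \<in> C_on Y K"
proof -
  have fin: "\<forall>\<^sub>F F in finite_subsets_at_top UNIV. finite (F :: 'k set)"
    by (rule eventually_finite_subsets_at_top_weakI)
  have "continuous_map Y Met_TC.mtopology (\<lambda>y. \<Sum>\<^sub>\<infinity>k. f k y)"
  proof (rule Met_TC.continuous_map_uniform_limit)
    show "\<forall>\<^sub>F F in finite_subsets_at_top UNIV.
        continuous_map Y Met_TC.mtopology (\<lambda>y. \<Sum>k\<in>F. f k y)"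
      using fin by (rule eventually_mono) (use C_onD(1)[OF C_on_sum[OF _ f]] in auto)
    fix r :: real assume "0 < r"
    show "\<forall>\<^sub>F F in finite_subsets_at_top UNIV. \<forall>y\<in>topspace Y. (\<Sum>\<^sub>\<infinity>k. f k y) \<in> UNIV \<and>
        dist (\<Sum>k\<in>F. f k y) (\<Sum>\<^sub>\<infinity>k. f k y) < r"
      using eventually_infsum_tail[OF w \<open>0 < r\<close>]
    proof (rule eventually_mono)
      fix F assume F: "finite F \<and> infsum w UNIV - sum w F < r"
      then show "\<forall>y\<in>topspace Y. (\<Sum>\<^sub>\<infinity>k. f k y) \<in> UNIV \<and>
          dist (\<Sum>k\<in>F. f k y) (\<Sum>\<^sub>\<infinity>k. f k y) < r"
        using infsum_tail_le[of w "\<lambda>k. f k y" F for y, OF w le]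
        by (auto simp: dist_norm norm_minus_commute intro: le_less_trans)
    qed
  qed simp
  moreover have "(\<Sum>\<^sub>\<infinity>k. f k y) = 0" if "y \<notin> K" for y
    using C_onD(2)[OF f that] by simp
  ultimately show ?thesis by (simp add: C_on_def)
qed

context contractive_star_rep
begin

lemma closure_star_algebra:
  assumes S: "S \<in> closure (\<phi> ` elems A)"
  shows "S \<in> bounded_ops" "adj S \<in> closure (\<phi> ` elems A)" "scale_op c S \<in> closure (\<phi> ` elems A)"
    and "V \<in> closure (\<phi> ` elems A) \<Longrightarrow> S + V \<in> closure (\<phi> ` elems A)"
    and "V \<in> closure (\<phi> ` elems A) \<Longrightarrow> S o\<^sub>L V \<in> closure (\<phi> ` elems A)"
proof -
  have "\<exists>a. (\<forall>n. a n \<in> elems A) \<and> (\<lambda>n. \<phi> (a n)) \<longlonglongrightarrow> V" if V: "V \<in> closure (\<phi> ` elems A)" for V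
    using extension_surj[OF V] env_CauchyD by blast
  then obtain a where a: "\<And>V n. V \<in> closure (\<phi> ` elems A) \<Longrightarrow> a V n \<in> elems A"
    "\<And>V. V \<in> closure (\<phi> ` elems A) \<Longrightarrow> (\<lambda>n. \<phi> (a V n)) \<longlonglongrightarrow> V"
    by metis
  have I: "V \<in> closure (\<phi> ` elems A)"
    if "\<And>n. b n \<in> elems A" "(\<lambda>n. \<phi> (b n)) \<longlonglongrightarrow> V" for b :: "nat \<Rightarrow> 'a" and V
    unfolding closure_sequential using that by (intro exI[of _ "\<lambda>n. \<phi> (b n)"]) auto
  note S' = a[OF S]
  show "S \<in> bounded_ops"
    by (rule closed_sequentially[OF closed_bounded_ops \<phi>_bounded[OF S'(1)] S'(2)])
  show "adj S \<in> closure (\<phi> ` elems A)"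
    using tendsto_adj[OF S'(2)] S'(1)
    by (intro I[of "\<lambda>n. star A (a S n)"]) (auto simp: closed \<phi>_star \<phi>_bounded)
  show "scale_op c S \<in> closure (\<phi> ` elems A)"
    using tendsto_scale_op[OF S'(2)] S'(1)
    by (intro I[of "\<lambda>n. scale A c (a S n)"]) (auto simp: closed \<phi>_scale)
  assume V: "V \<in> closure (\<phi> ` elems A)"
  note V' = a[OF V]
  show "S + V \<in> closure (\<phi> ` elems A)"
    using tendsto_add[OF S'(2) V'(2)] S'(1) V'(1)
    by (intro I[of "\<lambda>n. add A (a S n) (a V n)"]) (auto simp: closed \<phi>_add)
  show "S o\<^sub>L V \<in> closure (\<phi> ` elems A)"
    using bounded_bilinear.tendsto[OF bounded_bilinear_blinfun_compose S'(2) V'(2)] S'(1) V'(1)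
    by (intro I[of "\<lambda>n. mult A (a S n) (a V n)"]) (auto simp: closed \<phi>_mult)
qed

end

lemma bij_uminus: "bij_betw uminus (UNIV :: int set) UNIV"
  by (rule bij_betw_byWitness[of _ uminus]) auto

section \<open>The convolution algebra\<close>

context partial_system
begin

abbreviation L where
  "L \<equiv> L_algebra X D \<alpha>"

definition unitL :: "int \<Rightarrow> (nat \<Rightarrow> 'x option) \<Rightarrow> complex" where
  "unitL n = (if n = 0 then chi 0 else (\<lambda>_. 0))"

text \<open>\<open>f\<close> equals \<open>chi m\<close> times \<open>f\<close>, powers are
  multiplicative, and \<open>dEpow k\<close> turns \<open>chi m\<close> into the product of
  \<open>chi k\<close> and \<open>chi (k + m)\<close>.\<close>

lemma dEpow_C_on:
  assumes f: "f \<in> C_on XE (ext_dom X D \<alpha> m)"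
  shows "dEpow k f \<in> C_on XE (ext_dom X D \<alpha> (k + m))" and "dEpow k f \<in> C_on XE (ext_dom X D \<alpha> k)"
proof -
  have fC: "f \<in> C_all XE" using f ext_dom_Y by (rule C_on_mono)
  have van: "\<And>x. x \<notin> Y \<Longrightarrow> f x = 0" "\<And>x. x \<notin> Y \<Longrightarrow> chi 0 x = 0"
    using C_onD(2)[OF fC] by (auto simp: chi_0)
  have "f = (\<lambda>x. chi m x * f x)"
    using C_onD(2)[OF f] by (auto simp: chi_def)
  then have "dEpow k f = (\<lambda>x. dEpow k (chi m) x * dEpow k f x)"
    using dEpow_pointwise(1) by metis
  also have "dEpow k (chi m) = (\<lambda>x. chi k x * chi (k + m) x)"
    unfolding chi_dEpow[of m] chi_dEpow[of "k + m"] by (rule dEpow_dEpow[OF van(2)])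
  finally have "dEpow k f x = chi k x * chi (k + m) x * dEpow k f x" for x by (rule fun_cong)
  then have "x \<notin> ext_dom X D \<alpha> k \<or> x \<notin> ext_dom X D \<alpha> (k + m) \<Longrightarrow> dEpow k f x = 0" for x
    by (metis chi_def mult_zero_left mult_zero_right)
  then show "dEpow k f \<in> C_on XE (ext_dom X D \<alpha> (k + m))" "dEpow k f \<in> C_on XE (ext_dom X D \<alpha> k)"
    using C_onD(1)[OF dEpow_closed[OF fC]] by (auto simp: C_on_def)
qed

lemma L_iff: "a \<in> elems L \<longleftrightarrow> (\<forall>n. a n \<in> C_on XE (ext_dom X D \<alpha> n)) \<and> (\<lambda>n. sup_norm (a n)) summable_on UNIV"
  by (simp add: L_algebra_def)

lemma L_C_on: "a \<in> elems L \<Longrightarrow> a n \<in> C_on XE (ext_dom X D \<alpha> n)"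
  and L_summable: "a \<in> elems L \<Longrightarrow> (\<lambda>n. sup_norm (a n)) summable_on UNIV"
  by (simp_all add: L_iff)

lemma L_C_all: "a \<in> elems L \<Longrightarrow> a n \<in> C_all XE"
  by (rule C_on_mono[OF L_C_on ext_dom_Y])

lemma L_dominated:
  assumes "\<And>n. a n \<in> C_on XE (ext_dom X D \<alpha> n)" "w summable_on UNIV" "\<And>n. sup_norm (a n) \<le> w n"
  shows "a \<in> elems L"
proof -
  have "a n \<in> C_all XE" for n by (rule C_on_mono[OF assms(1) ext_dom_Y])
  then have "(\<lambda>n. sup_norm (a n)) summable_on UNIV"
    by (intro summable_on_comparison_test[OF assms(2)] assms(3) E.sup_norm_nonneg)
  then show ?thesis by (simp add: L_iff assms(1))
qed

lemma L_ops:
  "add L = (\<lambda>a b n x. a n x + b n x)"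
  "scale L = (\<lambda>c a n x. c * a n x)"
  "nrm L = (\<lambda>a. \<Sum>\<^sub>\<infinity>n. sup_norm (a n))"
  by (simp_all add: L_algebra_def)

lemma L_star:
  assumes a: "a \<in> elems L"
  shows "star L a n = dEpow n (\<lambda>y. cnj (a (- n) y))"
proof -
  have "(\<lambda>y. cnj (a (- n) y)) \<in> C_on XE (ext_dom X D \<alpha> (- n))"
    using L_C_on[OF a] by (intro C_on_intros)
  then show ?thesis by (simp add: L_algebra_def ext_delta_power_eq)
qed

text \<open>Going back and forth by \<open>k\<close> steps only cuts \<open>a k\<close> off to the
  domain in which it is supported anyway. What remains is \<open>a k\<close> times the shifted
  coefficient, meaningful everywhere thanks to extension by zero.\<close>

lemma L_mult:
  assumes a: "a \<in> elems L" and b: "b \<in> elems L"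
  shows "mult L a b n = (\<lambda>x. \<Sum>\<^sub>\<infinity>k. a k x * dEpow k (b (n - k)) x)"
proof -
  have "ext_delta_power X D \<alpha> k (\<lambda>y. ext_delta_power X D \<alpha> (- k) (a k) y * b (n - k) y) x =
      a k x * dEpow k (b (n - k)) x" for k x
  proof -
    have van: "x \<notin> Y \<Longrightarrow> a k x = 0" for x using C_onD(2)[OF L_C_all[OF a]] .
    have 1: "ext_delta_power X D \<alpha> (- k) (a k) = dEpow (- k) (a k)"
      using L_C_on[OF a, of k] by (intro ext_delta_power_eq) simp
    have "(\<lambda>y. dEpow (- k) (a k) y * b (n - k) y) \<in> C_on XE (ext_dom X D \<alpha> (- k))"
      by (rule C_on_intros(6)[OF dEpow_C_on(2)[OF L_C_on[OF a]] L_C_on[OF b]])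
    then have "ext_delta_power X D \<alpha> k (\<lambda>y. ext_delta_power X D \<alpha> (- k) (a k) y * b (n - k) y) =
        dEpow k (\<lambda>y. dEpow (- k) (a k) y * b (n - k) y)"
      unfolding 1 by (rule ext_delta_power_eq)
    also have "\<dots> = (\<lambda>x. chi k x * a k x * dEpow k (b (n - k)) x)"
      by (simp add: dEpow_pointwise(1) dEpow_dEpow[OF van])
    finally show ?thesis
      using C_onD(2)[OF L_C_on[OF a], of x k] by (simp add: chi_def)
  qed
  then show ?thesis by (simp add: L_algebra_def)
qed

lemma conv_C_on:
  assumes "a \<in> elems L" "b \<in> elems L"
  shows "(\<lambda>x. a k x * dEpow k (b (n - k)) x) \<in> C_on XE (ext_dom X D \<alpha> n)"
  using C_on_intros(7)[OF L_C_on[OF assms(1)] dEpow_C_on(1)[OF L_C_on[OF assms(2)]], of k k "n - k"] by simp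

lemma conv_norm_le:
  assumes "a \<in> elems L" "b \<in> elems L"
  shows "cmod (a k x * dEpow k (b (n - k)) x) \<le> sup_norm (a k) * sup_norm (b (n - k))"
  unfolding norm_mult
  using L_C_all[OF assms(1)] L_C_all[OF assms(2)]
  by (intro mult_mono E.norm_le_sup E.sup_norm_nonneg order_trans[OF E.norm_le_sup sup_norm_dEpow_le] dEpow_closed) auto

text \<open>Summed over \<open>n\<close> first, the inner series is a translate of the norm series
  of \<open>b\<close> and has the same sum for every \<open>k\<close>; unconditional summability
  then permits the exchange of order.\<close>

lemma conv_summable:
  assumes a: "a \<in> elems L" and b: "b \<in> elems L"
  shows "(\<lambda>(n, k). sup_norm (a k) * sup_norm (b (n - k))) summable_on UNIV \<times> UNIV"
proof -
  define W where "W = (\<Sum>\<^sub>\<infinity>n. sup_norm (b n))"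
  have "(\<lambda>(k, n). sup_norm (a k) * sup_norm (b (n - k))) summable_on UNIV \<times> UNIV"
  proof (rule summable_on_SigmaI)
    fix k :: int
    have "((\<lambda>n. sup_norm (b n)) has_sum W) UNIV"
      using L_summable[OF b] by (simp add: W_def)
    moreover have "bij_betw (\<lambda>n. n - k) UNIV UNIV"
      by (rule bij_betw_byWitness[of _ "\<lambda>n. n + k"]) auto
    ultimately have "((\<lambda>n. sup_norm (b (n - k))) has_sum W) UNIV"
      using has_sum_reindex_bij_betw[of "\<lambda>n. n - k" UNIV UNIV "\<lambda>n. sup_norm (b n)" W] by simp
    then show "((\<lambda>n. case (k, n) of (k, n) \<Rightarrow> sup_norm (a k) * sup_norm (b (n - k))) has_sum sup_norm (a k) * W) UNIV"
      by (simp add: has_sum_cmult_right)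
  next
    show "(\<lambda>k. sup_norm (a k) * W) summable_on UNIV"
      by (rule summable_on_cmult_left[OF L_summable[OF a]])
  qed (auto intro!: mult_nonneg_nonneg E.sup_norm_nonneg L_C_all a b)
  then have "(\<lambda>(n, k). case (k, n) of (k, n) \<Rightarrow> sup_norm (a k) * sup_norm (b (n - k))) summable_on UNIV \<times> UNIV"
    by (rule summable_on_swap[THEN iffD1])
  then show ?thesis by simp
qed

lemma conv_summable_row:
  assumes "a \<in> elems L" "b \<in> elems L"
  shows "(\<lambda>k. sup_norm (a k) * sup_norm (b (n - k))) summable_on UNIV"
  using summable_on_SigmaD1[OF conv_summable[OF assms], of n]  by simp

lemma L_mult_closed:
  assumes a: "a \<in> elems L" and b: "b \<in> elems L"
  shows "mult L a b \<in> elems L"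
proof (rule L_dominated)
  show "mult L a b n \<in> C_on XE (ext_dom X D \<alpha> n)" for n
    unfolding L_mult[OF a b]
    by (rule C_on_infsum[OF conv_C_on[OF a b] conv_summable_row[OF a b] conv_norm_le[OF a b]])
  show "(\<lambda>n. \<Sum>\<^sub>\<infinity>k. sup_norm (a k) * sup_norm (b (n - k))) summable_on UNIV"
    using summable_on_Sigma_banach[OF conv_summable[OF a b]] by simp
  show "sup_norm (mult L a b n) \<le> (\<Sum>\<^sub>\<infinity>k. sup_norm (a k) * sup_norm (b (n - k)))" for n
    unfolding L_mult[OF a b]
    by (rule sup_norm_least, rule summable_on_M_test(2)[OF conv_summable_row[OF a b] conv_norm_le[OF a b]])
qed

lemma conv_summable_pointwise:
  assumes "a \<in> elems L" "b \<in> elems L"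
  shows "(\<lambda>k. a k x * dEpow k (b (n - k)) x) summable_on UNIV"
  by (rule summable_on_M_test(1)[OF conv_summable_row[OF assms] conv_norm_le[OF assms]])

lemma L_add_closed:
  assumes a: "a \<in> elems L" and b: "b \<in> elems L"
  shows "add L a b \<in> elems L"
  unfolding L_ops
proof (rule L_dominated)
  show "(\<lambda>x. a n x + b n x) \<in> C_on XE (ext_dom X D \<alpha> n)" for n
    by (intro C_on_intros L_C_on a b)
  show "(\<lambda>n. sup_norm (a n) + sup_norm (b n)) summable_on UNIV"
    by (intro summable_on_add L_summable a b)
  show "sup_norm (\<lambda>x. a n x + b n x) \<le> sup_norm (a n) + sup_norm (b n)" for n
    by (intro E.sup_norm_triangle L_C_all a b)
qed

lemma L_scale_closed:
  assumes a: "a \<in> elems L"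
  shows "scale L c a \<in> elems L"
  unfolding L_ops
proof (rule L_dominated)
  show "(\<lambda>x. c * a n x) \<in> C_on XE (ext_dom X D \<alpha> n)" for n
    by (intro C_on_intros L_C_on a)
  show "(\<lambda>n. cmod c * sup_norm (a n)) summable_on UNIV"
    by (intro summable_on_cmult_right L_summable a)
  show "sup_norm (\<lambda>x. c * a n x) \<le> cmod c * sup_norm (a n)" for n
    by (intro E.sup_norm_scale_le L_C_all a)
qed

lemma L_star_closed:
  assumes a: "a \<in> elems L"
  shows "star L a \<in> elems L"
proof (rule L_dominated)
  have c: "(\<lambda>y. cnj (a (- n) y)) \<in> C_on XE (ext_dom X D \<alpha> (- n))" for n
    by (intro C_on_intros L_C_on a)
  show "star L a n \<in> C_on XE (ext_dom X D \<alpha> n)" for n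
    unfolding L_star[OF a] by (rule dEpow_C_on(2)[OF c])
  show "(\<lambda>n. sup_norm (a (- n))) summable_on UNIV"
    using L_summable[OF a] summable_on_reindex_bij_betw[OF bij_uminus, of "\<lambda>n. sup_norm (a n)"] by simp
  show "sup_norm (star L a n) \<le> sup_norm (a (- n))" for n
    unfolding L_star[OF a]
    using sup_norm_dEpow_le[OF C_on_mono[OF c ext_dom_Y], of n n] by simp
qed

lemma L_single:
  assumes b: "b \<in> C_on XE (ext_dom X D \<alpha> n)"
  shows "(\<lambda>m. if m = n then b else (\<lambda>_. 0)) \<in> elems L"
proof (rule L_dominated)
  show "(if m = n then b else (\<lambda>_. 0)) \<in> C_on XE (ext_dom X D \<alpha> m)" for m
    using b by (auto intro: C_on_intros)
  show "(\<lambda>m. if m = n then sup_norm b else 0) summable_on UNIV"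
    by (rule summable_on_cong_neutral[THEN iffD2, OF _ _ _ summable_on_finite[of "{n}" "\<lambda>_. sup_norm b"]]) auto
qed simp

lemma unitL_closed: "unitL \<in> elems L"
  using L_single[of "chi 0" 0] chi_closed[of 0] by (simp add: ext_dom_0 unitL_def[abs_def])

sublocale LA: unital_nonassoc_star_algebra L unitL
proof
  fix a b c :: "int \<Rightarrow> (nat \<Rightarrow> 'x option) \<Rightarrow> complex" and z :: complex
  assume a: "a \<in> elems L"
  show "0 \<le> nrm L a"
    using a by (auto simp: L_ops intro!: infsum_nonneg E.sup_norm_nonneg L_C_all)
  show "scale L z a \<in> elems L" "star L a \<in> elems L"
    using a by (rule L_scale_closed, rule L_star_closed)
  show "mult L unitL a = a"
  proof (intro ext)
    fix n x
    have "mult L unitL a n x = (\<Sum>\<^sub>\<infinity>k. unitL k x * dEpow k (a (n - k)) x)"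
      by (simp add: L_mult[OF unitL_closed a])
    also have "\<dots> = (\<Sum>\<^sub>\<infinity>k\<in>{0}. unitL k x * dEpow k (a (n - k)) x)"
      by (rule infsum_cong_neutral) (auto simp: unitL_def)
    finally show "mult L unitL a n x = a n x"
      using C_onD(2)[OF L_C_all[OF a], of x n] by (simp add: unitL_def chi_0)
  qed
  show "mult L a unitL = a"
  proof (intro ext)
    fix n x
    have "mult L a unitL n x = (\<Sum>\<^sub>\<infinity>k. a k x * dEpow k (unitL (n - k)) x)"
      by (simp add: L_mult[OF a unitL_closed])
    also have "\<dots> = (\<Sum>\<^sub>\<infinity>k\<in>{n}. a k x * dEpow k (unitL (n - k)) x)"
      by (rule infsum_cong_neutral) (auto simp: unitL_def)
    finally show "mult L a unitL n x = a n x"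
      using C_onD(2)[OF L_C_on[OF a], of x n] by (simp add: unitL_def chi_dEpow[symmetric] chi_def)
  qed
  show "star L (scale L z a) = scale L (cnj z) (star L a)"
    by (intro ext) (simp add: L_star[OF L_scale_closed[OF a]], simp add: L_ops L_star[OF a] dEpow_pointwise(3))
  show "star L (star L a) = a"
  proof
    fix n
    have van: "\<And>x. x \<notin> Y \<Longrightarrow> a n x = 0" using C_onD(2)[OF L_C_all[OF a]] .
    \<comment> \<open>Two stars give the powers \<open>n\<close> and \<open>- n\<close> of the
      automorphism, which compose to the cut-off \<open>chi n\<close>; this is \<open>1\<close> on
      the support of \<open>a n\<close>.\<close>
    have "star L (star L a) n = dEpow n (dEpow (- n) (a n))"
      by (simp add: L_star[OF L_star_closed[OF a]] L_star[OF a] dEpow_pointwise(4)[symmetric])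
    also have "\<dots> = (\<lambda>x. chi n x * a n x)" by (simp add: dEpow_dEpow[OF van])
    also have "\<dots> = a n" using C_onD(2)[OF L_C_on[OF a]] by (auto simp: chi_def)
    finally show "star L (star L a) n = a n" .
  qed
  assume b: "b \<in> elems L"
  show "add L a b \<in> elems L" "mult L a b \<in> elems L"
    using a b by (rule L_add_closed, rule L_mult_closed)
  show "mult L (scale L z a) b = scale L z (mult L a b)"
    "mult L a (scale L z b) = scale L z (mult L a b)"
    by (intro ext; simp add: L_mult[OF L_scale_closed[OF a] b] L_mult[OF a L_scale_closed[OF b]];
        simp add: L_ops L_mult[OF a b] dEpow_pointwise(3) mult_ac infsum_cmult_right'[symmetric])+
  show "star L (add L a b) = add L (star L a) (star L b)"
    by (intro ext) (simp add: L_star[OF L_add_closed[OF a b]],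
        simp add: L_ops L_star[OF a] L_star[OF b] dEpow_pointwise)
  assume c: "c \<in> elems L"
  show "mult L (add L a b) c = add L (mult L a c) (mult L b c)"
    using infsum_add[OF conv_summable_pointwise[OF a c] conv_summable_pointwise[OF b c]]
    by (intro ext) (simp add: L_mult[OF L_add_closed[OF a b] c],
        simp add: L_ops L_mult[OF a c] L_mult[OF b c] distrib_right)
  show "mult L a (add L b c) = add L (mult L a b) (mult L a c)"
    using infsum_add[OF conv_summable_pointwise[OF a b] conv_summable_pointwise[OF a c]]
    by (intro ext) (simp add: L_mult[OF a L_add_closed[OF b c]],
        simp add: L_ops L_mult[OF a b] L_mult[OF a c] distrib_left dEpow_pointwise)
next
  show "unitL \<in> elems L" by (rule unitL_closed)
  have "dEpow n (\<lambda>y. cnj (unitL (- n) y)) = unitL n" for n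
  proof (cases "n = 0")
    case True
    then show ?thesis by (auto simp: unitL_def chi_0)
  next
    case False
    then show ?thesis by (simp add: unitL_def)
  qed
  then show "star L unitL = unitL" by (intro ext) (simp add: L_star[OF unitL_closed])
qed (auto simp: L_ops fun_eq_iff algebra_simps)

end

lemma bounded_linear_comp_left: "bounded_linear (\<lambda>S. S o\<^sub>L V)"
  and bounded_linear_comp_right: "bounded_linear (\<lambda>S. V o\<^sub>L S)"
  by (rule bounded_bilinear.bounded_linear_left[OF bounded_bilinear_blinfun_compose],
      rule bounded_bilinear.bounded_linear_right[OF bounded_bilinear_blinfun_compose])

lemma has_sum_closed:
  fixes f :: "'a \<Rightarrow> 'b::real_normed_vector"
  assumes f: "(f has_sum S) A" and C: "closed C" and sum: "\<And>F. finite F \<Longrightarrow> F \<subseteq> A \<Longrightarrow> sum f F \<in> C"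
  shows "S \<in> C"
proof (rule Lim_in_closed_set[OF C])
  show "(sum f \<longlongrightarrow> S) (finite_subsets_at_top A)" using f by (simp add: has_sum_def)
  show "\<forall>\<^sub>F F in finite_subsets_at_top A. sum f F \<in> C"
    by (rule eventually_finite_subsets_at_top_weakI) (rule sum)
qed simp

lemma sum_bounded_ops: "(\<And>n. n \<in> F \<Longrightarrow> f n \<in> bounded_ops) \<Longrightarrow> sum f F \<in> bounded_ops"
  by (induction F rule: infinite_finite_induct) auto

lemma adj_zero: "adj 0 = 0"
  by (rule adj_eqI) (simp add: blinfun.bilinear_simps)

lemma adj_sum: "(\<And>n. n \<in> F \<Longrightarrow> f n \<in> bounded_ops) \<Longrightarrow> adj (sum f F) = (\<Sum>n\<in>F. adj (f n))"
  by (induction F rule: infinite_finite_induct) (auto simp: adj_zero adj_add sum_bounded_ops)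

lemma has_sum_adj:
  assumes f: "(f has_sum S) UNIV" and bounded: "\<And>n. f n \<in> bounded_ops"
  shows "((\<lambda>n. adj (f n)) has_sum adj S) UNIV"
proof -
  have "((\<lambda>F. adj (sum f F)) \<longlongrightarrow> adj S) (finite_subsets_at_top UNIV)"
    using f bounded by (intro tendsto_adj sum_bounded_ops) (auto simp: has_sum_def)
  then show ?thesis by (simp add: has_sum_def adj_sum bounded)
qed

section \<open>The integrated representation\<close>

context covariant_system
begin

lemma piB_sum:
  "finite F \<Longrightarrow> (\<And>k. k \<in> F \<Longrightarrow> f k \<in> C_all XE) \<Longrightarrow> piB (\<lambda>x. \<Sum>k\<in>F. f k x) = (\<Sum>k\<in>F. piB (f k))"
  by (induction F rule: finite_induct) (auto simp: piB_zero piB_add C_on_sum)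

text \<open>The pointwise series converges in the supremum norm, with respect to which
  \<open>piB\<close> is contractive.\<close>

lemma piB_infsum:
  fixes f :: "'k \<Rightarrow> (nat \<Rightarrow> 'x option) \<Rightarrow> complex"
  assumes f: "\<And>k. f k \<in> C_all XE" and w: "w summable_on UNIV" and le: "\<And>k x. cmod (f k x) \<le> w k"
  shows "((\<lambda>k. piB (f k)) has_sum piB (\<lambda>x. \<Sum>\<^sub>\<infinity>k. f k x)) UNIV"
  unfolding has_sum_def
proof (rule tendstoI)
  fix r :: real assume r: "r > 0"
  define g where "g x = (\<Sum>\<^sub>\<infinity>k. f k x)" for x
  have g: "g \<in> C_all XE" unfolding g_def by (rule C_on_infsum[OF f w le])
  show "\<forall>\<^sub>F F in finite_subsets_at_top UNIV. dist (\<Sum>k\<in>F. piB (f k)) (piB (\<lambda>x. \<Sum>\<^sub>\<infinity>k. f k x)) < r"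
    using eventually_infsum_tail[OF w r]
  proof (rule eventually_mono)
    fix F assume F: "finite F \<and> infsum w UNIV - sum w F < r"
    define s where "s x = (\<Sum>k\<in>F. f k x)" for x
    have s: "s \<in> C_all XE" unfolding s_def using F f by (intro C_on_sum) auto
    have "piB (\<lambda>x. g x + (-1) * s x) = piB g - piB s"
      using g s by (simp only: piB_add piB_scale C_on_intros scale_op_simps add_uminus_conv_diff)
    then have "norm (piB g - piB s) \<le> sup_norm (\<lambda>x. g x + (-1) * s x)"
      using norm_piB_le[of "\<lambda>x. g x + (-1) * s x"] g s C_on_intros(2,4) by metis
    also have "\<dots> \<le> infsum w UNIV - sum w F"
      using infsum_tail_le[OF w le] F by (intro sup_norm_least) (simp add: g_def s_def)
    finally show "dist (\<Sum>k\<in>F. piB (f k)) (piB (\<lambda>x. \<Sum>\<^sub>\<infinity>k. f k x)) < r"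
      using F f piB_sum[of F f] unfolding g_def[symmetric] s_def[abs_def]
      by (simp add: dist_norm norm_minus_commute)
  qed
qed

text \<open>The integrated form of the pair of \<open>piB\<close> and \<open>U\<close>.\<close>

definition Phi :: "(int \<Rightarrow> (nat \<Rightarrow> 'x option) \<Rightarrow> complex) \<Rightarrow> 'h \<Rightarrow>\<^sub>L 'h" where
  "Phi a = (\<Sum>\<^sub>\<infinity>n. piB (a n) o\<^sub>L Uint n)"

lemma norm_term_le:
  assumes "b \<in> C_all XE"
  shows "norm (piB b o\<^sub>L Uint n) \<le> sup_norm b"
proof -
  have "norm (piB b o\<^sub>L Uint n) \<le> norm (piB b) * norm (Uint n)" by (rule norm_blinfun_compose)
  also have "\<dots> \<le> sup_norm b * 1"
    using assms by (intro mult_mono norm_piB_le norm_Uint E.sup_norm_nonneg) auto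
  finally show ?thesis by simp
qed

lemma Phi_summable: "a \<in> elems L \<Longrightarrow> (\<lambda>n. piB (a n) o\<^sub>L Uint n) summable_on UNIV"
  and norm_Phi_le: "a \<in> elems L \<Longrightarrow> norm (Phi a) \<le> nrm L a"
  unfolding Phi_def L_ops
  by (rule summable_on_M_test[OF L_summable norm_term_le[OF L_C_all]]; assumption)+

lemma Phi_has_sum: "a \<in> elems L \<Longrightarrow> ((\<lambda>n. piB (a n) o\<^sub>L Uint n) has_sum Phi a) UNIV"
  unfolding Phi_def by (rule has_sum_infsum[OF Phi_summable])

lemma term_bounded: "b \<in> C_all XE \<Longrightarrow> piB b o\<^sub>L Uint n \<in> bounded_ops"
  by auto

lemma Phi_bounded:
  assumes "a \<in> elems L"
  shows "Phi a \<in> bounded_ops"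
  by (rule has_sum_closed[OF Phi_has_sum[OF assms] closed_bounded_ops])
    (intro sum_bounded_ops term_bounded L_C_all assms)

lemma Phi_add: "a \<in> elems L \<Longrightarrow> b \<in> elems L \<Longrightarrow> Phi (add L a b) = Phi a + Phi b"
  unfolding Phi_def L_ops
  by (simp add: infsum_add[symmetric] Phi_summable piB_add L_C_all comp_simps)

lemma Phi_scale:
  assumes a: "a \<in> elems L"
  shows "Phi (scale L c a) = scale_op c (Phi a)"
proof -
  have "((\<lambda>n. scale_op c (piB (a n) o\<^sub>L Uint n)) has_sum scale_op c (Phi a)) UNIV"
  proof -
    have "scale_op c (sum f F) = (\<Sum>n\<in>F. scale_op c (f n))" for f :: "int \<Rightarrow> 'h \<Rightarrow>\<^sub>L 'h" and F
      by (induction F rule: infinite_finite_induct)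
        (auto simp: scale_op_simps intro!: blinfun_eqI)
    then show ?thesis
      using tendsto_scale_op[OF Phi_has_sum[OF a, unfolded has_sum_def], of c] by (simp add: has_sum_def)
  qed
  then have "(\<Sum>\<^sub>\<infinity>n. scale_op c (piB (a n) o\<^sub>L Uint n)) = scale_op c (Phi a)" by (rule infsumI)
  then show ?thesis
    using L_C_all[OF a] by (simp add: Phi_def L_ops piB_scale scale_op_simps)
qed

lemma Phi_star:
  assumes a: "a \<in> elems L"
  shows "Phi (star L a) = adj (Phi a)"
proof -
  have eq: "adj (piB (a (- n)) o\<^sub>L Uint (- n)) = piB (star L a n) o\<^sub>L Uint n" for n
  proof -
    have b: "(\<lambda>y. cnj (a (- n) y)) \<in> C_all XE" using L_C_all[OF a] by (intro C_on_intros)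
    have "adj (piB (a (- n)) o\<^sub>L Uint (- n)) = Uint n o\<^sub>L (piB (\<lambda>y. cnj (a (- n) y)) o\<^sub>L Uint 0)"
      using L_C_all[OF a] by (simp add: adj_comp adj_Uint piB_star)
    also have "\<dots> = piB (star L a n) o\<^sub>L Uint n"
      unfolding Uint_piB_Uint[OF b] by (simp add: L_star[OF a])
    finally show ?thesis .
  qed
  have "((\<lambda>n. adj (piB (a n) o\<^sub>L Uint n)) has_sum adj (Phi a)) UNIV"
    by (rule has_sum_adj[OF Phi_has_sum[OF a] term_bounded[OF L_C_all[OF a]]])
  then have "((\<lambda>n. adj (piB (a (- n)) o\<^sub>L Uint (- n))) has_sum adj (Phi a)) UNIV"
    using has_sum_reindex_bij_betw[OF bij_uminus, of "\<lambda>n. adj (piB (a n) o\<^sub>L Uint n)"] by simp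
  then show ?thesis unfolding eq Phi_def[of "star L a"] by (rule infsumI)
qed

text \<open>The family \<open>M n k\<close> is absolutely summable and is summed in two ways: over
  \<open>k\<close> first it gives the coefficients of the convolution, over \<open>n\<close> first
  the composition of the two operators.\<close>

lemma Phi_mult:
  assumes a: "a \<in> elems L" and b: "b \<in> elems L"
  shows "Phi (mult L a b) = Phi a o\<^sub>L Phi b"
proof -
  define M where "M n k = (piB (a k) o\<^sub>L Uint k) o\<^sub>L (piB (b (n - k)) o\<^sub>L Uint (n - k))" for n k
  have term_eq: "piB (\<lambda>x. a k x * dEpow k (b (n - k)) x) o\<^sub>L Uint n = M n k" for n k
  proof -
    have "M n k = piB (a k) o\<^sub>L (Uint k o\<^sub>L (piB (b (n - k)) o\<^sub>L Uint (n - k)))"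
      by (simp add: M_def blinfun_compose_assoc)
    also have "\<dots> = piB (a k) o\<^sub>L (piB (dEpow k (b (n - k))) o\<^sub>L Uint n)"
      using Uint_piB_Uint[OF L_C_all[OF b], of k "n - k" "n - k"] by simp
    finally show ?thesis
      by (simp add: piB_mult L_C_all a b dEpow_closed blinfun_compose_assoc)
  qed
  have row: "(\<Sum>\<^sub>\<infinity>k. M n k) = piB (mult L a b n) o\<^sub>L Uint n" for n
  proof -
    have "((\<lambda>k. piB (\<lambda>x. a k x * dEpow k (b (n - k)) x)) has_sum piB (mult L a b n)) UNIV"
      unfolding L_mult[OF a b]
      by (rule piB_infsum[OF C_on_mono[OF conv_C_on[OF a b] ext_dom_Y] conv_summable_row[OF a b]
            conv_norm_le[OF a b]])
    from has_sum_bounded_linear[OF bounded_linear_comp_left this, of "Uint n"]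
    show ?thesis unfolding term_eq by (rule infsumI)
  qed
  have col: "(\<Sum>\<^sub>\<infinity>n. M n k) = (piB (a k) o\<^sub>L Uint k) o\<^sub>L Phi b" for k
  proof -
    have "bij_betw (\<lambda>n. n - k) UNIV UNIV"
      by (rule bij_betw_byWitness[of _ "\<lambda>n. n + k"]) auto
    then have "((\<lambda>n. piB (b (n - k)) o\<^sub>L Uint (n - k)) has_sum Phi b) UNIV"
      using Phi_has_sum[OF b] has_sum_reindex_bij_betw[of "\<lambda>n. n - k" UNIV UNIV "\<lambda>n. piB (b n) o\<^sub>L Uint n"]
      by simp
    from has_sum_bounded_linear[OF bounded_linear_comp_right this, of "piB (a k) o\<^sub>L Uint k"]
    show ?thesis unfolding M_def by (rule infsumI)
  qed
  have "(\<lambda>(n, k). M n k) summable_on UNIV \<times> UNIV"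
  proof (rule summable_on_M_test(1)[OF conv_summable[OF a b]])
    fix p :: "int \<times> int"
    obtain n k where p: "p = (n, k)" by (cases p)
    have "norm (M n k) \<le> norm (piB (a k) o\<^sub>L Uint k) * norm (piB (b (n - k)) o\<^sub>L Uint (n - k))"
      unfolding M_def by (rule norm_blinfun_compose)
    also have "\<dots> \<le> sup_norm (a k) * sup_norm (b (n - k))"
      by (intro mult_mono norm_term_le L_C_all E.sup_norm_nonneg a b) auto
    finally show "norm (case p of (n, k) \<Rightarrow> M n k) \<le>
        (case p of (n, k) \<Rightarrow> sup_norm (a k) * sup_norm (b (n - k)))"
      by (simp add: p)
  qed
  then have "(\<Sum>\<^sub>\<infinity>n. \<Sum>\<^sub>\<infinity>k. M n k) = (\<Sum>\<^sub>\<infinity>k. \<Sum>\<^sub>\<infinity>n. M n k)"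
    by (rule infsum_swap_banach)
  moreover have "(\<Sum>\<^sub>\<infinity>k. (piB (a k) o\<^sub>L Uint k) o\<^sub>L Phi b) = Phi a o\<^sub>L Phi b"
    by (rule infsumI, rule has_sum_bounded_linear[OF bounded_linear_comp_left Phi_has_sum[OF a]])
  ultimately show ?thesis by (simp add: row col Phi_def[of "mult L a b"])
qed

sublocale rep: contractive_star_rep L unitL Phi
proof
  show "star_hom L (op_algebra bounded_ops) Phi"
    by (auto simp: star_hom_def op_algebra_def Phi_bounded Phi_add Phi_scale Phi_mult Phi_star)
qed (rule norm_Phi_le)

lemma Phi_finite:
  assumes "a \<in> elems L" "finite F" "\<And>n. n \<notin> F \<Longrightarrow> a n = (\<lambda>_. 0)"
  shows "Phi a = (\<Sum>n\<in>F. piB (a n) o\<^sub>L Uint n)"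
proof -
  have "Phi a = (\<Sum>\<^sub>\<infinity>n\<in>F. piB (a n) o\<^sub>L Uint n)"
    unfolding Phi_def by (rule infsum_cong_neutral) (auto simp: assms(3) piB_zero comp_simps)
  then show ?thesis using assms(2) by simp
qed

section \<open>The generated C*-algebra and the formula on trigonometric polynomials\<close>

abbreviation generators :: "('h \<Rightarrow>\<^sub>L 'h) set" where
  "generators \<equiv> insert U (\<pi> ` C_all X)"

definition cstar_closed :: "('h \<Rightarrow>\<^sub>L 'h) set \<Rightarrow> bool" where
  "cstar_closed S \<longleftrightarrow> generators \<subseteq> S \<and> S \<subseteq> bounded_ops \<and> closed S \<and> 0 \<in> S \<and>
     (\<forall>S1\<in>S. \<forall>S2\<in>S. S1 + S2 \<in> S \<and> S1 o\<^sub>L S2 \<in> S) \<and>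
     (\<forall>V\<in>S. adj V \<in> S \<and> (\<forall>c. scale_op c V \<in> S))"

lemma Phi_in_cstar_closed:
  assumes S: "cstar_closed S" and a: "a \<in> elems L"
  shows "Phi a \<in> S"
proof -
  have gen: "U \<in> S" "\<And>a. a \<in> C_all X \<Longrightarrow> \<pi> a \<in> S"
    and cl: "closed S" "0 \<in> S" "\<And>S1 S2. S1 \<in> S \<Longrightarrow> S2 \<in> S \<Longrightarrow> S1 + S2 \<in> S"
      "\<And>S1 S2. S1 \<in> S \<Longrightarrow> S2 \<in> S \<Longrightarrow> S1 o\<^sub>L S2 \<in> S" "\<And>V. V \<in> S \<Longrightarrow> adj V \<in> S"
    using S by (auto simp: cstar_closed_def)
  have T: "T k a \<in> S" if "a \<in> C_all X" for k a
    by (induction k) (use that gen cl in \<open>auto simp: T_Suc\<close>)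
  have "V \<in> S" if "(b, V) \<in> R N" for b V N
    using that by (induction rule: R.induct) (auto intro: T cl)
  then have RU: "V \<in> S" if "(b, V) \<in> RU" for b V
    using that by (auto simp: RU_def)
  have piB: "piB b \<in> S" if b: "b \<in> C_all XE" for b
  proof -
    obtain s t where "approx b (piB b) s t" using piB_rel[OF b] by (auto simp: ext_rel_def)
    note st = approxD[OF this]
    show ?thesis by (rule closed_sequentially[OF cl(1) RU[OF st(2)] st(7)])
  qed
  \<comment> \<open>The algebra generated by \<open>U\<close> and the image of \<open>\<pi>\<close>
    may lack the identity operator, so the exponent \<open>0\<close> is set apart; in the terms of
    the series it only occurs next to some \<open>piB b\<close>.\<close>
  have Uint: "Uint k \<in> S \<or> k = 0" for k
  proof (induction k rule: int_cases_induct)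
    case (2 n)
    then have "U o\<^sub>L Uint (int n) \<in> S" using gen(1) cl(4) by (cases "n = 0") auto
    then show ?case by (simp only: Uint_Suc simp_thms)
  next
    case (3 n)
    then have "adj U o\<^sub>L Uint (- int n) \<in> S" using gen(1) cl(4,5) by (cases "n = 0") auto
    then show ?case by (simp only: Uint_minus_Suc simp_thms)
  qed simp
  then have term_in: "piB b o\<^sub>L Uint n \<in> S" if "b \<in> C_all XE" for b n
    using piB[OF that] cl(4) Uint[of n] by (cases "n = 0") auto
  have sum: "sum f F \<in> S" if "\<And>n. f n \<in> S" for f :: "int \<Rightarrow> 'h \<Rightarrow>\<^sub>L 'h" and F
    by (induction F rule: infinite_finite_induct) (auto intro: cl that)
  show ?thesis
    by (rule has_sum_closed[OF Phi_has_sum[OF a] cl(1) sum]) (rule term_in[OF L_C_all[OF a]])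
qed

lemma Phi_single:
  assumes b: "b \<in> C_on XE (ext_dom X D \<alpha> n)"
  shows "Phi (\<lambda>m. if m = n then b else (\<lambda>_. 0)) = piB b o\<^sub>L Uint n"
  using Phi_finite[OF L_single[OF b], of "{n}"] by simp

lemma chi_1: "chi 1 = ecoord 0 (ind D)"
proof
  show "chi 1 x = ecoord 0 (ind D) x" for x
    using ext_proj_Y[of x]
    by (auto simp: chi_def ext_dom_1 ecoord_def ind_def ext_preimage_def)
qed

text \<open>The closure of the image is itself one of the sets that are intersected, and it is
  contained in all of them because \<open>Phi a\<close> is a norm limit of polynomials in the
  generators.\<close>

lemma cstar_generated_eq: "cstar_generated generators = closure (Phi ` elems L)"
proof
  have gen: "generators \<subseteq> Phi ` elems L"
  proof -
    have c: "chi 1 \<in> C_on XE (ext_dom X D \<alpha> 1)"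
      using C_onD(1)[OF chi_closed, of 1] by (simp add: C_on_def chi_def)
    \<comment> \<open>The coefficient at \<open>n = 1\<close> must be supported in the domain of the
      extended map. The indicator of that domain is the right choice because its operator
      \<open>\<pi> (ind D)\<close> is the final projection of \<open>U\<close>.\<close>
    have "piB (chi 1) o\<^sub>L Uint 1 = U"
      using Uint_Suc[of 0] by (simp add: chi_1 piB_ecoord U_final)
    then have "U \<in> Phi ` elems L"
      by (intro image_eqI[OF _ L_single[OF c]]) (simp add: Phi_single[OF c])
    moreover have "\<pi> a \<in> Phi ` elems L" if a: "a \<in> C_all X" for a
    proof -
      have c: "ecoord 0 a \<in> C_on XE (ext_dom X D \<alpha> 0)" using a by (simp add: ext_dom_0 ecoord_closed)
      have "piB (ecoord 0 a) o\<^sub>L Uint 0 = \<pi> a" using a by (simp add: piB_ecoord)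
      then show ?thesis
        by (intro image_eqI[OF _ L_single[OF c]]) (simp add: Phi_single[OF c])
    qed
    ultimately show ?thesis by auto
  qed
  have "0 \<in> closure (Phi ` elems L)"
  proof -
    have "(\<lambda>_ _. 0) \<in> elems L" by (simp add: L_iff C_on_intros)
    moreover have "Phi (\<lambda>_ _. 0) = 0" by (simp add: Phi_def piB_zero comp_simps)
    ultimately show ?thesis using closure_subset by (metis (no_types, lifting) imageI subsetD)
  qed
  moreover have "generators \<subseteq> closure (Phi ` elems L)"
    using gen closure_subset by blast
  ultimately have "cstar_closed (closure (Phi ` elems L))"
    unfolding cstar_closed_def using rep.closure_star_algebra by (simp add: subset_iff)
  then show "cstar_generated generators \<subseteq> closure (Phi ` elems L)"
    unfolding cstar_generated_def cstar_closed_def by (rule Inter_lower[OF CollectI])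
  show "closure (Phi ` elems L) \<subseteq> cstar_generated generators"
    unfolding cstar_generated_def
  proof (rule Inter_greatest)
    fix S
    assume "S \<in> {S. generators \<subseteq> S \<and> S \<subseteq> bounded_ops \<and> closed S \<and> 0 \<in> S \<and>
     (\<forall>S1\<in>S. \<forall>S2\<in>S. S1 + S2 \<in> S \<and> S1 o\<^sub>L S2 \<in> S) \<and>
     (\<forall>V\<in>S. adj V \<in> S \<and> (\<forall>c. scale_op c V \<in> S))}"
    then have S: "cstar_closed S" unfolding mem_Collect_eq cstar_closed_def .
    then have "closed S" by (simp add: cstar_closed_def)
    then show "closure (Phi ` elems L) \<subseteq> S"
      using Phi_in_cstar_closed[OF S] by (intro closure_minimal) auto
  qed
qed

text \<open>Both series have only finitely many nonzero terms, on the same index set. This places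
  the operator series of the final formula over the function it belongs to.\<close>

lemma coeff_fun_RU:
  assumes a: "coeff_seq X D \<alpha> a"
  shows "(coeff_fun X D \<alpha> a, \<Sum>k. T k (a k)) \<in> RU"
proof -
  define K where "K = {n. a n \<noteq> (\<lambda>_. 0)}"
  have K: "finite K" and aC: "\<And>k. a k \<in> C_all X"
    using a C_on_mono[OF _ power_dom_subset] by (auto simp: K_def coeff_seq_def)
  have "((\<lambda>x. \<Sum>k\<in>J. ecoord k (a k) x), \<Sum>k\<in>J. T k (a k)) \<in> RU" if "finite J" for J
    using that
  proof (induction J rule: finite_induct)
    case empty
    then show ?case
      using RU_gen[of "\<lambda>_. 0" 0] T_zero[of 0] by (simp add: C_on_intros ecoord_zero)
  next
    case (insert k J)
    then show ?case using RU_plus[OF RU_gen[OF aC[of k]] insert.IH] by simp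
  qed
  from this[OF K]
  have "((\<lambda>x. \<Sum>k\<in>K. ecoord k (a k) x), \<Sum>k\<in>K. T k (a k)) \<in> RU" .
  moreover have "coeff_fun X D \<alpha> a = (\<lambda>x. \<Sum>k\<in>K. ecoord k (a k) x)"
  proof
    fix x
    have "(\<Sum>k. case_option 0 (a k) (x k)) = (\<Sum>k\<in>K. case_option 0 (a k) (x k))"
      by (rule suminf_finite[OF K]) (auto simp: K_def split: option.split)
    then show "coeff_fun X D \<alpha> a x = (\<Sum>k\<in>K. ecoord k (a k) x)"
      by (simp add: coeff_fun_def ecoord_def)
  qed
  moreover have "(\<Sum>k. T k (a k)) = (\<Sum>k\<in>K. T k (a k))"
    by (rule suminf_finite[OF K]) (auto simp: K_def T_zero)
  ultimately show ?thesis by simp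
qed

lemma trig_poly_closed:
  assumes "\<And>n. n \<in> {- int N..int N} \<Longrightarrow> b n \<in> C_on XE (ext_dom X D \<alpha> n)"
  shows "trig_poly N b \<in> elems L"
proof (rule L_dominated)
  show "trig_poly N b n \<in> C_on XE (ext_dom X D \<alpha> n)" for n
    using assms[of n] by (auto simp: trig_poly_def C_on_intros abs_le_iff)
  show "(\<lambda>n. sup_norm (trig_poly N b n)) summable_on UNIV"
    by (rule summable_on_cong_neutral[THEN iffD2, OF _ _ _
          summable_on_finite[of "{- int N..int N}" "\<lambda>n. sup_norm (b n)"]])
      (auto simp: trig_poly_def)
qed simp

lemma Phi_trig_poly:
  assumes "\<And>n. n \<in> {- int N..int N} \<Longrightarrow> b n \<in> C_on XE (ext_dom X D \<alpha> n)"
  shows "Phi (trig_poly N b) = (\<Sum>n=- int N..int N. piB (b n) o\<^sub>L Uint n)"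
proof -
  have "Phi (trig_poly N b) = (\<Sum>n=- int N..int N. piB (trig_poly N b n) o\<^sub>L Uint n)"
    by (rule Phi_finite[OF trig_poly_closed[OF assms]]) (auto simp: trig_poly_def)
  also have "\<dots> = (\<Sum>n=- int N..int N. piB (b n) o\<^sub>L Uint n)"
    by (rule sum.cong) (auto simp: trig_poly_def)
  finally show ?thesis .
qed

end

theorem theorem4p7:
  fixes X :: "'x topology" and D :: "'x set" and \<alpha> :: "'x \<Rightarrow> 'x"
    and \<pi> :: "('x \<Rightarrow> complex) \<Rightarrow> ('h::complex_hilbert_space \<Rightarrow>\<^sub>L 'h)" and U :: "'h \<Rightarrow>\<^sub>L 'h"
  assumes "compact_space X" and "Hausdorff_space X"
    and "openin X D" and "closedin X D"
    and "continuous_map (subtopology X D) X \<alpha>" and "openin X (\<alpha> ` D)"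
    and "cov_faith_rep X D \<alpha> \<pi> U \<or>
         (cov_rep X D \<alpha> \<pi> U \<and> inj_on (pullback D \<alpha>) (C_all X))"
  shows "\<exists>\<Psi>. star_epimorphism (covariance_algebra X D \<alpha>)
               (op_algebra (cstar_generated (insert U (\<pi> ` C_all X)))) \<Psi> \<and>
           (\<forall>(N::nat) (a :: int \<Rightarrow> nat \<Rightarrow> 'x \<Rightarrow> complex).
              (\<forall>n\<in>{- int N..int N}. coeff_seq X D \<alpha> (a n) \<and>
                 coeff_fun X D \<alpha> (a n) \<in> C_on (ext_space X D \<alpha>) (ext_dom X D \<alpha> n)) \<longrightarrow>
              \<Psi> (env_embed (L_algebra X D \<alpha>) (trig_poly N (\<lambda>n. coeff_fun X D \<alpha> (a n)))) =
              (\<Sum>n=- int N..int N.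
                 (\<Sum>k. op_power (adj U) k o\<^sub>L \<pi> (a n k) o\<^sub>L op_power U k) o\<^sub>L op_power_int U n))"
proof -
  have "cov_rep X D \<alpha> \<pi> U" using assms(7) by (auto simp: cov_faith_rep_def)
  then interpret covariant_system X D \<alpha> \<pi> U
    by unfold_locales (use assms in auto)
  show ?thesis
  proof (intro exI[of _ rep.extension] conjI allI impI)
    show "star_epimorphism (covariance_algebra X D \<alpha>)
        (op_algebra (cstar_generated (insert U (\<pi> ` C_all X)))) rep.extension"
      unfolding covariance_algebra_def cstar_generated_eq by (rule rep.extension_epimorphism)
    fix N :: nat and a :: "int \<Rightarrow> nat \<Rightarrow> 'x \<Rightarrow> complex"
    assume "\<forall>n\<in>{- int N..int N}. coeff_seq X D \<alpha> (a n) \<and>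
      coeff_fun X D \<alpha> (a n) \<in> C_on (ext_space X D \<alpha>) (ext_dom X D \<alpha> n)"
    then have a: "coeff_seq X D \<alpha> (a n)" "coeff_fun X D \<alpha> (a n) \<in> C_on XE (ext_dom X D \<alpha> n)"
      if "n \<in> {- int N..int N}" for n
      using that by auto
    have "rep.extension (env_embed L (trig_poly N (\<lambda>n. coeff_fun X D \<alpha> (a n)))) =
        (\<Sum>n=- int N..int N. piB (coeff_fun X D \<alpha> (a n)) o\<^sub>L Uint n)"
      using rep.extension_embed[OF trig_poly_closed[OF a(2)]] Phi_trig_poly[OF a(2)] by simp
    also have "\<dots> = (\<Sum>n=- int N..int N.
        (\<Sum>k. op_power (adj U) k o\<^sub>L \<pi> (a n k) o\<^sub>L op_power U k) o\<^sub>L op_power_int U n)"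
      by (rule sum.cong) (simp_all add: piB_RU[OF coeff_fun_RU[OF a(1)]] T_def)
    finally show "rep.extension (env_embed L (trig_poly N (\<lambda>n. coeff_fun X D \<alpha> (a n)))) =
        (\<Sum>n=- int N..int N.
          (\<Sum>k. op_power (adj U) k o\<^sub>L \<pi> (a n k) o\<^sub>L op_power U k) o\<^sub>L op_power_int U n)" .
  qed
qed

end
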